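(* Let $k\in\mathbb{N}$, let $\mathbb{D}_Q\subset\mathbb{M}^d$ be an NC operator ball, and let $P\in M_k(\mathbb{C}\langle Z\rangle)$ be $Q$-stable with atomic factorization $P=P_1P_2\cdots P_l$ (each $P_j\in M_k(\mathbb{C}\langle Z\rangle)$ an atom). Then $$\sup_{0\le r<1}\big\|\big(P_1^{(r)}\big)^{-1}P_1\big(P_2^{(r)}\big)^{-1}P_2\cdots\big(P_l^{(r)}\big)^{-1}P_l\big\|_Q<\infty,$$ $$\sup_{0\le r<1}\big\|P_1\big(P_1^{(r)}\big)^{-1}P_2\big(P_2^{(r)}\big)^{-1}\cdots P_l\big(P_l^{(r)}\big)^{-1}\big\|_Q<\infty.$$
   Context: Fix $d\in\mathbb{N}$. Write $M_n$ for the complex $n\times n$ matrices, $M_n^d$ for $d$-tuples of such matrices, and $\mathbb{M}^d=\bigsqcup_{n\ge1}M_n^d$. Let $\mathcal{H}$ be a Hilbert space, let $\mathcal{E}\subseteq B(\mathcal{H})$ be a $d$-dimensional linear subspace (operator space) with basis $Q_1,\dots,Q_d$, and put $Q(X)=\sum_{j=1}^d Q_j\otimes X_j\in B(\mathcal{H}\otimes\mathbb{C}^n)$ for $X=(X_1,\dots,X_d)\in M_n^d$. The associated NC operator ball is $\mathbb{D}_Q=\{X\in\mathbb{M}^d:\|Q(X)\|<1\}$ (operator norm). $\mathbb{C}\langle Z\rangle$ is the algebra of polynomials over $\mathbb{C}$ in $d$ freely non-commuting variables $Z_1,\dots,Z_d$. An element $P\in M_k(\mathbb{C}\langle Z\rangle)$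 is written $P=\sum_w C_wZ^w$ (finite sum over words $w$ in $\{1,\dots,d\}$, with $C_w\in M_k$) and is evaluated at $X\in M_n^d$ by $P(X)=\sum_w C_w\otimes X^w\in M_k(M_n)$. For $0\le r<1$, $P^{(r)}(X):=P(rX)$. $P$ is $Q$-stable if $\det P(X)\ne0$ for all $X\in\mathbb{D}_Q$. For a matrix-valued function $F$ on $\mathbb{D}_Q$, $\|F\|_Q:=\sup_{X\in\mathbb{D}_Q}\|F(X)\|$ (operator norm); products and inverses of such functions are taken pointwise. $GL_k(\mathbb{C}\langle Z\rangle)$ is the set of $P\in M_k(\mathbb{C}\langle Z\rangle)$ having an inverse in $M_k(\mathbb{C}\langle Z\rangle)$. $P\in M_k(\mathbb{C}\langle Z\rangle)$ is an atom if it is not a product of two elements $F,G\in M_k(\mathbb{C}\langle Z\rangle)$ with $F,G\notin GL_k(\mathbb{C}\langle Z\rangle)$. *)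

theory Defs
  imports
    "HOL-Library.Poly_Mapping"
    "HOL-Library.Extended_Real"
    "Jordan_Normal_Form.Determinant"
    "Jordan_Normal_Form.Gauss_Jordan_Elimination"
begin

section \<open>Complex Hilbert spaces and spaces of bounded operators\<close>

class complex_hilbert = real_normed_vector + complete_space +
  fixes scaleC :: "complex \<Rightarrow> 'a \<Rightarrow> 'a"  (infixr \<open>*\<^sub>C\<close> 75)
    and cinner :: "'a \<Rightarrow> 'a \<Rightarrow> complex"
  assumes scaleC_add_right: "c *\<^sub>C (x + y) = c *\<^sub>C x + c *\<^sub>C y"
    and scaleC_add_left: "(b + c) *\<^sub>C x = b *\<^sub>C x + c *\<^sub>C x"
    and scaleC_scaleC: "b *\<^sub>C c *\<^sub>C x = (b * c) *\<^sub>C x"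
    and scaleC_one: "1 *\<^sub>C x = x"
    and scaleR_scaleC: "a *\<^sub>R x = complex_of_real a *\<^sub>C x"
    and cinner_commute: "cinner x y = cnj (cinner y x)"
    and cinner_add_left: "cinner (x + y) z = cinner x z + cinner y z"
    and cinner_scaleC_left: "cinner (c *\<^sub>C x) y = c * cinner x y"
    and cinner_ge_zero: "0 \<le> Re (cinner x x)"
    and cinner_eq_zero_iff: "cinner x x = 0 \<longleftrightarrow> x = 0"
    and norm_eq_sqrt_cinner: "norm x = sqrt (Re (cinner x x))"

definition bounded_clinear :: "('h::complex_hilbert \<Rightarrow> 'h) \<Rightarrow> bool" where
  "bounded_clinear T \<longleftrightarrow> bounded_linear T \<and> (\<forall>c x. T (c *\<^sub>C x) = c *\<^sub>C T x)"

text \<open>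
  The family \<open>Q\<close> is a basis of the linear subspace \<open>E\<close> of \<open>B(H)\<close>.
  The index type \<open>'d\<close> plays the role of \<open>{1, ..., d}\<close>.
\<close>
definition operator_space_basis ::
    "('h::complex_hilbert \<Rightarrow> 'h) set \<Rightarrow> ('d::finite \<Rightarrow> 'h \<Rightarrow> 'h) \<Rightarrow> bool" where
  "operator_space_basis E Q \<longleftrightarrow>
     (\<forall>j. bounded_clinear (Q j)) \<and>
     (\<forall>c. (\<forall>x. (\<Sum>j\<in>UNIV. c j *\<^sub>C Q j x) = 0) \<longrightarrow> (\<forall>j. c j = 0)) \<and>
     E = range (\<lambda>c x. \<Sum>j\<in>UNIV. c j *\<^sub>C Q j x)"

definition operator_norm :: "'v set \<Rightarrow> ('v \<Rightarrow> real) \<Rightarrow> ('v \<Rightarrow> 'v) \<Rightarrow> real" where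
  "operator_norm V nrm T = (SUP v\<in>{v\<in>V. nrm v \<le> 1}. nrm (T v))"

section \<open>Matrices\<close>

definition vec_norm :: "complex vec \<Rightarrow> real" where
  "vec_norm v = sqrt (\<Sum>i<dim_vec v. (cmod (v $ i))\<^sup>2)"

text \<open>Used for square matrices only.\<close>
definition mat_norm :: "complex mat \<Rightarrow> real" where
  "mat_norm A = operator_norm (carrier_vec (dim_col A)) vec_norm (\<lambda>v. A *\<^sub>v v)"

definition mat_inv :: "complex mat \<Rightarrow> complex mat" where
  "mat_inv A = the (mat_inverse A)"

definition kronecker :: "complex mat \<Rightarrow> complex mat \<Rightarrow> complex mat"  (infixl \<open>\<otimes>\<^sub>K\<close> 70) where
  "A \<otimes>\<^sub>K B = mat (dim_row A * dim_row B) (dim_col A * dim_col B)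
     (\<lambda>(i, j). A $$ (i div dim_row B, j div dim_col B) * B $$ (i mod dim_row B, j mod dim_col B))"

definition mat_list_prod :: "nat \<Rightarrow> 'a::semiring_1 mat list \<Rightarrow> 'a mat" where
  "mat_list_prod n As = foldr (*) As (1\<^sub>m n)"

section \<open>The NC universe and NC operator balls\<close>

type_synonym 'd nc_point = "nat \<times> ('d \<Rightarrow> complex mat)"

definition nc_universe :: "'d nc_point set" where
  "nc_universe = (SIGMA n:{1..}. {X. \<forall>j. X j \<in> carrier_mat n n})"

definition nc_scale :: "real \<Rightarrow> 'd nc_point \<Rightarrow> 'd nc_point" where
  "nc_scale r = (\<lambda>(n, X). (n, \<lambda>j. complex_of_real r \<cdot>\<^sub>m X j))"

text \<open>
  \<open>H \<otimes> \<complex>\<^sup>n\<close> is realised as the Hilbert direct sum of \<open>n\<close> copies of \<open>H\<close>, where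
  \<open>h :: nat \<Rightarrow> 'h\<close> stands for the sum of the \<open>h a \<otimes> e\<^sub>a\<close> over \<open>a < n\<close>.
\<close>
definition tensor_space :: "nat \<Rightarrow> (nat \<Rightarrow> 'h::complex_hilbert) set" where
  "tensor_space n = {h. \<forall>a\<ge>n. h a = 0}"

definition tensor_norm :: "nat \<Rightarrow> (nat \<Rightarrow> 'h::complex_hilbert) \<Rightarrow> real" where
  "tensor_norm n h = sqrt (\<Sum>a<n. (norm (h a))\<^sup>2)"

definition tensor_op ::
    "('h::complex_hilbert \<Rightarrow> 'h) \<Rightarrow> nat \<Rightarrow> complex mat \<Rightarrow> (nat \<Rightarrow> 'h) \<Rightarrow> (nat \<Rightarrow> 'h)" where
  "tensor_op T n A h = (\<lambda>a. if a < n then \<Sum>b<n. A $$ (a, b) *\<^sub>C T (h b) else 0)"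

definition Q_eval ::
    "('d::finite \<Rightarrow> 'h::complex_hilbert \<Rightarrow> 'h) \<Rightarrow> 'd nc_point \<Rightarrow> (nat \<Rightarrow> 'h) \<Rightarrow> (nat \<Rightarrow> 'h)" where
  "Q_eval Q = (\<lambda>(n, X) h a. \<Sum>j\<in>UNIV. tensor_op (Q j) n (X j) h a)"

definition nc_ball :: "('d::finite \<Rightarrow> 'h::complex_hilbert \<Rightarrow> 'h) \<Rightarrow> 'd nc_point set" where
  "nc_ball Q = {Z \<in> nc_universe.
     operator_norm (tensor_space (fst Z)) (tensor_norm (fst Z)) (Q_eval Q Z) < 1}"

text \<open>The value may be \<open>\<infinity>\<close>.\<close>
definition Q_norm ::
    "('d::finite \<Rightarrow> 'h::complex_hilbert \<Rightarrow> 'h) \<Rightarrow> ('d nc_point \<Rightarrow> complex mat) \<Rightarrow> ereal" where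
  "Q_norm Q F = (SUP Z\<in>nc_ball Q. ereal (mat_norm (F Z)))"

section \<open>Matrices over the free algebra\<close>

text \<open>
  The free algebra is the monoid algebra of the free monoid on \<open>'d\<close>. The convolution product of
  \<^typ>\<open>'a \<Rightarrow>\<^sub>0 'b\<close> uses the additive structure of \<open>'a\<close>, so concatenation of words is written \<open>+\<close>.
\<close>
datatype 'd word = Word (letters: "'d list")

instantiation word :: (type) monoid_add
begin

definition zero_word :: "'a word" where
  "0 = Word []"

definition plus_word :: "'a word \<Rightarrow> 'a word \<Rightarrow> 'a word" where
  "u + v = Word (letters u @ letters v)"

instance
  by standard (simp_all add: zero_word_def plus_word_def)

end

type_synonym 'd nc_poly = "'d word \<Rightarrow>\<^sub>0 complex"

definition nc_coeff :: "'d nc_poly mat \<Rightarrow> 'd word \<Rightarrow> complex mat" where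
  "nc_coeff P w = map_mat (\<lambda>p. Poly_Mapping.lookup p w) P"

definition nc_support :: "'d nc_poly mat \<Rightarrow> 'd word set" where
  "nc_support P = {w. nc_coeff P w \<noteq> 0\<^sub>m (dim_row P) (dim_col P)}"

definition word_eval :: "'d word \<Rightarrow> 'd nc_point \<Rightarrow> complex mat" where
  "word_eval w = (\<lambda>(n, X). mat_list_prod n (map X (letters w)))"

text \<open>\<open>P(X)\<close> is the sum of the \<open>C\<^sub>w \<otimes> X\<^sup>w\<close>; the sum is taken entrywise.\<close>
definition nc_eval :: "'d nc_poly mat \<Rightarrow> 'd nc_point \<Rightarrow> complex mat" where
  "nc_eval P Z = mat (dim_row P * fst Z) (dim_col P * fst Z)
     (\<lambda>ij. \<Sum>w\<in>nc_support P. (nc_coeff P w \<otimes>\<^sub>K word_eval w Z) $$ ij)"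

definition nc_dilate :: "real \<Rightarrow> 'd nc_poly mat \<Rightarrow> 'd nc_point \<Rightarrow> complex mat" where
  "nc_dilate r P Z = nc_eval P (nc_scale r Z)"

definition Q_stable ::
    "('d::finite \<Rightarrow> 'h::complex_hilbert \<Rightarrow> 'h) \<Rightarrow> 'd nc_poly mat \<Rightarrow> bool" where
  "Q_stable Q P \<longleftrightarrow> (\<forall>Z\<in>nc_ball Q. det (nc_eval P Z) \<noteq> 0)"

definition nc_GL :: "nat \<Rightarrow> 'd nc_poly mat set" where
  "nc_GL k = {P \<in> carrier_mat k k. \<exists>G\<in>carrier_mat k k. P * G = 1\<^sub>m k \<and> G * P = 1\<^sub>m k}"

definition nc_atom :: "nat \<Rightarrow> 'd nc_poly mat \<Rightarrow> bool" where
  "nc_atom k P \<longleftrightarrow> P \<in> carrier_mat k k \<and>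
     \<not> (\<exists>F\<in>carrier_mat k k. \<exists>G\<in>carrier_mat k k. F \<notin> nc_GL k \<and> G \<notin> nc_GL k \<and> P = F * G)"

end

theory Submission
  imports Defs "HOL-Analysis.L2_Norm"
begin

text \<open>
  Since matrices of a product multiply and norms are submultiplicative, it suffices to bound the
  quotients \<open>R(rX)\<^sup>-\<^sup>1 R(X)\<close> and \<open>R(X) R(rX)\<^sup>-\<^sup>1\<close> for one atom \<open>R\<close>; each factor of a
  stable product is stable because determinants multiply. The ball is bounded, so
  \<open>R(X) - R(rX)\<close> has norm \<open>O(1 - r)\<close>, and everything reduces to the resolvent estimate
  \<open>\<parallel>R(rX)\<^sup>-\<^sup>1\<parallel> \<le> K / (1 - r)\<close>, uniformly in \<open>X\<close> and in the size of the matrices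
  (\<open>resolvent_bound\<close>, \<open>dilation_difference\<close>).
  
  The estimate follows once the homogeneous components of the power series \<open>R\<^sup>-\<^sup>1\<close> are bounded on
  the ball. Stability gives a weaker statement: \<open>R(rX)\<^sup>-\<^sup>1\<close> is bounded for each \<open>r < 1\<close>. A kernel
  vector of \<open>R(X)\<close> only sees \<open>X\<close> through a space spanned by boundedly many vectors, so compressing
  \<open>X\<close> reduces this to one matrix size, where compactness applies (\<open>uniform_lower_bound\<close>).
  Placing tuples \<open>X\<^sub>1, \<dots>, X\<^sub>m\<close> below the diagonal of a block matrix then shows that the component of degree
  \<open>m\<close>, polarized to \<open>m\<close> arguments, grows more slowly than \<open>r\<^sup>-\<^sup>m\<close> (\<open>path_growth\<close>).
  
  To pass to \<open>r = 1\<close>, the series \<open>R\<^sup>-\<^sup>1 c\<close>, with \<open>c\<close> a polynomial column of bounded degree, are viewed as the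
  states of a linear system: removing the last letter of all words maps such series to such series.
  Weighting growth by \<open>r\<close> and normalizing gives norms on the finite-dimensional state space; if
  they blow up as \<open>r \<rightarrow> 1\<close>, an upper limit of the normalized norms is a seminorm whose kernel is an invariant
  subspace of states, and for which all paths of tuples in the ball are contractive.
  Contractivity bounds the growth unless the kernel interferes.
  
  Here the atom enters. An invariant subspace of states generates, together with the columns of
  \<open>R\<close>, a submodule of the free right module of columns that is itself free of rank \<open>k\<close>
  (\<open>submodule_factorization\<close>, a consequence of Cohn's weak algorithm). So \<open>R = F G\<close>, and one of \<open>F\<close>, \<open>G\<close> is
  invertible. If \<open>G\<close> is, every state of the subspace is a polynomial; if \<open>F\<close> is, long shifts of all
  states lie in the subspace (\<open>invariant_subspace_dichotomy\<close>). The second case is impossible because the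
  seminorm is nonzero; in the first case, long shifts of a state are controlled by the
  seminorm, which gives the bound (\<open>bounded_growth_Out\<close>).
\<close>

section \<open>Complex Hilbert spaces and \<open>l\<^sup>2\<close> norms\<close>

lemma cinner_add_right: "cinner x (y + z) = cinner x y + cinner (x::'h::complex_hilbert) z"
  by (metis cinner_add_left cinner_commute complex_cnj_add)

lemma cinner_scaleC_right: "cinner x (c *\<^sub>C y) = cnj c * cinner (x::'h::complex_hilbert) y"
  by (metis cinner_commute cinner_scaleC_left complex_cnj_mult)

lemma cinner_zero_left [simp]: "cinner 0 (y::'h::complex_hilbert) = 0"
  using cinner_add_left[of 0 0 y] by simp

lemma cinner_zero_right [simp]: "cinner (y::'h::complex_hilbert) 0 = 0"
  using cinner_add_right[of y 0 0] by simp

lemma cinner_sum_left: "cinner (\<Sum>i\<in>I. f i) (y::'h::complex_hilbert) = (\<Sum>i\<in>I. cinner (f i) y)"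
  by (induction I rule: infinite_finite_induct) (auto simp: cinner_add_left)

lemma cinner_sum_right: "cinner (y::'h::complex_hilbert) (\<Sum>i\<in>I. f i) = (\<Sum>i\<in>I. cinner y (f i))"
  by (induction I rule: infinite_finite_induct) (auto simp: cinner_add_right)

lemma scaleC_zero_left [simp]: "0 *\<^sub>C (x::'h::complex_hilbert) = 0"
  using scaleC_add_left[of 0 0 x] by simp

lemma scaleC_zero_right [simp]: "c *\<^sub>C (0::'h::complex_hilbert) = 0"
  using scaleC_add_right[of c 0 "0::'h"] by simp

lemma scaleC_sum_right: "c *\<^sub>C (\<Sum>i\<in>I. f i) = (\<Sum>i\<in>I. c *\<^sub>C (f i :: 'h::complex_hilbert))"
  by (induction I rule: infinite_finite_induct) (auto simp: scaleC_add_right)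

lemma cinner_self: "cinner x x = complex_of_real ((norm (x::'h::complex_hilbert))\<^sup>2)"
proof -
  have "Im (cinner x x) = 0"
    using arg_cong[OF cinner_commute[of x x], of Im] by simp
  then show ?thesis
    by (simp add: norm_eq_sqrt_cinner cinner_ge_zero complex_eq_iff)
qed

lemma norm_scaleC: "norm (c *\<^sub>C (x::'h::complex_hilbert)) = cmod c * norm x"
proof -
  have "cinner (c *\<^sub>C x) (c *\<^sub>C x) = c * cnj c * cinner x x"
    by (simp add: cinner_scaleC_left cinner_scaleC_right)
  then have "complex_of_real ((norm (c *\<^sub>C x))\<^sup>2) = complex_of_real ((cmod c * norm x)\<^sup>2)"
    unfolding cinner_self complex_norm_square[symmetric] of_real_mult[symmetric] power_mult_distrib .
  then have "(norm (c *\<^sub>C x))\<^sup>2 = (cmod c * norm x)\<^sup>2"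
    using of_real_eq_iff by blast
  then show ?thesis by simp
qed

lemma cinner_Cauchy_Schwarz: "cmod (cinner (x::'h::complex_hilbert) y) \<le> norm x * norm y"
proof (cases "y = 0")
  case False
  define t where "t = cinner x y / cinner y y"
  have ny: "norm y > 0" using False by simp
  have minus: "- t *\<^sub>C y + t *\<^sub>C y = 0"
    using scaleC_add_left[of "-t" t y] by simp
  define z where "z = x + (- t) *\<^sub>C y"
  have zy: "cinner z y = 0"
    unfolding z_def t_def by (simp add: cinner_add_left cinner_scaleC_left cinner_self ny)
  have x: "x = z + t *\<^sub>C y" unfolding z_def using minus by (simp add: add.assoc)
  have "cinner x y = t * cinner y y" by (subst x) (simp add: cinner_add_left cinner_scaleC_left zy)
  then have a: "cmod (cinner x y) = cmod t * norm y * norm y"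
    by (simp add: cinner_self norm_mult power2_eq_square)
  have yz: "cinner y z = 0" using zy cinner_commute[of y z] by simp
  have "cinner x x = cinner z z + cinner (t *\<^sub>C y) (t *\<^sub>C y)"
    by (subst (1 2) x) (simp add: cinner_add_left cinner_add_right cinner_scaleC_left cinner_scaleC_right zy yz)
  then have "(norm x)\<^sup>2 = (norm z)\<^sup>2 + (cmod t * norm y)\<^sup>2"
    unfolding cinner_self norm_scaleC by (metis of_real_add of_real_eq_iff)
  then have "(cmod t * norm y)\<^sup>2 \<le> (norm x)\<^sup>2" by simp
  then have "cmod t * norm y \<le> norm x" by (simp add: power2_le_iff_abs_le)
  then show ?thesis unfolding a using ny by simp
qed simp

lemma bounded_clinear_sum:
  assumes "bounded_clinear T" shows "T (\<Sum>i\<in>I. f i) = (\<Sum>i\<in>I. T (f i))"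
  using assms linear_sum[of T] unfolding bounded_clinear_def bounded_linear_def by auto

lemma bounded_clinear_scaleC:
  "bounded_clinear T \<Longrightarrow> T (c *\<^sub>C x) = c *\<^sub>C T x"
  by (simp add: bounded_clinear_def)

lemma bounded_clinear_zero: "bounded_clinear T \<Longrightarrow> T 0 = 0"
  using bounded_clinear_scaleC[of T 0 0] by simp

lemma bounded_clinear_bound:
  assumes "bounded_clinear T" shows "\<exists>K\<ge>0. \<forall>x. norm (T x) \<le> K * norm x"
  using assms bounded_linear.nonneg_bounded[of T] unfolding bounded_clinear_def
  by (auto simp: mult.commute)

abbreviation l2 :: "'a set \<Rightarrow> ('a \<Rightarrow> 'v::real_normed_vector) \<Rightarrow> real" where
  "l2 S h \<equiv> L2_set (\<lambda>a. norm (h a)) S"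

lemma l2_CS: "(\<Sum>a\<in>S. norm (f a) * norm (g a)) \<le> l2 S f * l2 S g"
  using L2_set_mult_ineq[of "\<lambda>a. norm (f a)" "\<lambda>a. norm (g a)" S] by simp

lemma l2_triangle: "l2 S (\<lambda>a. f a + g a) \<le> l2 S f + l2 S g"
  by (rule order_trans[OF L2_set_mono L2_set_triangle_ineq]) (auto simp: norm_triangle_ineq)

lemma l2_sum: "l2 S (\<lambda>a. \<Sum>i\<in>I. f i a) \<le> (\<Sum>i\<in>I. l2 S (f i))"
proof (induction I rule: infinite_finite_induct)
  case (insert x F)
  then show ?case using l2_triangle[of "f x" "\<lambda>a. \<Sum>i\<in>F. f i a" S] by simp
qed (auto simp: L2_set_def)

lemma l2_mult: "l2 S (\<lambda>a. c * f a :: complex) = cmod c * l2 S f"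
  by (simp add: norm_mult L2_set_right_distrib)

lemma l2_square: "(l2 S h)\<^sup>2 = (\<Sum>a\<in>S. (norm (h a))\<^sup>2)"
  by (simp add: L2_set_def sum_nonneg)

lemma l2_superset: "finite T \<Longrightarrow> S \<subseteq> T \<Longrightarrow> (\<And>a. a \<in> T - S \<Longrightarrow> h a = 0) \<Longrightarrow> l2 T h = l2 S h"
  unfolding L2_set_def by (rule arg_cong[of _ _ sqrt], rule sum.mono_neutral_right) auto

text \<open>
  Testing a vector against itself turns a bound on the pairing into a bound on the norm, after
  cancelling one factor.
\<close>

lemma l2_duality:
  assumes "K \<ge> 0" "cmod (\<Sum>a\<in>S. w a * cnj (w a)) \<le> K * l2 S w"
  shows "l2 S (w::_\<Rightarrow>complex) \<le> K"
proof -
  have "(\<Sum>a\<in>S. w a * cnj (w a)) = of_real ((l2 S w)\<^sup>2)"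
    unfolding l2_square of_real_sum complex_norm_square ..
  with assms have "l2 S w * l2 S w \<le> K * l2 S w"
    by (simp add: power2_eq_square norm_mult)
  then show ?thesis using \<open>K \<ge> 0\<close> L2_set_nonneg[of "\<lambda>a. norm (w a)" S]
    by (metis mult_right_le_imp_le order_le_less)
qed

section \<open>Seminorms in finitely many coordinates\<close>

lemma real_bounded_subsequence:
  fixes f :: "nat \<Rightarrow> real"
  assumes "\<And>n. \<bar>f n\<bar> \<le> B"
  shows "\<exists>l r. strict_mono (r::nat\<Rightarrow>nat) \<and> (\<lambda>n. f (r n)) \<longlonglongrightarrow> l"
proof -
  obtain r where r: "strict_mono (r::nat\<Rightarrow>nat)" "monoseq (\<lambda>n. f (r n))"
    using seq_monosub[of f] by auto
  have "Bseq (\<lambda>n. f (r n))" by (rule BseqI'[of _ B]) (use assms in auto)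
  with r(2) have "convergent (\<lambda>n. f (r n))" by (intro Bseq_monoseq_convergent) auto
  with r(1) show ?thesis unfolding convergent_def by blast
qed

lemma complex_bounded_subsequence:
  fixes f :: "nat \<Rightarrow> complex"
  assumes "\<And>n. cmod (f n) \<le> B"
  shows "\<exists>l r. strict_mono (r::nat\<Rightarrow>nat) \<and> (\<lambda>n. f (r n)) \<longlonglongrightarrow> l"
proof -
  have "\<bar>Re (f n)\<bar> \<le> B" for n using assms[of n] abs_Re_le_cmod[of "f n"] by linarith
  then obtain l1 r1 where 1: "strict_mono (r1::nat\<Rightarrow>nat)" "(\<lambda>n. Re (f (r1 n))) \<longlonglongrightarrow> l1"
    using real_bounded_subsequence[of "\<lambda>n. Re (f n)"] by blast
  have "\<bar>Im (f (r1 n))\<bar> \<le> B" for n using assms[of "r1 n"] abs_Im_le_cmod[of "f (r1 n)"] by linarith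
  then obtain l2 r2 where 2: "strict_mono (r2::nat\<Rightarrow>nat)" "(\<lambda>n. Im (f (r1 (r2 n)))) \<longlonglongrightarrow> l2"
    using real_bounded_subsequence[of "\<lambda>n. Im (f (r1 n))"] by blast
  have "(\<lambda>n. Re (f (r1 (r2 n)))) \<longlonglongrightarrow> l1"
    using LIMSEQ_subseq_LIMSEQ[OF 1(2) 2(1)] by (simp add: o_def)
  with 2(2) have "(\<lambda>n. f (r1 (r2 n))) \<longlonglongrightarrow> Complex l1 l2"
    by (simp add: tendsto_complex_iff)
  moreover have "strict_mono (\<lambda>n. r1 (r2 n))" using 1(1) 2(1) by (simp add: strict_mono_def)
  ultimately show ?thesis by blast
qed

lemma coordinatewise_bounded_subsequence:
  fixes f :: "nat \<Rightarrow> 'i \<Rightarrow> complex"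
  assumes "finite I" "\<And>n i. i \<in> I \<Longrightarrow> cmod (f n i) \<le> B"
  shows "\<exists>l r. strict_mono (r::nat\<Rightarrow>nat) \<and> (\<forall>i\<in>I. (\<lambda>n. f (r n) i) \<longlonglongrightarrow> l i)"
  using assms
proof (induction I rule: finite_induct)
  case empty
  show ?case by (rule exI, rule exI[of _ id]) (auto simp: strict_mono_def)
next
  case (insert i I)
  then obtain l r where r: "strict_mono (r::nat\<Rightarrow>nat)" "\<forall>i\<in>I. (\<lambda>n. f (r n) i) \<longlonglongrightarrow> l i"
    by auto
  have "cmod (f (r n) i) \<le> B" for n using insert.prems by blast
  then obtain l' r' where r': "strict_mono (r'::nat\<Rightarrow>nat)" "(\<lambda>n. f (r (r' n)) i) \<longlonglongrightarrow> l'"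
    using complex_bounded_subsequence[of "\<lambda>n. f (r n) i"] by blast
  have "(\<lambda>n. f (r (r' n)) i') \<longlonglongrightarrow> (l(i := l')) i'" if "i' \<in> insert i I" for i'
  proof (cases "i' = i")
    case False
    with that r(2) have "(\<lambda>n. f (r n) i') \<longlonglongrightarrow> l i'" by auto
    from LIMSEQ_subseq_LIMSEQ[OF this r'(1)] False show ?thesis by (simp add: o_def)
  qed (use r' in simp)
  moreover have "strict_mono (\<lambda>n. r (r' n))" using r(1) r'(1) by (simp add: strict_mono_def)
  ultimately show ?case by blast
qed

text \<open>
  Only one half of homogeneity is demanded; the other half follows by applying it to \<open>1 / t\<close>.
  This makes the condition stable under suprema and upper limits without further work.
\<close>

definition seminorm :: "(('i \<Rightarrow> complex) \<Rightarrow> real) \<Rightarrow> bool" where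
  "seminorm h \<longleftrightarrow> (\<forall>x y. h (\<lambda>i. x i + y i) \<le> h x + h y) \<and> (\<forall>t x. h (\<lambda>i. t * x i) \<le> cmod t * h x)"

lemma seminorm_add: "seminorm h \<Longrightarrow> h (\<lambda>i. x i + y i) \<le> h x + h y"
  and seminorm_mult: "seminorm h \<Longrightarrow> h (\<lambda>i. t * x i) \<le> cmod t * h x"
  by (auto simp: seminorm_def)

lemma seminorm_zero: assumes "seminorm h" shows "h (\<lambda>i. 0) = 0"
proof -
  have "h (\<lambda>i. 0) \<le> 0" using seminorm_mult[OF assms, of 0 "\<lambda>i. 0"] by simp
  moreover have "h (\<lambda>i. 0) \<le> h (\<lambda>i. 0) + h (\<lambda>i. 0)" using seminorm_add[OF assms, of "\<lambda>i. 0" "\<lambda>i. 0"] by simp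
  ultimately show ?thesis by linarith
qed

lemma seminorm_nonneg: assumes "seminorm h" shows "h x \<ge> 0"
proof -
  have "0 \<le> h x + h (\<lambda>i. -1 * x i)"
    using seminorm_add[OF assms, of x "\<lambda>i. -1 * x i"] seminorm_zero[OF assms] by simp
  also have "\<dots> \<le> h x + h x" using seminorm_mult[OF assms, of "-1" x] by simp
  finally show ?thesis by simp
qed

lemma seminorm_sum:
  assumes "seminorm h" shows "h (\<lambda>i. \<Sum>j\<in>J. t j * x j i) \<le> (\<Sum>j\<in>J. cmod (t j) * h (x j))"
proof (induction J rule: infinite_finite_induct)
  case (insert j J)
  then show ?case
    using seminorm_add[OF assms, of "\<lambda>i. t j * x j i" "\<lambda>i. \<Sum>j\<in>J. t j * x j i"]
      seminorm_mult[OF assms, of "t j" "x j"] by simp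
qed (simp_all add: seminorm_zero[OF assms])

text \<open>
  Growth is measured by suprema over many tests, each of which is a seminorm in the state.
\<close>

lemma seminorm_SUP:
  assumes "\<And>\<tau>. \<tau> \<in> \<Theta> \<Longrightarrow> seminorm (G \<tau>)" "\<Theta> \<noteq> {}" "\<And>x. bdd_above ((\<lambda>\<tau>. G \<tau> x) ` \<Theta>)"
  shows "seminorm (\<lambda>x. SUP \<tau>\<in>\<Theta>. G \<tau> x)"
  unfolding seminorm_def
proof (intro conjI allI cSUP_least[OF assms(2)])
  fix x y :: "'b \<Rightarrow> complex" and t \<tau> assume \<tau>: "\<tau> \<in> \<Theta>"
  have up: "G \<tau> x \<le> (SUP \<tau>\<in>\<Theta>. G \<tau> x)" for x by (rule cSUP_upper[OF \<tau> assms(3)])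
  show "G \<tau> (\<lambda>i. x i + y i) \<le> (SUP \<tau>\<in>\<Theta>. G \<tau> x) + (SUP \<tau>\<in>\<Theta>. G \<tau> y)"
    using seminorm_add[OF assms(1)[OF \<tau>], of x y] up[of x] up[of y] by linarith
  show "G \<tau> (\<lambda>i. t * x i) \<le> cmod t * (SUP \<tau>\<in>\<Theta>. G \<tau> x)"
    using seminorm_mult[OF assms(1)[OF \<tau>], of t x] mult_left_mono[OF up[of x], of "cmod t"] by simp
qed

text \<open>
  Equivalence of norms in finite dimension, by compactness of the unit sphere of the
  \<open>l\<^sup>1\<close> norm.
\<close>

lemma definite_seminorm_bounds_coordinates:
  assumes fin: "finite I" and h: "seminorm h"
    and def0: "\<And>x. (\<And>i. i \<notin> I \<Longrightarrow> x i = 0) \<Longrightarrow> h x = 0 \<Longrightarrow> x = (\<lambda>i. 0)"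
  shows "\<exists>c>0. \<forall>x. (\<forall>i. i \<notin> I \<longrightarrow> x i = 0) \<longrightarrow> (\<forall>i. cmod (x i) \<le> c * h x)"
proof (rule ccontr)
  let ?e = "\<lambda>j i. if i = j then 1 else (0::complex)"
  define K where "K = (\<Sum>j\<in>I. h (?e j))"
  have K: "h x \<le> K * (\<Sum>i\<in>I. cmod (x i))" if "\<And>i. i \<notin> I \<Longrightarrow> x i = 0" for x
  proof -
    have "x = (\<lambda>i. \<Sum>j\<in>I. x j * ?e j i)"
      using that fin by (auto simp: fun_eq_iff if_distrib cong: if_cong)
    from ord_eq_le_trans[OF arg_cong[OF this, of h] seminorm_sum[OF h]]
    have "h x \<le> (\<Sum>j\<in>I. cmod (x j) * h (?e j))" .
    also have "\<dots> \<le> (\<Sum>j\<in>I. cmod (x j) * K)"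
      unfolding K_def by (intro sum_mono mult_left_mono member_le_sum) (auto simp: fin seminorm_nonneg[OF h])
    finally show ?thesis by (simp add: sum_distrib_left mult.commute)
  qed
  assume "\<not> ?thesis"
  then have neg: "c > 0 \<Longrightarrow> \<exists>x i. (\<forall>i. i \<notin> I \<longrightarrow> x i = 0) \<and> cmod (x i) > c * h x" for c
    by (meson not_le)
  have "\<exists>x. (\<forall>i. i \<notin> I \<longrightarrow> x i = 0) \<and> (\<Sum>i\<in>I. cmod (x i)) = 1 \<and> h x \<le> 1 / (real n + 1)" for n
  proof -
    obtain x i where x: "\<And>i. i \<notin> I \<Longrightarrow> x i = 0" and i: "cmod (x i) > (real n + 1) * h x"
      using neg[of "real n + 1"] by (auto simp: add_pos_nonneg)
    define M where "M = (\<Sum>i\<in>I. cmod (x i))"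
    have xi: "cmod (x i) > 0" using i mult_nonneg_nonneg[of "real n + 1" "h x"] seminorm_nonneg[OF h, of x] by linarith
    then have "i \<in> I" using x[of i] by force
    then have M: "cmod (x i) \<le> M" unfolding M_def by (intro member_le_sum) (auto simp: fin)
    with xi have "M > 0" by linarith
    define z where "z = (\<lambda>i. complex_of_real (1 / M) * x i)"
    have "h z \<le> (1 / M) * h x" unfolding z_def using seminorm_mult[OF h, of "complex_of_real (1/M)" x] \<open>M > 0\<close>
      by (simp add: norm_divide)
    also have "\<dots> \<le> 1 / (real n + 1)"
    proof -
      have "(real n + 1) * h x \<le> M" using i M by linarith
      then show ?thesis using \<open>M > 0\<close> by (simp add: field_simps)
    qed
    finally have "h z \<le> 1 / (real n + 1)" .
    moreover have "(\<Sum>i\<in>I. cmod (z i)) = 1"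
      unfolding z_def norm_mult sum_distrib_left[symmetric] M_def[symmetric] using \<open>M > 0\<close>
      by (simp add: norm_divide)
    moreover have "\<forall>i. i \<notin> I \<longrightarrow> z i = 0" using x by (simp add: z_def)
    ultimately show ?thesis by blast
  qed
  then have "\<exists>z. \<forall>n. (\<forall>i. i \<notin> I \<longrightarrow> z n i = 0) \<and> (\<Sum>i\<in>I. cmod (z n i)) = 1 \<and> h (z n) \<le> 1 / (real n + 1)"
    by (intro choice allI)
  then obtain z where z: "\<And>n i. i \<notin> I \<Longrightarrow> z n i = 0" "\<And>n. (\<Sum>i\<in>I. cmod (z n i)) = 1" "\<And>n. h (z n) \<le> 1 / (real n + 1)"
    by blast
  have "cmod (z n i) \<le> 1" if "i \<in> I" for n i
    using member_le_sum[OF that, of "\<lambda>i. cmod (z n i)"] z(2)[of n] fin by simp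
  then obtain l r where r: "strict_mono (r::nat\<Rightarrow>nat)" "\<And>i. i \<in> I \<Longrightarrow> (\<lambda>n. z (r n) i) \<longlonglongrightarrow> l i"
    using coordinatewise_bounded_subsequence[OF fin, of z 1] by blast
  define l' where "l' i = (if i \<in> I then l i else 0)" for i
  have lim: "(\<lambda>n. K * (\<Sum>i\<in>I. cmod (l' i - z (r n) i)) + 1 / (real (r n) + 1)) \<longlonglongrightarrow> K * (\<Sum>i\<in>I. 0) + 0"
  proof (intro tendsto_add tendsto_mult tendsto_sum tendsto_const)
    fix i assume "i \<in> I"
    then have "(\<lambda>n. l' i - z (r n) i) \<longlonglongrightarrow> l' i - l' i"
      by (intro tendsto_diff tendsto_const) (simp add: l'_def r)
    then show "(\<lambda>n. cmod (l' i - z (r n) i)) \<longlonglongrightarrow> 0" by (simp add: tendsto_norm_zero)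
  next
    have "(\<lambda>n. 1 / (real n + 1)) \<longlonglongrightarrow> 0" using LIMSEQ_inverse_real_of_nat by (simp add: inverse_eq_divide add.commute)
    from LIMSEQ_subseq_LIMSEQ[OF this r(1)] show "(\<lambda>n. 1 / (real (r n) + 1)) \<longlonglongrightarrow> 0" by (simp add: o_def)
  qed
  have "h l' \<le> K * (\<Sum>i\<in>I. cmod (l' i - z (r n) i)) + 1 / (real (r n) + 1)" for n
  proof -
    have "h l' \<le> h (\<lambda>i. l' i - z (r n) i) + h (z (r n))"
      using seminorm_add[OF h, of "\<lambda>i. l' i - z (r n) i" "z (r n)"] by simp
    moreover have "h (\<lambda>i. l' i - z (r n) i) \<le> K * (\<Sum>i\<in>I. cmod (l' i - z (r n) i))"
      by (rule K) (simp add: l'_def z(1))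
    ultimately show ?thesis using z(3)[of "r n"] by linarith
  qed
  then have "h l' \<le> 0" using LIMSEQ_le_const[OF lim, of "h l'"] by auto
  then have "h l' = 0" using seminorm_nonneg[OF h, of l'] by simp
  then have l0: "l' = (\<lambda>i. 0)" by (rule def0[rotated]) (simp add: l'_def)
  have "(\<lambda>n. \<Sum>i\<in>I. cmod (z (r n) i)) \<longlonglongrightarrow> (\<Sum>i\<in>I. cmod (l i))"
    by (intro tendsto_sum tendsto_norm r)
  then have "(\<lambda>n. 1::real) \<longlonglongrightarrow> (\<Sum>i\<in>I. cmod (l i))" by (simp add: z)
  moreover have "(\<Sum>i\<in>I. cmod (l i)) = 0"
    using l0 by (auto simp: l'_def fun_eq_iff split: if_splits intro!: sum.neutral)
  ultimately have "(\<lambda>n. 1::real) \<longlonglongrightarrow> 0" by simp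
  then show False using LIMSEQ_unique[OF _ tendsto_const] by force
qed

text \<open>
  A reduced echelon basis \<open>e\<close> of the kernel of a seminorm: choose a maximal set \<open>J\<close> of pivot
  coordinates. By maximality the seminorm is definite on the vectors that vanish at the pivots, so
  subtracting the kernel part leaves a remainder whose coordinates are controlled by the
  seminorm. The expansion of a kernel vector has its own pivot coordinates as coefficients, which
  later makes the matrix of an operator on the kernel explicit.
\<close>

lemma seminorm_kernel_echelon:
  assumes B: "finite B" and h: "seminorm h"
  obtains J e c where "J \<subseteq> B" "c > 0"
    and "\<And>l. l \<in> J \<Longrightarrow> h (e l) = 0" "\<And>l b. l \<in> J \<Longrightarrow> b \<notin> B \<Longrightarrow> e l b = 0"
    and "\<And>z. \<forall>b. b \<notin> B \<longrightarrow> z b = 0 \<Longrightarrow> h z = 0 \<Longrightarrow> z = (\<lambda>b. \<Sum>l\<in>J. z l * e l b)"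
    and "\<And>z b. \<forall>b. b \<notin> B \<longrightarrow> z b = 0 \<Longrightarrow> cmod (z b - (\<Sum>l\<in>J. z l * e l b)) \<le> c * h z"
proof -
  let ?V = "\<lambda>z. \<forall>b. b \<notin> B \<longrightarrow> z b = (0::complex)"
  define P where "P J e \<longleftrightarrow> J \<subseteq> B \<and> (\<forall>l\<in>J. h (e l) = 0 \<and> ?V (e l) \<and> (\<forall>l'\<in>J. e l l' = (if l' = l then 1 else 0)))" for J e
  have fin: "finite {J. J \<subseteq> B}" using B by simp
  have "P {} (\<lambda>_ _. 0)" by (simp add: P_def)
  then have ne: "{J. \<exists>e. P J e} \<noteq> {}" by blast
  have finP: "finite {J. \<exists>e. P J e}" by (rule finite_subset[OF _ fin]) (auto simp: P_def)
  define m where "m = Max (card ` {J. \<exists>e. P J e})"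
  have "m \<in> card ` {J. \<exists>e. P J e}" unfolding m_def using ne finP by (intro Max_in) auto
  then obtain J e where J: "P J e" "card J = m" by auto
  have JB: "J \<subseteq> B" and finJ: "finite J" using J(1) B by (auto simp: P_def intro: finite_subset)
  define res where "res z = (\<lambda>b. z b - (\<Sum>l\<in>J. z l * e l b))" for z
  have resV: "?V (res z)" if "?V z" for z using that J(1) by (auto simp: res_def P_def)
  have resJ: "res z l = 0" if "l \<in> J" for z l
  proof -
    have "(\<Sum>l'\<in>J. z l' * e l' l) = (\<Sum>l'\<in>J. if l' = l then z l' else 0)"
      using J(1) that by (intro sum.cong) (auto simp: P_def)
    then show ?thesis using that finJ by (simp add: res_def)
  qed
  have hcomb: "h (\<lambda>b. \<Sum>l\<in>J. t l * e l b) = 0" for t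
  proof -
    have "h (\<lambda>b. \<Sum>l\<in>J. t l * e l b) \<le> (\<Sum>l\<in>J. cmod (t l) * h (e l))" by (rule seminorm_sum[OF h])
    also have "\<dots> = 0" using J(1) by (simp add: P_def)
    finally show ?thesis using seminorm_nonneg[OF h] by (simp add: order_antisym)
  qed
  have resh: "h (res z) \<le> h z" for z
  proof -
    have "h (res z) \<le> h z + h (\<lambda>b. \<Sum>l\<in>J. (- z l) * e l b)"
      using seminorm_add[OF h, of z "\<lambda>b. \<Sum>l\<in>J. (- z l) * e l b"]
      by (simp add: res_def sum_negf)
    then show ?thesis using hcomb[of "\<lambda>l. - z l"] by simp
  qed
  have def0: "y = (\<lambda>b. 0)" if y: "\<And>b. b \<notin> B - J \<Longrightarrow> y b = 0" and hy: "h y = 0" for y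
  proof (rule ccontr)
    assume "y \<noteq> (\<lambda>b. 0)"
    then obtain b where yb: "y b \<noteq> 0" by auto
    then have b: "b \<in> B" "b \<notin> J" using y by auto
    define f where "f = (\<lambda>i. (1 / y b) * y i)"
    have hf: "h f = 0" using seminorm_mult[OF h, of "1 / y b" y] hy seminorm_nonneg[OF h, of f]
      by (simp add: f_def)
    define e' where "e' l = (if l = b then f else (\<lambda>i. e l i + (- e l b) * f i))" for l
    have he: "h (e' l) = 0" if "l \<in> insert b J" for l
    proof (cases "l = b")
      case False
      with that J(1) have "h (e l) = 0" by (auto simp: P_def)
      with False have "h (e' l) \<le> 0"
        using seminorm_add[OF h, of "e l" "\<lambda>i. (- e l b) * f i"] seminorm_mult[OF h, of "- e l b" f] hf
        unfolding e'_def by simp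
      then show ?thesis using seminorm_nonneg[OF h, of "e' l"] by simp
    qed (simp add: e'_def hf)
    have fV: "f i = 0" if "i \<notin> B - J" for i using y[OF that] by (simp add: f_def)
    have "P (insert b J) e'"
      unfolding P_def
    proof (intro conjI ballI allI impI)
      show "insert b J \<subseteq> B" using JB b by auto
      fix l assume l: "l \<in> insert b J"
      show "h (e' l) = 0" using he l .
      fix i assume "i \<notin> B"
      then show "e' l i = 0" using fV l J(1) by (auto simp: e'_def P_def)
    next
      fix l l' assume l: "l \<in> insert b J" "l' \<in> insert b J"
      show "e' l l' = (if l' = l then 1 else 0)"
        using l J(1) b yb fV by (auto simp: e'_def P_def f_def)
    qed
    then have "card (insert b J) \<le> m" unfolding m_def using finP by (intro Max_ge) auto
    then show False using J(2) b finJ by simp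
  qed
  have "finite (B - J)" using B by simp
  from definite_seminorm_bounds_coordinates[OF this h def0] obtain c where c: "c > 0"
    "\<And>x b. (\<And>i. i \<notin> B - J \<Longrightarrow> x i = 0) \<Longrightarrow> cmod (x b) \<le> c * h x" by blast
  have bound: "cmod (res z b) \<le> c * h z" if "\<And>b. b \<notin> B \<Longrightarrow> z b = 0" for z b
  proof -
    have "cmod (res z b) \<le> c * h (res z)"
      using resV[of z] resJ that by (intro c(2)) auto
    also have "\<dots> \<le> c * h z" using resh c(1) by simp
    finally show ?thesis .
  qed
  show ?thesis
  proof (rule that[of J c e])
    fix z assume z: "\<forall>b. b \<notin> B \<longrightarrow> z b = (0::complex)" "h z = 0"
    have "res z b = 0" for b using bound[of z b] z by simp
    then have "z b - (\<Sum>l\<in>J. z l * e l b) = 0" for b unfolding res_def .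
    then show "z = (\<lambda>b. \<Sum>l\<in>J. z l * e l b)" unfolding right_minus_eq by (rule ext)
  qed (use JB c bound J(1) in \<open>auto simp: res_def P_def\<close>)
qed

section \<open>Sesquilinear norm bounds for tuples of matrices\<close>

definition mat_apply :: "'s set \<Rightarrow> ('s \<Rightarrow> 's \<Rightarrow> complex) \<Rightarrow> ('s \<Rightarrow> complex) \<Rightarrow> 's \<Rightarrow> complex" where
  "mat_apply S A v = (\<lambda>a. \<Sum>b\<in>S. A a b * v b)"

text \<open>
  The form \<open>(h, g) \<mapsto> \<langle>Q(X) h, g\<rangle>\<close> on \<open>H \<otimes> \<complex>\<^sup>S\<close>. The index set \<open>S\<close> is arbitrary, so that block
  matrices can be indexed by pairs.
\<close>

definition tuple_form ::
  "('d::finite \<Rightarrow> 'h::complex_hilbert \<Rightarrow> 'h) \<Rightarrow> 's set \<Rightarrow> ('d \<Rightarrow> 's \<Rightarrow> 's \<Rightarrow> complex) \<Rightarrow> ('s \<Rightarrow> 'h) \<Rightarrow> ('s \<Rightarrow> 'h) \<Rightarrow> complex" where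
  "tuple_form Q S X h g = (\<Sum>a\<in>S. \<Sum>b\<in>S. \<Sum>j\<in>UNIV. X j a b * cinner (Q j (h b)) (g a))"

text \<open>
  The bound \<open>\<parallel>Q(X)\<parallel> \<le> \<rho>\<close>, stated through the form: in this shape it passes to entrywise
  limits, compressions and block matrices without computing a norm.
\<close>

definition tuple_norm_le ::
  "('d::finite \<Rightarrow> 'h::complex_hilbert \<Rightarrow> 'h) \<Rightarrow> real \<Rightarrow> 's set \<Rightarrow> ('d \<Rightarrow> 's \<Rightarrow> 's \<Rightarrow> complex) \<Rightarrow> bool" where
  "tuple_norm_le Q \<rho> S X \<longleftrightarrow> finite S \<and> 0 \<le> \<rho> \<and> (\<forall>h g. cmod (tuple_form Q S X h g) \<le> \<rho> * (l2 S h * l2 S g))"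

lemma tuple_norm_le_finite: "tuple_norm_le Q \<rho> S X \<Longrightarrow> finite S"
  and tuple_norm_le_nonneg: "tuple_norm_le Q \<rho> S X \<Longrightarrow> 0 \<le> \<rho>"
  and tuple_norm_le_bound: "tuple_norm_le Q \<rho> S X \<Longrightarrow> cmod (tuple_form Q S X h g) \<le> \<rho> * (l2 S h * l2 S g)"
  by (auto simp: tuple_norm_le_def)

lemma tuple_form_cong:
  "(\<And>j a b. a \<in> S \<Longrightarrow> b \<in> S \<Longrightarrow> X j a b = Y j a b) \<Longrightarrow> tuple_form Q S X h g = tuple_form Q S Y h g"
  unfolding tuple_form_def by (intro sum.cong) auto

lemma tuple_norm_le_cong:
  "tuple_norm_le Q \<rho> S X \<Longrightarrow> (\<And>j a b. a \<in> S \<Longrightarrow> b \<in> S \<Longrightarrow> X j a b = Y j a b) \<Longrightarrow> tuple_norm_le Q \<rho> S Y"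
  unfolding tuple_norm_le_def using tuple_form_cong[of S X Y Q] by metis

lemma tuple_norm_le_mono: "tuple_norm_le Q \<rho> S X \<Longrightarrow> \<rho> \<le> \<rho>' \<Longrightarrow> tuple_norm_le Q \<rho>' S X"
  unfolding tuple_norm_le_def
  by (meson L2_set_nonneg mult_nonneg_nonneg mult_right_mono order_trans)

lemma tuple_norm_le_scale:
  assumes "tuple_norm_le Q \<rho> S X" shows "tuple_norm_le Q (cmod t * \<rho>) S (\<lambda>j a b. t * X j a b)"
proof -
  have "tuple_form Q S (\<lambda>j a b. t * X j a b) h g = t * tuple_form Q S X h g" for h g
    by (simp add: tuple_form_def sum_distrib_left mult.assoc)
  with assms show ?thesis
    by (auto simp: tuple_norm_le_def norm_mult mult.assoc intro!: mult_left_mono)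
qed

lemma tuple_norm_le_pad:
  assumes "tuple_norm_le Q \<rho> S X" "S \<subseteq> T" "finite T" "\<And>j a b. a \<notin> S \<or> b \<notin> S \<Longrightarrow> X j a b = 0"
  shows "tuple_norm_le Q \<rho> T X"
proof -
  have "tuple_form Q T X h g = tuple_form Q S X h g" for h g
  proof -
    have "tuple_form Q T X h g = (\<Sum>a\<in>S. \<Sum>b\<in>T. \<Sum>j\<in>UNIV. X j a b * cinner (Q j (h b)) (g a))"
      unfolding tuple_form_def using assms by (intro sum.mono_neutral_right) auto
    also have "\<dots> = tuple_form Q S X h g"
      unfolding tuple_form_def using assms by (intro sum.cong sum.mono_neutral_right) auto
    finally show ?thesis .
  qed
  moreover have mono: "l2 S h \<le> l2 T h" for h :: "'c \<Rightarrow> 'b"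
    unfolding L2_set_def using assms by (intro real_sqrt_le_mono sum_mono2) auto
  have "\<rho> * (l2 S h * l2 S g) \<le> \<rho> * (l2 T h * l2 T g)" for h g :: "'c \<Rightarrow> 'b"
    using tuple_norm_le_nonneg[OF assms(1)] by (intro mult_left_mono mult_mono mono) auto
  ultimately show ?thesis
    using assms unfolding tuple_norm_le_def by (metis order_trans)
qed

lemma tuple_form_mult_right:
  assumes Q: "\<And>j. bounded_clinear (Q j)" and "finite S"
  shows "tuple_form Q S (\<lambda>j a b. \<Sum>c\<in>T. X j a c * U c b) h g =
    (\<Sum>a\<in>S. \<Sum>c\<in>T. \<Sum>j\<in>UNIV. X j a c * cinner (Q j (\<Sum>b\<in>S. U c b *\<^sub>C h b)) (g a))"
proof -
  have "tuple_form Q S (\<lambda>j a b. \<Sum>c\<in>T. X j a c * U c b) h g =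
     (\<Sum>a\<in>S. \<Sum>b\<in>S. \<Sum>j\<in>UNIV. \<Sum>c\<in>T. X j a c * (U c b * cinner (Q j (h b)) (g a)))"
    by (simp add: tuple_form_def sum_distrib_right mult.assoc)
  also have "\<dots> = (\<Sum>a\<in>S. \<Sum>b\<in>S. \<Sum>c\<in>T. \<Sum>j\<in>UNIV. X j a c * (U c b * cinner (Q j (h b)) (g a)))"
    by (intro sum.cong refl sum.swap)
  also have "\<dots> = (\<Sum>a\<in>S. \<Sum>c\<in>T. \<Sum>b\<in>S. \<Sum>j\<in>UNIV. X j a c * (U c b * cinner (Q j (h b)) (g a)))"
    by (intro sum.cong refl sum.swap)
  also have "\<dots> = (\<Sum>a\<in>S. \<Sum>c\<in>T. \<Sum>j\<in>UNIV. \<Sum>b\<in>S. X j a c * (U c b * cinner (Q j (h b)) (g a)))"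
    by (intro sum.cong refl sum.swap)
  finally show ?thesis
    by (simp add: bounded_clinear_sum[OF Q] bounded_clinear_scaleC[OF Q] cinner_sum_left
        cinner_scaleC_left sum_distrib_left)
qed

text \<open>
  The tuple \<open>X v f\<^sup>*\<close> has the norm of \<open>X\<close> at most, since \<open>v f\<^sup>*\<close> is a contraction. Such tuples
  restart a path from the vector \<open>v\<close> after projecting onto \<open>f\<close>.
\<close>

lemma tuple_norm_le_rank1:
  assumes Q: "\<And>j. bounded_clinear (Q j)" and X: "tuple_norm_le Q \<rho> S X"
    and v: "l2 S v \<le> 1" and f: "l2 S f \<le> 1"
  shows "tuple_norm_le Q \<rho> S (\<lambda>j a b. mat_apply S (X j) v a * cnj (f b))"
proof -
  have fin: "finite S" using X by (rule tuple_norm_le_finite)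
  have "cmod (tuple_form Q S (\<lambda>j a b. mat_apply S (X j) v a * cnj (f b)) h g) \<le> \<rho> * (l2 S h * l2 S g)" for h g
  proof -
    define h' where "h' c = (\<Sum>b\<in>S. (v c * cnj (f b)) *\<^sub>C h b)" for c
    have "tuple_form Q S (\<lambda>j a b. mat_apply S (X j) v a * cnj (f b)) h g = tuple_form Q S X h' g"
      using tuple_form_mult_right[OF Q fin, where X = X and T = S and U = "\<lambda>c b. v c * cnj (f b)" and h = h and g = g]
      by (simp add: mat_apply_def sum_distrib_right mult.assoc h'_def tuple_form_def)
    also have "cmod \<dots> \<le> \<rho> * (l2 S h' * l2 S g)" by (rule tuple_norm_le_bound[OF X])
    also have "\<dots> \<le> \<rho> * (l2 S h * l2 S g)"
    proof (intro mult_left_mono mult_right_mono)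
      have "norm (h' c) \<le> cmod (v c) * l2 S h" for c
      proof -
        have "norm (h' c) \<le> (\<Sum>b\<in>S. cmod (v c) * (cmod (f b) * norm (h b)))"
          unfolding h'_def by (rule order_trans[OF norm_sum]) (simp add: norm_scaleC norm_mult mult.assoc)
        also have "\<dots> \<le> cmod (v c) * (l2 S f * l2 S h)"
          unfolding sum_distrib_left[symmetric] by (intro mult_left_mono l2_CS) auto
        also have "\<dots> \<le> cmod (v c) * (1 * l2 S h)"
          using f by (intro mult_left_mono mult_right_mono) auto
        finally show ?thesis by simp
      qed
      then have "l2 S h' \<le> L2_set (\<lambda>c. cmod (v c) * l2 S h) S" by (intro L2_set_mono) auto
      also have "\<dots> = l2 S v * l2 S h" by (simp add: L2_set_left_distrib)
      also have "\<dots> \<le> 1 * l2 S h" by (intro mult_right_mono v) auto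
      finally show "l2 S h' \<le> l2 S h" by simp
    qed (use X in \<open>auto simp: tuple_norm_le_def\<close>)
    finally show ?thesis .
  qed
  with X show ?thesis by (auto simp: tuple_norm_le_def)
qed

text \<open>
  Compression by a contraction \<open>W\<close> does not increase \<open>\<parallel>Q(X)\<parallel>\<close>, because \<open>W\<close> acts on
  the matrix factor and commutes with the action of \<open>Q\<close> on the Hilbert space.
\<close>

lemma tuple_norm_le_compress:
  assumes Q: "\<And>j. bounded_clinear (Q j)" and X: "tuple_norm_le Q \<rho> S X" and fin: "finite T"
    and W: "\<And>h::'t \<Rightarrow> 'h::complex_hilbert. l2 S (\<lambda>a. \<Sum>p\<in>T. W p a *\<^sub>C h p) \<le> l2 T h"
  shows "tuple_norm_le (Q::'d::finite \<Rightarrow> 'h \<Rightarrow> 'h) \<rho> T (\<lambda>j p q. \<Sum>a\<in>S. cnj (W p a) * (\<Sum>b\<in>S. X j a b * W q b))"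
proof -
  let ?Y = "\<lambda>j p q. \<Sum>a\<in>S. cnj (W p a) * (\<Sum>b\<in>S. X j a b * W q b)"
  have "cmod (tuple_form Q T ?Y h g) \<le> \<rho> * (l2 T h * l2 T g)" for h g
  proof -
    let ?U = "\<lambda>h a. \<Sum>p\<in>T. W p a *\<^sub>C h p"
    let ?c = "\<lambda>j p q a b. cnj (W p a) * (X j a b * (W q b * cinner (Q j (h q)) (g p)))"
    have "tuple_form Q T ?Y h g = (\<Sum>p\<in>T. \<Sum>q\<in>T. \<Sum>j\<in>UNIV. \<Sum>a\<in>S. \<Sum>b\<in>S. ?c j p q a b)"
      by (simp add: tuple_form_def sum_distrib_right sum_distrib_left mult.assoc)
    also have "\<dots> = (\<Sum>p\<in>T. \<Sum>q\<in>T. \<Sum>a\<in>S. \<Sum>b\<in>S. \<Sum>j\<in>UNIV. ?c j p q a b)"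
      by (subst sum.swap[of _ S UNIV], subst sum.swap[of _ S UNIV]) simp
    also have "\<dots> = (\<Sum>p\<in>T. \<Sum>a\<in>S. \<Sum>b\<in>S. \<Sum>q\<in>T. \<Sum>j\<in>UNIV. ?c j p q a b)"
      by (subst sum.swap[of _ S T], subst sum.swap[of _ S T]) simp
    also have "\<dots> = (\<Sum>a\<in>S. \<Sum>b\<in>S. \<Sum>p\<in>T. \<Sum>q\<in>T. \<Sum>j\<in>UNIV. ?c j p q a b)"
      by (subst sum.swap[of _ S T], subst sum.swap[of _ S T]) simp
    also have "\<dots> = (\<Sum>a\<in>S. \<Sum>b\<in>S. \<Sum>j\<in>UNIV. \<Sum>p\<in>T. \<Sum>q\<in>T. ?c j p q a b)"
      by (intro sum.cong refl) (subst sum.swap[of _ UNIV T], subst sum.swap[of _ UNIV T], simp)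
    also have "\<dots> = tuple_form Q S X (?U h) (?U g)"
      unfolding tuple_form_def
    proof (intro sum.cong refl)
      fix a b j
      show "(\<Sum>p\<in>T. \<Sum>q\<in>T. ?c j p q a b) = X j a b * cinner (Q j (?U h b)) (?U g a)"
        by (simp add: bounded_clinear_sum[OF Q] bounded_clinear_scaleC[OF Q] cinner_sum_left cinner_sum_right
            cinner_scaleC_left cinner_scaleC_right sum_distrib_left mult_ac)
    qed
    also have "cmod \<dots> \<le> \<rho> * (l2 S (?U h) * l2 S (?U g))" by (rule tuple_norm_le_bound[OF X])
    also have "\<dots> \<le> \<rho> * (l2 T h * l2 T g)"
      using X by (intro mult_left_mono mult_mono W) (auto simp: tuple_norm_le_def)
    finally show ?thesis .
  qed
  with X fin show ?thesis by (auto simp: tuple_norm_le_def)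
qed

lemma l2_product: "l2 (A \<times> B) h = L2_set (\<lambda>p. l2 B (\<lambda>b. h (p, b))) A"
  unfolding L2_set_def by (simp add: sum.cartesian_product sum_nonneg)

text \<open>
  A block matrix with blocks \<open>X 0, X 1, \<dots>\<close> just below the diagonal maps orthogonal pieces to
  orthogonal pieces, so its norm is the largest of the norms of its blocks.
\<close>

lemma tuple_norm_le_block_shift:
  assumes X: "\<And>p. p < m \<Longrightarrow> tuple_norm_le Q \<rho> {..<n} (X p)" and \<rho>: "\<rho> \<ge> 0"
  shows "tuple_norm_le Q \<rho> ({..<Suc m} \<times> {..<n::nat})
    (\<lambda>j (q, a) (p, b). if q = Suc p then X p j a b else 0)"
proof -
  let ?S = "{..<Suc m} \<times> {..<n}"
  let ?X = "\<lambda>j (q, a) (p, b). if q = Suc p then X p j a b else (0::complex)"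
  have "cmod (tuple_form Q ?S ?X h g) \<le> \<rho> * (l2 ?S h * l2 ?S g)" for h g
  proof -
    define H where "H p = (\<lambda>b. h (p, b))" for p
    define G where "G p = (\<lambda>b. g (p, b))" for p
    have "tuple_form Q ?S ?X h g = (\<Sum>q<Suc m. \<Sum>a<n. \<Sum>p<Suc m. \<Sum>b<n. \<Sum>j\<in>UNIV.
        (if q = Suc p then X p j a b * cinner (Q j (H p b)) (G q a) else 0))"
      unfolding tuple_form_def H_def G_def sum.cartesian_product'
      by (intro sum.cong refl) auto
    also have "\<dots> = (\<Sum>q<Suc m. \<Sum>p<Suc m. \<Sum>a<n. \<Sum>b<n. \<Sum>j\<in>UNIV.
        (if q = Suc p then X p j a b * cinner (Q j (H p b)) (G q a) else 0))"
      by (intro sum.cong refl sum.swap)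
    also have "\<dots> = (\<Sum>p<Suc m. \<Sum>q<Suc m. if q = Suc p then tuple_form Q {..<n} (X p) (H p) (G (Suc p)) else 0)"
      by (subst sum.swap, intro sum.cong refl) (simp add: tuple_form_def)
    also have "\<dots> = (\<Sum>p<m. tuple_form Q {..<n} (X p) (H p) (G (Suc p)))"
      by simp (intro sum.cong refl, auto)
    also have "cmod \<dots> \<le> (\<Sum>p<m. \<rho> * (l2 {..<n} (H p) * l2 {..<n} (G (Suc p))))"
      by (rule order_trans[OF norm_sum]) (intro sum_mono tuple_norm_le_bound X, simp)
    also have "\<dots> \<le> \<rho> * (L2_set (\<lambda>p. l2 {..<n} (H p)) {..<m} * L2_set (\<lambda>p. l2 {..<n} (G (Suc p))) {..<m})"
      unfolding sum_distrib_left[symmetric]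
      using L2_set_mult_ineq[of "\<lambda>p. l2 {..<n} (H p)" "\<lambda>p. l2 {..<n} (G (Suc p))" "{..<m}"] \<rho>
      by (intro mult_left_mono) auto
    also have "\<dots> \<le> \<rho> * (l2 ?S h * l2 ?S g)"
    proof (intro mult_left_mono mult_mono \<rho>)
      show "L2_set (\<lambda>p. l2 {..<n} (H p)) {..<m} \<le> l2 ?S h"
        unfolding l2_product H_def L2_set_def[of _ "{..<m}"] L2_set_def[of _ "{..<Suc m}"]
        by (intro real_sqrt_le_mono sum_mono2) auto
      have "L2_set (\<lambda>p. l2 {..<n} (G (Suc p))) {..<m} = L2_set (\<lambda>p. l2 {..<n} (G p)) {Suc 0..<Suc m}"
        unfolding L2_set_def by (simp only: sum.atLeast_Suc_lessThan_Suc_shift lessThan_atLeast0 o_def)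
      also have "\<dots> \<le> l2 ?S g"
        unfolding l2_product G_def L2_set_def[of _ "{Suc 0..<Suc m}"] L2_set_def[of _ "{..<Suc m}"]
        by (intro real_sqrt_le_mono sum_mono2) auto
      finally show "L2_set (\<lambda>p. l2 {..<n} (G (Suc p))) {..<m} \<le> l2 ?S g" .
    qed auto
    finally show ?thesis .
  qed
  with \<rho> show ?thesis by (auto simp: tuple_norm_le_def)
qed

text \<open>
  The ball contains small multiples of each coordinate direction at every matrix size. Using
  them as entries of a path extracts single letters of a series.
\<close>

lemma tuple_norm_le_scalar_point:
  assumes Q: "\<And>j. bounded_clinear (Q j)"
  shows "\<exists>\<epsilon>>0. \<forall>S j0. finite S \<longrightarrow>
    tuple_norm_le Q (1/2) S (\<lambda>j a b. if j = j0 \<and> a = b then complex_of_real \<epsilon> else 0)"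
proof -
  obtain K where K: "\<And>j. K j \<ge> 0" "\<And>j x. norm (Q j x) \<le> K j * norm x"
    using bounded_clinear_bound[OF Q] by metis
  define \<epsilon> where "\<epsilon> = 1 / (2 * (1 + (\<Sum>j\<in>UNIV. K j)))"
  have pos: "1 + (\<Sum>j\<in>UNIV. K j) > 0" using sum_nonneg[of UNIV K] K(1) by (simp add: add_pos_nonneg)
  then have \<epsilon>: "\<epsilon> > 0" by (simp add: \<epsilon>_def)
  have \<epsilon>K: "\<epsilon> * K j \<le> 1/2" for j
  proof -
    have "K j \<le> 1 + (\<Sum>j\<in>UNIV. K j)" using member_le_sum[of j UNIV K] K(1) by simp
    then show ?thesis using pos by (simp add: \<epsilon>_def field_simps)
  qed
  have "cmod (tuple_form Q S (\<lambda>j a b. if j = j0 \<and> a = b then complex_of_real \<epsilon> else 0) h g) \<le> 1/2 * (l2 S h * l2 S g)"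
    if "finite S" for S :: "'c set" and j0 h g
  proof -
    have "tuple_form Q S (\<lambda>j a b. if j = j0 \<and> a = b then complex_of_real \<epsilon> else 0) h g =
      (\<Sum>a\<in>S. \<Sum>b\<in>S. if a = b then complex_of_real \<epsilon> * cinner (Q j0 (h b)) (g a) else 0)"
      unfolding tuple_form_def by (intro sum.cong refl) (auto simp: if_distribR if_distrib cong: if_cong)
    also have "\<dots> = (\<Sum>a\<in>S. complex_of_real \<epsilon> * cinner (Q j0 (h a)) (g a))"
      using that by simp
    also have "cmod \<dots> \<le> (\<Sum>a\<in>S. 1/2 * (norm (h a) * norm (g a)))"
    proof (rule order_trans[OF norm_sum], rule sum_mono)
      fix a
      have "cmod (cinner (Q j0 (h a)) (g a)) \<le> K j0 * norm (h a) * norm (g a)"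
        by (rule order_trans[OF cinner_Cauchy_Schwarz]) (intro mult_right_mono K norm_ge_zero)
      then have "cmod (complex_of_real \<epsilon> * cinner (Q j0 (h a)) (g a)) \<le> \<epsilon> * (K j0 * norm (h a) * norm (g a))"
        using \<epsilon> by (simp add: norm_mult)
      also have "\<dots> = (\<epsilon> * K j0) * (norm (h a) * norm (g a))" by simp
      also have "\<dots> \<le> 1/2 * (norm (h a) * norm (g a))" by (intro mult_right_mono \<epsilon>K) auto
      finally show "cmod (complex_of_real \<epsilon> * cinner (Q j0 (h a)) (g a)) \<le> 1/2 * (norm (h a) * norm (g a))" .
    qed
    also have "\<dots> \<le> 1/2 * (l2 S h * l2 S g)"
      unfolding sum_distrib_left[symmetric] by (intro mult_left_mono l2_CS) auto
    finally show ?thesis .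
  qed
  with \<epsilon> show ?thesis by (intro exI[of _ \<epsilon>]) (simp add: tuple_norm_le_def)
qed

section \<open>Points of the operator ball\<close>

lemma basis_bounded: "operator_space_basis E Q \<Longrightarrow> bounded_clinear (Q j)"
  by (simp add: operator_space_basis_def)

text \<open>
  The coordinate functionals on the span of \<open>Q\<close> are bounded by \<open>C\<close> for the norm of the form
  \<open>\<langle>T x, y\<rangle>\<close>.
\<close>

definition coordinate_bound :: "('d::finite \<Rightarrow> 'h::complex_hilbert \<Rightarrow> 'h) \<Rightarrow> real \<Rightarrow> bool" where
  "coordinate_bound Q C \<longleftrightarrow> C > 0 \<and> (\<forall>c \<rho> j. 0 \<le> \<rho> \<longrightarrow>
    (\<forall>x y. cmod (\<Sum>j\<in>UNIV. c j * cinner (Q j x) y) \<le> \<rho> * (norm x * norm y)) \<longrightarrow> cmod (c j) \<le> C * \<rho>)"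

text \<open>
  The quantity \<open>\<bar>\<langle>T x, y\<rangle>\<bar> / (1 + \<parallel>x\<parallel> \<parallel>y\<parallel>)\<close>, maximized over all \<open>x\<close> and \<open>y\<close>, is a seminorm
  of \<open>T = \<Sum>\<^sub>j c\<^sub>j Q\<^sub>j\<close> that is at most the operator norm; it is definite because the \<open>Q\<^sub>j\<close> are linearly
  independent.
\<close>

lemma basis_coordinates_bounded:
  fixes Q :: "'d::finite \<Rightarrow> 'h::complex_hilbert \<Rightarrow> 'h"
  assumes basis: "operator_space_basis E Q"
  obtains C where "coordinate_bound Q C"
proof -
  note Q = basis_bounded[OF basis]
  obtain K where K: "\<And>j. K j \<ge> 0" "\<And>j x. norm (Q j x) \<le> K j * norm x"
    using bounded_clinear_bound[OF Q] by metis
  define F where "F c x y = (\<Sum>j\<in>UNIV. c j * cinner (Q j x) y)" for c x y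
  define G where "G = (\<lambda>(x, y) c. cmod (F c x y) / (1 + norm x * norm y))"
  have pos: "1 + norm x * norm y > 0" for x y :: 'h by (simp add: add_pos_nonneg)
  have semi: "seminorm (G \<tau>)" for \<tau>
  proof -
    obtain x y where \<tau>: "\<tau> = (x, y)" by force
    have "F (\<lambda>i. c i + c' i) x y = F c x y + F c' x y" for c c'
      by (simp add: F_def distrib_right sum.distrib)
    then have "cmod (F (\<lambda>i. c i + c' i) x y) \<le> cmod (F c x y) + cmod (F c' x y)" for c c'
      by (simp add: norm_triangle_ineq)
    moreover have "F (\<lambda>i. t * c i) x y = t * F c x y" for t c
      by (simp add: F_def sum_distrib_left mult.assoc)
    ultimately show ?thesis
      unfolding seminorm_def G_def \<tau> using pos[of x y]
      by (simp add: add_divide_distrib[symmetric] divide_right_mono norm_mult)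
  qed
  have F_le: "cmod (F c x y) \<le> (\<Sum>j\<in>UNIV. cmod (c j) * K j) * (norm x * norm y)" for c x y
  proof -
    have "cmod (F c x y) \<le> (\<Sum>j\<in>UNIV. cmod (c j) * (K j * norm x * norm y))"
      unfolding F_def
    proof (rule order_trans[OF norm_sum], rule sum_mono)
      fix j
      have "cmod (cinner (Q j x) y) \<le> K j * norm x * norm y"
        by (rule order_trans[OF cinner_Cauchy_Schwarz]) (intro mult_right_mono K norm_ge_zero)
      then show "cmod (c j * cinner (Q j x) y) \<le> cmod (c j) * (K j * norm x * norm y)"
        by (simp add: norm_mult mult_left_mono)
    qed
    then show ?thesis by (simp add: sum_distrib_right mult.assoc)
  qed
  have G_le: "G (x, y) c \<le> \<rho>" if "cmod (F c x y) \<le> \<rho> * (norm x * norm y)" "\<rho> \<ge> 0" for x y c \<rho>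
  proof -
    have "cmod (F c x y) \<le> \<rho> * (1 + norm x * norm y)"
      using that by (simp add: distrib_left)
    then show ?thesis using pos[of x y] by (simp add: G_def pos_divide_le_eq)
  qed
  have bdd: "bdd_above ((\<lambda>\<tau>. G \<tau> c) ` UNIV)" for c
  proof (rule bdd_aboveI2)
    fix \<tau>
    have "0 \<le> (\<Sum>j\<in>UNIV. cmod (c j) * K j)" by (intro sum_nonneg mult_nonneg_nonneg K norm_ge_zero)
    then show "G \<tau> c \<le> (\<Sum>j\<in>UNIV. cmod (c j) * K j)"
      using G_le[OF F_le] by (cases \<tau>) auto
  qed
  define h where "h c = (SUP \<tau>. G \<tau> c)" for c
  have h: "seminorm h" unfolding h_def by (rule seminorm_SUP) (auto simp: semi bdd)
  have definite: "c = (\<lambda>j. 0)" if "h c = 0" for c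
  proof -
    have "(\<Sum>j\<in>UNIV. c j *\<^sub>C Q j x) = 0" for x
    proof -
      let ?T = "\<Sum>j\<in>UNIV. c j *\<^sub>C Q j x"
      have "G (x, ?T) c \<le> 0" using cSUP_upper[OF UNIV_I bdd, of "(x, ?T)" c] that by (simp add: h_def)
      then have "cmod (F c x ?T) \<le> 0" using pos[of x ?T] by (simp add: G_def pos_divide_le_eq)
      then have "cinner ?T ?T = 0" by (simp add: F_def cinner_sum_left cinner_scaleC_left)
      then show ?thesis by (simp only: cinner_eq_zero_iff)
    qed
    with basis show ?thesis by (auto simp: operator_space_basis_def)
  qed
  obtain C where C: "C > 0" "\<And>c j. cmod (c j) \<le> C * h c"
    using definite_seminorm_bounds_coordinates[OF finite h, of UNIV] definite by auto
  show ?thesis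
  proof (rule that, unfold coordinate_bound_def, intro conjI allI impI)
    show "C > 0" by (rule C(1))
  next
    fix c j and \<rho> :: real
    assume \<rho>: "0 \<le> \<rho>" and *: "\<forall>x y. cmod (\<Sum>j\<in>UNIV. c j * cinner (Q j x) y) \<le> \<rho> * (norm x * norm y)"
    have "h c \<le> \<rho>" unfolding h_def
      using G_le[of c _ _ \<rho>] * \<rho> by (intro cSUP_least) (auto simp: F_def)
    then show "cmod (c j) \<le> C * \<rho>"
      using C(2)[of c j] mult_left_mono[of "h c" \<rho> C] C(1) by linarith
  qed
qed

text \<open>
  The ball is bounded, at all matrix sizes at once: for vectors \<open>v\<close>, \<open>u\<close> the scalars
  \<open>\<langle>X\<^sub>j v, u\<rangle>\<close> are the coordinates of an element of the span of \<open>Q\<close> of norm at most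
  \<open>\<rho> \<parallel>v\<parallel> \<parallel>u\<parallel>\<close>.
\<close>

lemma tuple_norm_le_mat_apply_bound:
  assumes C: "coordinate_bound Q C" and Q: "\<And>j. bounded_clinear (Q j)" and X: "tuple_norm_le Q \<rho> S X"
  shows "l2 S (mat_apply S (X j) v) \<le> C * \<rho> * l2 S v"
proof (rule l2_duality)
  let ?u = "mat_apply S (X j) v"
  define c where "c j = (\<Sum>a\<in>S. mat_apply S (X j) v a * cnj (?u a))" for j
  have l2s: "l2 S (\<lambda>a. f a *\<^sub>C x) = l2 S f * norm x" for f and x :: 'b
    by (simp add: norm_scaleC L2_set_left_distrib)
  have C_pos: "C > 0" using C by (simp add: coordinate_bound_def)
  have "cmod (c j) \<le> C * (\<rho> * (l2 S v * l2 S ?u))"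
  proof (rule C[unfolded coordinate_bound_def, THEN conjunct2, rule_format])
    fix x y
    have "(\<Sum>j\<in>UNIV. c j * cinner (Q j x) y) =
       (\<Sum>j\<in>UNIV. \<Sum>a\<in>S. \<Sum>b\<in>S. X j a b * (v b * (cnj (?u a) * cinner (Q j x) y)))"
      unfolding c_def by (simp only: mat_apply_def[of S "X _" v] sum_distrib_right mult.assoc)
    also have "\<dots> = (\<Sum>a\<in>S. \<Sum>j\<in>UNIV. \<Sum>b\<in>S. X j a b * (v b * (cnj (?u a) * cinner (Q j x) y)))"
      by (rule sum.swap)
    also have "\<dots> = (\<Sum>a\<in>S. \<Sum>b\<in>S. \<Sum>j\<in>UNIV. X j a b * (v b * (cnj (?u a) * cinner (Q j x) y)))"
      by (intro sum.cong refl sum.swap)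
    also have "\<dots> = tuple_form Q S X (\<lambda>b. v b *\<^sub>C x) (\<lambda>a. ?u a *\<^sub>C y)"
      unfolding tuple_form_def
      by (simp add: bounded_clinear_scaleC[OF Q] cinner_scaleC_left cinner_scaleC_right mult_ac)
    also have "cmod \<dots> \<le> \<rho> * (l2 S (\<lambda>b. v b *\<^sub>C x) * l2 S (\<lambda>a. ?u a *\<^sub>C y))"
      by (rule tuple_norm_le_bound[OF X])
    finally show "cmod (\<Sum>j\<in>UNIV. c j * cinner (Q j x) y) \<le> \<rho> * (l2 S v * l2 S ?u) * (norm x * norm y)"
      unfolding l2s by (simp add: mult_ac)
  qed (use tuple_norm_le_nonneg[OF X] in auto)
  then show "cmod (\<Sum>a\<in>S. ?u a * cnj (?u a)) \<le> C * \<rho> * l2 S v * l2 S ?u"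
    unfolding c_def by (simp add: mult.assoc)
qed (use tuple_norm_le_nonneg[OF X] C in \<open>auto simp: coordinate_bound_def\<close>)

text \<open>
  Entries outside the matrix are set to zero, which embeds a point into all larger matrix sizes.
\<close>

definition nc_entries :: "'d nc_point \<Rightarrow> 'd \<Rightarrow> nat \<Rightarrow> nat \<Rightarrow> complex" where
  "nc_entries Z = (\<lambda>j a b. if a < fst Z \<and> b < fst Z then snd Z j $$ (a, b) else 0)"

lemma tensor_norm_l2: "tensor_norm n h = l2 {..<n} h"
  by (simp add: tensor_norm_def L2_set_def)

lemma Q_eval_apply:
  "Q_eval Q Z h a = (if a < fst Z then \<Sum>j\<in>UNIV. \<Sum>b<fst Z. nc_entries Z j a b *\<^sub>C Q j (h b) else 0)"
  by (cases Z) (simp add: Q_eval_def tensor_op_def nc_entries_def)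

lemma tuple_form_Q_eval:
  "tuple_form Q {..<fst Z} (nc_entries Z) h g = (\<Sum>a<fst Z. cinner (Q_eval Q Z h a) (g a))"
  unfolding tuple_form_def
  by (intro sum.cong refl) (simp add: Q_eval_apply cinner_sum_left cinner_scaleC_left sum.swap[of _ "{..<fst Z}"])

text \<open>
  Each \<open>Q\<^sub>j\<close> is bounded, so the supremum defining the operator norm is over a bounded set and bounds
  \<open>Q(X)\<close> on all vectors by homogeneity.
\<close>

lemma nc_ball_imp_tuple_norm_le:
  fixes Q :: "'d::finite \<Rightarrow> 'h::complex_hilbert \<Rightarrow> 'h"
  assumes Q: "\<And>j. bounded_clinear (Q j)" and Z: "Z \<in> nc_ball Q"
  obtains \<rho> where "\<rho> < 1" "tuple_norm_le Q \<rho> {..<fst Z} (nc_entries Z)"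
proof -
  define n where "n = fst Z"
  define T where "T = Q_eval Q Z"
  define \<rho> where "\<rho> = operator_norm (tensor_space n) (tensor_norm n) T"
  have \<rho>1: "\<rho> < 1" using Z by (simp add: nc_ball_def \<rho>_def n_def T_def)
  obtain K where K: "\<And>j. K j \<ge> 0" "\<And>j x. norm (Q j x) \<le> K j * norm x"
    using bounded_clinear_bound[OF Q] by metis
  define M where "M = (\<Sum>a<n. \<Sum>j\<in>UNIV. \<Sum>b<n. cmod (nc_entries Z j a b) * K j)"
  have M: "l2 {..<n} (T h) \<le> M * l2 {..<n} h" for h
  proof -
    have "l2 {..<n} (T h) \<le> (\<Sum>a<n. norm (T h a))" by (rule L2_set_le_sum) simp
    also have "\<dots> \<le> (\<Sum>a<n. \<Sum>j\<in>UNIV. \<Sum>b<n. cmod (nc_entries Z j a b) * K j * l2 {..<n} h)"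
    proof (rule sum_mono)
      fix a assume a: "a \<in> {..<n}"
      have "norm (T h a) = norm (\<Sum>j\<in>UNIV. \<Sum>b<n. nc_entries Z j a b *\<^sub>C Q j (h b))"
        using a by (simp add: T_def Q_eval_apply n_def)
      also have "\<dots> \<le> (\<Sum>j\<in>UNIV. \<Sum>b<n. norm (nc_entries Z j a b *\<^sub>C Q j (h b)))"
        by (rule order_trans[OF norm_sum]) (intro sum_mono norm_sum)
      also have "\<dots> \<le> (\<Sum>j\<in>UNIV. \<Sum>b<n. cmod (nc_entries Z j a b) * (K j * l2 {..<n} h))"
      proof (intro sum_mono)
        fix j b assume "b \<in> {..<n}"
        then have "norm (h b) \<le> l2 {..<n} h" by (intro member_le_L2_set) auto
        then have "norm (Q j (h b)) \<le> K j * l2 {..<n} h"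
          using K(2)[of j "h b"] mult_left_mono[of "norm (h b)" "l2 {..<n} h" "K j"] K(1)[of j] by linarith
        then show "norm (nc_entries Z j a b *\<^sub>C Q j (h b)) \<le> cmod (nc_entries Z j a b) * (K j * l2 {..<n} h)"
          by (simp add: norm_scaleC mult_left_mono)
      qed
      finally show "norm (T h a) \<le> (\<Sum>j\<in>UNIV. \<Sum>b<n. cmod (nc_entries Z j a b) * K j * l2 {..<n} h)"
        by (simp add: mult.assoc)
    qed
    finally show ?thesis by (simp add: M_def sum_distrib_right)
  qed
  have M0: "M \<ge> 0" unfolding M_def by (intro sum_nonneg mult_nonneg_nonneg K) auto
  have bdd: "bdd_above ((\<lambda>v. tensor_norm n (T v)) ` {v \<in> tensor_space n. tensor_norm n v \<le> 1})"
  proof (rule bdd_aboveI2)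
    fix v :: "nat \<Rightarrow> 'h" assume "v \<in> {v \<in> tensor_space n. tensor_norm n v \<le> 1}"
    then have "l2 {..<n} v \<le> 1" by (simp add: tensor_norm_l2)
    then have "M * l2 {..<n} v \<le> M * 1" by (rule mult_left_mono) (rule M0)
    with M[of v] show "tensor_norm n (T v) \<le> M" by (simp add: tensor_norm_l2)
  qed
  have unit: "l2 {..<n} (T v) \<le> \<rho>" if "v \<in> tensor_space n" "l2 {..<n} v \<le> 1" for v :: "nat \<Rightarrow> 'h"
    using cSUP_upper[OF _ bdd, of v] that by (simp add: \<rho>_def operator_norm_def tensor_norm_l2)
  have "T (\<lambda>_. 0) a = 0" for a
    by (simp add: T_def Q_eval_apply bounded_clinear_zero[OF Q])
  then have T0: "l2 {..<n} (T (\<lambda>_. 0)) = 0" by (simp add: L2_set_def)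
  have \<rho>0: "\<rho> \<ge> 0" using unit[of "\<lambda>_. 0"] T0 by (simp add: tensor_space_def L2_set_def)
  have T_le: "l2 {..<n} (T h) \<le> \<rho> * l2 {..<n} h" for h
  proof (cases "l2 {..<n} h = 0")
    case True then show ?thesis using M[of h] \<rho>0 L2_set_nonneg[of "\<lambda>a. norm (T h a)"] by simp
  next
    case False
    define c where "c = l2 {..<n} h"
    have c: "c > 0" using False L2_set_nonneg[of "\<lambda>a. norm (h a)" "{..<n}"] by (simp add: c_def less_le)
    define v where "v a = (if a < n then complex_of_real (1 / c) *\<^sub>C h a else 0)" for a
    have "l2 {..<n} v = L2_set (\<lambda>a. (1 / c) * norm (h a)) {..<n}"
      using c by (intro L2_set_cong) (auto simp: v_def norm_scaleC norm_divide)
    also have "\<dots> = (1 / c) * c" using c by (subst L2_set_right_distrib[symmetric]) (auto simp: c_def)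
    finally have v1: "l2 {..<n} v \<le> 1" using c by simp
    have vT: "v \<in> tensor_space n" by (simp add: tensor_space_def v_def)
    have "T v a = complex_of_real (1 / c) *\<^sub>C T h a" for a
      by (simp add: T_def Q_eval_apply n_def[symmetric] v_def bounded_clinear_scaleC[OF Q] scaleC_sum_right
          scaleC_scaleC mult.commute)
    then have "l2 {..<n} (T v) = L2_set (\<lambda>a. (1 / c) * norm (T h a)) {..<n}"
      using c by (intro L2_set_cong) (auto simp: norm_scaleC norm_divide)
    also have "\<dots> = (1 / c) * l2 {..<n} (T h)" using c by (subst L2_set_right_distrib[symmetric]) auto
    finally have "(1 / c) * l2 {..<n} (T h) \<le> \<rho>"
      using unit[OF _ v1] vT by simp
    then show ?thesis using c by (simp add: field_simps c_def)
  qed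
  have "cmod (tuple_form Q {..<n} (nc_entries Z) h g) \<le> \<rho> * (l2 {..<n} h * l2 {..<n} g)" for h g
  proof -
    have "cmod (tuple_form Q {..<n} (nc_entries Z) h g) \<le> (\<Sum>a<n. norm (T h a) * norm (g a))"
      unfolding n_def tuple_form_Q_eval T_def
      by (rule order_trans[OF norm_sum]) (intro sum_mono cinner_Cauchy_Schwarz)
    also have "\<dots> \<le> l2 {..<n} (T h) * l2 {..<n} g" by (rule l2_CS)
    also have "\<dots> \<le> \<rho> * l2 {..<n} h * l2 {..<n} g" by (intro mult_right_mono T_le) auto
    finally show ?thesis by (simp add: mult.assoc)
  qed
  with \<rho>0 \<rho>1 show ?thesis by (intro that[of \<rho>]) (auto simp: tuple_norm_le_def n_def)
qed

lemma tuple_norm_le_imp_nc_ball: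
  assumes Z: "Z \<in> nc_universe" and X: "tuple_norm_le Q \<rho> {..<fst Z} (nc_entries Z)" and \<rho>: "\<rho> < 1"
  shows "Z \<in> nc_ball Q"
proof -
  define n where "n = fst Z"
  define T where "T = Q_eval Q Z"
  have "tensor_norm n (T h) \<le> \<rho>" if "tensor_norm n h \<le> 1" for h
  proof -
    have eq: "tuple_form Q {..<n} (nc_entries Z) h (T h) = complex_of_real ((l2 {..<n} (T h))\<^sup>2)"
      unfolding n_def T_def tuple_form_Q_eval l2_square cinner_self of_real_sum ..
    have "(l2 {..<n} (T h))\<^sup>2 \<le> \<rho> * (l2 {..<n} h * l2 {..<n} (T h))"
      using tuple_norm_le_bound[OF X[folded n_def], of h "T h"] unfolding eq norm_of_real by simp
    also have "\<dots> \<le> \<rho> * (1 * l2 {..<n} (T h))"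
      using that tuple_norm_le_nonneg[OF X] by (intro mult_left_mono mult_right_mono) (auto simp: tensor_norm_l2)
    finally have "l2 {..<n} (T h) * l2 {..<n} (T h) \<le> \<rho> * l2 {..<n} (T h)"
      by (simp add: power2_eq_square)
    then show ?thesis
      using tuple_norm_le_nonneg[OF X] L2_set_nonneg[of "\<lambda>a. norm (T h a)" "{..<n}"]
      unfolding tensor_norm_l2 by (metis mult_right_le_imp_le order_le_less)
  qed
  moreover have "(\<lambda>_. 0) \<in> {v \<in> tensor_space n. tensor_norm n v \<le> 1}"
    by (simp add: tensor_space_def tensor_norm_def)
  ultimately have "operator_norm (tensor_space n) (tensor_norm n) T \<le> \<rho>"
    unfolding operator_norm_def by (intro cSUP_least) auto
  with Z \<rho> show ?thesis by (simp add: nc_ball_def n_def T_def)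
qed

lemma nc_scale_in_ball:
  assumes Q: "\<And>j. bounded_clinear (Q j)" and Z: "Z \<in> nc_ball Q" and r: "0 \<le> r" "r \<le> 1"
  shows "nc_scale r Z \<in> nc_ball Q"
    and "nc_entries (nc_scale r Z) = (\<lambda>j a b. complex_of_real r * nc_entries Z j a b)"
    and "fst (nc_scale r Z) = fst Z"
proof -
  obtain n X where ZX: "Z = (n, X)" by force
  have U: "Z \<in> nc_universe" using Z by (simp add: nc_ball_def)
  then have X: "X j \<in> carrier_mat n n" for j by (simp add: nc_universe_def ZX)
  show f: "fst (nc_scale r Z) = fst Z" by (simp add: nc_scale_def ZX)
  show e: "nc_entries (nc_scale r Z) = (\<lambda>j a b. complex_of_real r * nc_entries Z j a b)"
  proof (intro ext)
    fix j a b
    show "nc_entries (nc_scale r Z) j a b = complex_of_real r * nc_entries Z j a b"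
      using X[of j] by (auto simp: nc_entries_def nc_scale_def ZX)
  qed
  obtain \<rho> where \<rho>: "\<rho> < 1" "tuple_norm_le Q \<rho> {..<fst Z} (nc_entries Z)"
    using nc_ball_imp_tuple_norm_le[OF Q Z] .
  have "r * \<rho> < 1" using r \<rho> tuple_norm_le_nonneg[OF \<rho>(2)] mult_left_le_one_le[of \<rho> r] by linarith
  moreover have "nc_scale r Z \<in> nc_universe" using U by (auto simp: nc_universe_def nc_scale_def ZX)
  ultimately show "nc_scale r Z \<in> nc_ball Q"
    using tuple_norm_le_scale[OF \<rho>(2), of "complex_of_real r"] r
    by (intro tuple_norm_le_imp_nc_ball[of _ _ "r * \<rho>"]) (auto simp: e f)
qed

section \<open>Words in matrices and Gram--Schmidt\<close>

definition word_apply :: "'s set \<Rightarrow> ('d \<Rightarrow> 's \<Rightarrow> 's \<Rightarrow> complex) \<Rightarrow> 'd list \<Rightarrow> ('s \<Rightarrow> complex) \<Rightarrow> 's \<Rightarrow> complex" where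
  "word_apply S X u v = foldr (\<lambda>j. mat_apply S (X j)) u v"

lemma word_apply_Nil [simp]: "word_apply S X [] v = v"
  and word_apply_Cons [simp]: "word_apply S X (j # u) v = mat_apply S (X j) (word_apply S X u v)"
  and word_apply_append: "word_apply S X (u @ u') v = word_apply S X u (word_apply S X u' v)"
  by (simp_all add: word_apply_def)

lemma mat_apply_add: "mat_apply S A (\<lambda>b. v b + w b) = (\<lambda>a. mat_apply S A v a + mat_apply S A w a)"
  and mat_apply_mult: "mat_apply S A (\<lambda>b. t * v b) = (\<lambda>a. t * mat_apply S A v a)"
  by (simp_all add: mat_apply_def fun_eq_iff distrib_left sum.distrib sum_distrib_left mult_ac)

lemma mat_apply_zero [simp]: "mat_apply S A (\<lambda>b. 0) = (\<lambda>a. 0)"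
  by (simp add: mat_apply_def)

lemma mat_apply_sum: "mat_apply S A (\<lambda>b. \<Sum>i\<in>I. v i b) = (\<lambda>a. \<Sum>i\<in>I. mat_apply S A (v i) a)"
  by (induction I rule: infinite_finite_induct) (simp_all add: mat_apply_add)

lemma mat_apply_cong: "(\<And>b. b \<in> S \<Longrightarrow> v b = w b) \<Longrightarrow> mat_apply S A v = mat_apply S A w"
  by (simp add: mat_apply_def)

lemma word_apply_add: "word_apply S X u (\<lambda>b. v b + w b) = (\<lambda>a. word_apply S X u v a + word_apply S X u w a)"
  by (induction u) (simp_all add: mat_apply_add)

lemma word_apply_mult: "word_apply S X u (\<lambda>b. t * v b) = (\<lambda>a. t * word_apply S X u v a)"
  by (induction u) (simp_all add: mat_apply_mult)

lemma word_apply_zero [simp]: "word_apply S X u (\<lambda>b. 0) = (\<lambda>a. 0)"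
  by (induction u) simp_all

lemma word_apply_sum: "word_apply S X u (\<lambda>b. \<Sum>i\<in>I. v i b) = (\<lambda>a. \<Sum>i\<in>I. word_apply S X u (v i) a)"
  by (induction I rule: infinite_finite_induct) (simp_all add: word_apply_add)

lemma word_apply_bound:
  assumes "\<And>j v. l2 S (mat_apply S (X j) v) \<le> C * l2 S v" "C \<ge> 0"
  shows "l2 S (word_apply S X u v) \<le> C ^ length u * l2 S v"
proof (induction u)
  case (Cons j u)
  have "l2 S (word_apply S X (j # u) v) \<le> C * l2 S (word_apply S X u v)" using assms(1) by simp
  also have "\<dots> \<le> C * (C ^ length u * l2 S v)" by (intro mult_left_mono Cons assms)
  finally show ?case by (simp add: mult.assoc)
qed simp

definition inner_prod :: "'s set \<Rightarrow> ('s \<Rightarrow> complex) \<Rightarrow> ('s \<Rightarrow> complex) \<Rightarrow> complex" where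
  "inner_prod S x y = (\<Sum>a\<in>S. x a * cnj (y a))"

lemma inner_prod_add_left: "inner_prod S (\<lambda>a. x a + y a) z = inner_prod S x z + inner_prod S y z"
  and inner_prod_mult_left: "inner_prod S (\<lambda>a. t * x a) z = t * inner_prod S x z"
  and inner_prod_mult_right: "inner_prod S z (\<lambda>a. t * x a) = cnj t * inner_prod S z x"
  and inner_prod_diff_left: "inner_prod S (\<lambda>a. x a - y a) z = inner_prod S x z - inner_prod S y z"
  by (simp_all add: inner_prod_def algebra_simps sum.distrib sum_distrib_left sum_subtractf)

lemma inner_prod_sum_left: "inner_prod S (\<lambda>a. \<Sum>p\<in>T. f p a) z = (\<Sum>p\<in>T. inner_prod S (f p) z)"
  unfolding inner_prod_def sum_distrib_right by (rule sum.swap)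

lemma inner_prod_sum_right: "inner_prod S z (\<lambda>a. \<Sum>p\<in>T. f p a) = (\<Sum>p\<in>T. inner_prod S z (f p))"
  unfolding inner_prod_def sum_distrib_left cnj_sum by (rule sum.swap)

lemma inner_prod_commute: "inner_prod S x y = cnj (inner_prod S y x)"
  by (simp add: inner_prod_def mult.commute)

lemma inner_prod_self: "inner_prod S x x = of_real ((l2 S x)\<^sup>2)"
  unfolding inner_prod_def l2_square of_real_sum complex_norm_square ..

lemma inner_prod_CS: "cmod (inner_prod S x y) \<le> l2 S x * l2 S y"
proof -
  have "cmod (inner_prod S x y) \<le> (\<Sum>a\<in>S. cmod (x a) * cmod (y a))"
    unfolding inner_prod_def by (rule order_trans[OF norm_sum]) (simp add: norm_mult)
  also have "\<dots> \<le> l2 S x * l2 S y" by (rule l2_CS)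
  finally show ?thesis .
qed

lemma inner_prod_cong: "(\<And>a. a \<in> S \<Longrightarrow> x a = x' a) \<Longrightarrow> inner_prod S x y = inner_prod S x' y"
  by (simp add: inner_prod_def)

text \<open>
  Vectors of an orthosystem may vanish. This keeps their number fixed when the vectors to be
  spanned are dependent.
\<close>

definition orthosystem :: "'s set \<Rightarrow> nat \<Rightarrow> (nat \<Rightarrow> 's \<Rightarrow> complex) \<Rightarrow> bool" where
  "orthosystem S m f \<longleftrightarrow> (\<forall>p<m. \<forall>q<m. p \<noteq> q \<longrightarrow> inner_prod S (f p) (f q) = 0) \<and> (\<forall>p<m. inner_prod S (f p) (f p) \<in> {0, 1})"

lemma Gram_Schmidt:
  assumes "finite S"
  shows "\<exists>f. orthosystem S m f \<and> (\<forall>i<m. \<forall>a\<in>S. u i a = (\<Sum>p<m. inner_prod S (u i) (f p) * f p a))"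
proof (induction m)
  case 0
  show ?case by (simp add: orthosystem_def)
next
  case (Suc m)
  then obtain f where f: "orthosystem S m f"
    and u: "\<And>i a. i < m \<Longrightarrow> a \<in> S \<Longrightarrow> u i a = (\<Sum>p<m. inner_prod S (u i) (f p) * f p a)" by auto
  define w where "w a = u m a - (\<Sum>p<m. inner_prod S (u m) (f p) * f p a)" for a
  have zero: "f p a = 0" if "p < m" "inner_prod S (f p) (f p) = 0" "a \<in> S" for p a
    using that assms by (simp add: inner_prod_self L2_set_eq_0_iff)
  have wf: "inner_prod S w (f q) = 0" if "q < m" for q
  proof -
    have "inner_prod S w (f q) = inner_prod S (u m) (f q) - (\<Sum>p<m. inner_prod S (u m) (f p) * inner_prod S (f p) (f q))"
      unfolding w_def inner_prod_diff_left inner_prod_sum_left inner_prod_mult_left ..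
    also have "(\<Sum>p<m. inner_prod S (u m) (f p) * inner_prod S (f p) (f q)) = (\<Sum>p<m. if p = q then inner_prod S (u m) (f q) * inner_prod S (f q) (f q) else 0)"
      using f that by (intro sum.cong) (auto simp: orthosystem_def)
    also have "\<dots> = inner_prod S (u m) (f q) * inner_prod S (f q) (f q)" using that by simp
    also have "\<dots> = inner_prod S (u m) (f q)"
    proof (cases "inner_prod S (f q) (f q) = 0")
      case True
      with zero[OF that True] show ?thesis by (simp add: inner_prod_def)
    next
      case False with f that show ?thesis by (auto simp: orthosystem_def)
    qed
    finally show ?thesis by simp
  qed
  define N where "N = l2 S w"
  define g where "g a = complex_of_real (1 / N) * w a" for a
  define f' where "f' = f(m := g)"
  have f'_old: "f' p = f p" if "p < m" for p using that by (simp add: f'_def)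
  have gf: "inner_prod S g (f q) = 0" if "q < m" for q
    unfolding g_def inner_prod_mult_left using wf[OF that] by simp
  then have fg: "inner_prod S (f q) g = 0" if "q < m" for q
    using that inner_prod_commute[of S "f q" g] by simp
  have gg: "inner_prod S g g \<in> {0, 1}"
    unfolding g_def inner_prod_mult_left inner_prod_mult_right
    unfolding inner_prod_self N_def[symmetric] by (cases "N = 0") (auto simp: power2_eq_square)
  have orth: "orthosystem S (Suc m) f'"
    using f gf fg gg unfolding orthosystem_def by (auto simp: f'_def less_Suc_eq)
  have um: "u m a = w a + (\<Sum>p<m. inner_prod S (u m) (f p) * f p a)" for a by (simp add: w_def)
  have umg: "inner_prod S (u m) g = inner_prod S w g"
  proof -
    have "inner_prod S (u m) g = inner_prod S (\<lambda>a. w a + (\<Sum>p<m. inner_prod S (u m) (f p) * f p a)) g"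
      by (rule inner_prod_cong) (rule um)
    also have "\<dots> = inner_prod S w g" unfolding inner_prod_add_left inner_prod_sum_left inner_prod_mult_left using fg by simp
    finally show ?thesis .
  qed
  have wg: "inner_prod S w g * g a = w a" if "a \<in> S" for a
  proof (cases "N = 0")
    case True
    then have "w a = 0" using that assms by (simp add: N_def L2_set_eq_0_iff)
    then show ?thesis by (simp add: g_def)
  next
    case False
    then show ?thesis
      unfolding g_def inner_prod_mult_right
      unfolding inner_prod_self N_def[symmetric] by (simp add: power2_eq_square)
  qed
  have "u i a = (\<Sum>p<Suc m. inner_prod S (u i) (f' p) * f' p a)" if i: "i < Suc m" and a: "a \<in> S" for i a
  proof (cases "i = m")
    case True
    then show ?thesis using um[of a] wg[OF a] umg by (simp add: f'_def)
  next
    case False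
    with i have im: "i < m" by simp
    have "inner_prod S (u i) g = inner_prod S (\<lambda>a. \<Sum>p<m. inner_prod S (u i) (f p) * f p a) g"
      by (rule inner_prod_cong) (rule u[OF im])
    also have "\<dots> = 0" unfolding inner_prod_sum_left inner_prod_mult_left using fg by simp
    finally show ?thesis using u[OF im a] by (simp add: f'_def)
  qed
  with orth show ?case by blast
qed

lemma orthosystem_isometric:
  assumes f: "orthosystem S m f"
  shows "l2 S (\<lambda>a. \<Sum>p<m. f p a *\<^sub>C h p) \<le> l2 {..<m} (h :: nat \<Rightarrow> 'h::complex_hilbert)"
proof (rule power2_le_imp_le)
  let ?g = "\<lambda>a. \<Sum>p<m. f p a *\<^sub>C h p"
  have "complex_of_real ((l2 S ?g)\<^sup>2) = (\<Sum>a\<in>S. \<Sum>p<m. \<Sum>q<m. (f p a * cnj (f q a)) * cinner (h p) (h q))"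
    unfolding l2_square of_real_sum cinner_self[symmetric]
    by (simp add: cinner_sum_left cinner_sum_right cinner_scaleC_left cinner_scaleC_right sum_distrib_left mult.assoc)
      (rule sum.cong[OF refl], subst sum.swap, simp add: mult_ac)
  also have "\<dots> = (\<Sum>p<m. \<Sum>a\<in>S. \<Sum>q<m. (f p a * cnj (f q a)) * cinner (h p) (h q))"
    by (rule sum.swap)
  also have "\<dots> = (\<Sum>p<m. \<Sum>q<m. \<Sum>a\<in>S. (f p a * cnj (f q a)) * cinner (h p) (h q))"
    by (intro sum.cong refl sum.swap)
  also have "\<dots> = (\<Sum>p<m. \<Sum>q<m. inner_prod S (f p) (f q) * cinner (h p) (h q))"
    by (simp add: inner_prod_def sum_distrib_right)
  also have "\<dots> = (\<Sum>p<m. \<Sum>q<m. if q = p then inner_prod S (f p) (f p) * cinner (h p) (h p) else 0)"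
    using f by (intro sum.cong refl) (auto simp: orthosystem_def)
  also have "\<dots> = complex_of_real (\<Sum>p<m. (l2 S (f p))\<^sup>2 * (norm (h p))\<^sup>2)"
    by (simp add: inner_prod_self cinner_self)
  finally have "(l2 S ?g)\<^sup>2 = (\<Sum>p<m. (l2 S (f p))\<^sup>2 * (norm (h p))\<^sup>2)"
    using of_real_eq_iff by blast
  also have "\<dots> \<le> (\<Sum>p<m. (norm (h p))\<^sup>2)"
  proof (rule sum_mono)
    fix p assume "p \<in> {..<m}"
    then have "inner_prod S (f p) (f p) \<in> {0, 1}" using f by (simp add: orthosystem_def)
    then have "(l2 S (f p))\<^sup>2 = 0 \<or> (l2 S (f p))\<^sup>2 = 1" unfolding inner_prod_self
      by (metis empty_iff insert_iff of_real_0 of_real_1 of_real_eq_iff)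
    then have "(l2 S (f p))\<^sup>2 \<le> 1" by linarith
    then show "(l2 S (f p))\<^sup>2 * (norm (h p))\<^sup>2 \<le> (norm (h p))\<^sup>2"
      using mult_right_mono[of _ 1 "(norm (h p))\<^sup>2"] by fastforce
  qed
  finally show "(l2 S ?g)\<^sup>2 \<le> (l2 {..<m} h)\<^sup>2" by (simp add: l2_square)
qed simp

lemma orthosystem_Bessel:
  assumes f: "orthosystem S m f"
  shows "l2 {..<m} (\<lambda>p. inner_prod S x (f p)) \<le> l2 S x"
proof -
  define t where "t p = inner_prod S x (f p)" for p
  define w where "w a = (\<Sum>p<m. t p * f p a)" for a
  have "inner_prod S x w = complex_of_real ((l2 {..<m} t)\<^sup>2)"
    unfolding w_def inner_prod_sum_right inner_prod_mult_right l2_square of_real_sum complex_norm_square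
    by (simp add: t_def mult.commute)
  then have 1: "(l2 {..<m} t)\<^sup>2 \<le> l2 S x * l2 S w"
    using inner_prod_CS[of S x w] unfolding \<open>inner_prod S x w = _\<close> norm_of_real by simp
  have "inner_prod S w w = (\<Sum>p<m. t p * (\<Sum>q<m. cnj (t q) * inner_prod S (f p) (f q)))"
    unfolding w_def inner_prod_sum_left inner_prod_mult_left inner_prod_sum_right inner_prod_mult_right ..
  also have "\<dots> = (\<Sum>p<m. t p * (\<Sum>q<m. if q = p then cnj (t p) * inner_prod S (f p) (f p) else 0))"
    using f by (intro sum.cong refl arg_cong[of _ _ "(*) _"]) (auto simp: orthosystem_def)
  also have "\<dots> = (\<Sum>p<m. t p * cnj (t p) * inner_prod S (f p) (f p))" by (simp add: mult.assoc)
  also have "\<dots> = (\<Sum>p<m. t p * cnj (t p))"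
  proof (intro sum.cong refl)
    fix p assume p: "p \<in> {..<m}"
    show "t p * cnj (t p) * inner_prod S (f p) (f p) = t p * cnj (t p)"
    proof (cases "inner_prod S (f p) (f p) = 0")
      case True
      then have "l2 S (f p) = 0" by (simp add: inner_prod_self)
      then have "t p = 0" using inner_prod_CS[of S x "f p"] by (simp add: t_def)
      then show ?thesis by simp
    next
      case False then show ?thesis using f p by (auto simp: orthosystem_def)
    qed
  qed
  finally have "(l2 S w)\<^sup>2 = (l2 {..<m} t)\<^sup>2"
    unfolding inner_prod_self complex_norm_square[symmetric] of_real_sum[symmetric] l2_square[where S = "{..<m}"]
    using of_real_eq_iff by blast
  then have "l2 S w = l2 {..<m} t" by simp
  with 1 have "l2 {..<m} t * l2 {..<m} t \<le> l2 S x * l2 {..<m} t" by (simp add: power2_eq_square)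
  then show ?thesis unfolding t_def[symmetric]
    by (metis L2_set_nonneg mult_right_le_imp_le order_le_less)
qed

section \<open>Compression to a bounded level\<close>

definition words :: "nat \<Rightarrow> 'd list set" where
  "words D = {u. length u < D}"

lemma finite_words [simp]: "finite (words D :: 'd::finite list set)"
proof -
  have "finite {u :: 'd list. set u \<subseteq> UNIV \<and> length u \<le> D}"
    by (rule finite_lists_length_le) simp
  then show ?thesis by (rule finite_subset[rotated]) (auto simp: words_def)
qed

definition poly_apply :: "nat \<Rightarrow> nat \<Rightarrow> (nat \<Rightarrow> nat \<Rightarrow> 'd list \<Rightarrow> complex) \<Rightarrow> 's set \<Rightarrow>
    ('d \<Rightarrow> 's \<Rightarrow> 's \<Rightarrow> complex) \<Rightarrow> (nat \<Rightarrow> 's \<Rightarrow> complex) \<Rightarrow> nat \<Rightarrow> 's \<Rightarrow> complex" where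
  "poly_apply k D pc S X \<xi> i a = (\<Sum>l<k. \<Sum>u\<in>words D. pc i l u * word_apply S X u (\<xi> l) a)"

definition block_norm :: "nat \<Rightarrow> 's set \<Rightarrow> (nat \<Rightarrow> 's \<Rightarrow> complex) \<Rightarrow> real" where
  "block_norm k S \<xi> = L2_set (\<lambda>i. l2 S (\<xi> i)) {..<k}"

lemma block_norm_nonneg [simp]: "block_norm k S \<xi> \<ge> 0"
  by (simp add: block_norm_def)

lemma block_norm_mult: "block_norm k S (\<lambda>i a. t * \<xi> i a) = cmod t * block_norm k S \<xi>"
  by (simp add: block_norm_def norm_mult L2_set_right_distrib)

lemma block_norm_cong: "(\<And>i a. i < k \<Longrightarrow> a \<in> S \<Longrightarrow> \<xi> i a = \<xi>' i a) \<Longrightarrow> block_norm k S \<xi> = block_norm k S \<xi>'"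
  by (simp add: block_norm_def cong: L2_set_cong_simp)

lemma block_norm_triangle: "block_norm k S (\<lambda>i a. \<xi> i a + \<eta> i a) \<le> block_norm k S \<xi> + block_norm k S \<eta>"
  unfolding block_norm_def
  by (rule order_trans[OF L2_set_mono L2_set_triangle_ineq]) (auto simp: l2_triangle)

lemma l2_le_block_norm: "i < k \<Longrightarrow> l2 S (\<xi> i) \<le> block_norm k S \<xi>"
  unfolding block_norm_def by (rule member_le_L2_set) auto

lemma block_norm_le_sum: "block_norm k S \<xi> \<le> (\<Sum>i<k. l2 S (\<xi> i))"
  unfolding block_norm_def by (rule L2_set_le_sum) auto

lemma block_norm_eq_0_iff: "finite S \<Longrightarrow> block_norm k S \<xi> = 0 \<longleftrightarrow> (\<forall>i<k. \<forall>a\<in>S. \<xi> i a = 0)"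
  by (auto simp: block_norm_def L2_set_eq_0_iff)

lemma poly_apply_mult: "poly_apply k D pc S X (\<lambda>l a. t * \<xi> l a) = (\<lambda>i a. t * poly_apply k D pc S X \<xi> i a)"
  by (simp add: poly_apply_def fun_eq_iff word_apply_mult sum_distrib_left mult_ac)

lemma poly_apply_add: "poly_apply k D pc S X (\<lambda>l a. \<xi> l a + \<eta> l a) = (\<lambda>i a. poly_apply k D pc S X \<xi> i a + poly_apply k D pc S X \<eta> i a)"
  by (simp add: poly_apply_def fun_eq_iff word_apply_add distrib_left sum.distrib)

lemma poly_apply_zero [simp]: "poly_apply k D pc S X (\<lambda>l a. 0) = (\<lambda>i a. 0)"
  by (simp add: poly_apply_def fun_eq_iff)

lemma poly_apply_sum: "poly_apply k D pc S X (\<lambda>l a. \<Sum>t\<in>I. \<xi> t l a) = (\<lambda>i a. \<Sum>t\<in>I. poly_apply k D pc S X (\<xi> t) i a)"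
  by (induction I rule: infinite_finite_induct) (simp_all add: poly_apply_add)

text \<open>
  Evaluating a polynomial matrix of degree less than \<open>D\<close> at \<open>X\<close> on a vector \<open>\<xi>\<close> involves only
  the vectors \<open>X\<^sup>w \<xi>\<^sub>l\<close> with \<open>\<bar>w\<bar> < D\<close>. There are \<open>m\<close> of them, whatever the size of \<open>X\<close>. Compressing \<open>X\<close> to
  their span gives a tuple of size \<open>m\<close> that acts on \<open>\<xi>\<close> in the same way.
\<close>

lemma compression:
  fixes Q :: "'d::finite \<Rightarrow> 'h::complex_hilbert \<Rightarrow> 'h" and X :: "'d \<Rightarrow> 's \<Rightarrow> 's \<Rightarrow> complex"
  assumes Q: "\<And>j. bounded_clinear (Q j)" and X: "tuple_norm_le Q \<rho> S X"
    and m_def: "m = card ({..<k} \<times> (words D :: 'd list set))" and D: "D > 0"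
  shows "\<exists>Y \<zeta>. tuple_norm_le Q \<rho> {..<m} Y \<and> block_norm k {..<m} \<zeta> = block_norm k S \<xi> \<and>
    block_norm k {..<m} (poly_apply k D pc {..<m} Y \<zeta>) \<le> block_norm k S (poly_apply k D pc S X \<xi>)"
proof -
  have fin: "finite S" using X by (rule tuple_norm_le_finite)
  have "finite ({..<k} \<times> (words D :: 'd list set))" by simp
  from ex_bij_betw_nat_finite[OF this] obtain e where "bij_betw e {0..<m} ({..<k} \<times> (words D :: 'd list set))"
    unfolding m_def by blast
  then have e: "e ` {0..<m} = {..<k} \<times> (words D :: 'd list set)" by (simp add: bij_betw_def)
  define x where "x i = (case e i of (l, w) \<Rightarrow> word_apply S X w (\<xi> l))" for i
  from Gram_Schmidt[OF fin, of m x] obtain f where f: "orthosystem S m f"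
    and fx: "\<And>i a. i < m \<Longrightarrow> a \<in> S \<Longrightarrow> x i a = (\<Sum>p<m. inner_prod S (x i) (f p) * f p a)" by blast
  have exp: "word_apply S X w (\<xi> l) a = (\<Sum>p<m. inner_prod S (word_apply S X w (\<xi> l)) (f p) * f p a)"
    if "l < k" "length w < D" "a \<in> S" for l w a
  proof -
    have "(l, w) \<in> e ` {0..<m}" using that e by (simp add: words_def)
    then obtain i where "i < m" "e i = (l, w)" by force
    then show ?thesis using fx[of i a] that by (simp add: x_def)
  qed
  define Y where "Y j p q = (\<Sum>a\<in>S. cnj (f p a) * (\<Sum>b\<in>S. X j a b * f q b))" for j p q
  define \<zeta> where "\<zeta> l p = inner_prod S (\<xi> l) (f p)" for l p
  have Y: "tuple_norm_le Q \<rho> {..<m} Y"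
    unfolding Y_def by (rule tuple_norm_le_compress[OF Q X]) (simp_all add: orthosystem_isometric[OF f])
  have mvY: "mat_apply {..<m} (Y j) (\<lambda>q. inner_prod S y (f q)) p = inner_prod S (mat_apply S (X j) y) (f p)"
    if "\<And>a. a \<in> S \<Longrightarrow> y a = (\<Sum>q<m. inner_prod S y (f q) * f q a)" for y j p
  proof -
    have "mat_apply S (X j) y = mat_apply S (X j) (\<lambda>a. \<Sum>q<m. inner_prod S y (f q) * f q a)" using that by (rule mat_apply_cong)
    also have "\<dots> = (\<lambda>a. \<Sum>q<m. inner_prod S y (f q) * mat_apply S (X j) (f q) a)" by (simp add: mat_apply_sum mat_apply_mult)
    finally have "inner_prod S (mat_apply S (X j) y) (f p) = (\<Sum>q<m. inner_prod S y (f q) * inner_prod S (mat_apply S (X j) (f q)) (f p))"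
      by (simp add: inner_prod_sum_left inner_prod_mult_left)
    moreover have "Y j p q = inner_prod S (mat_apply S (X j) (f q)) (f p)" for q
      by (simp add: Y_def inner_prod_def mat_apply_def mult.commute)
    ultimately show ?thesis by (simp add: mat_apply_def[of "{..<m}"] mult.commute)
  qed
  have wopY: "word_apply {..<m} Y w (\<zeta> l) = (\<lambda>p. inner_prod S (word_apply S X w (\<xi> l)) (f p))" if "l < k" "length w < D" for l w
    using that(2)
  proof (induction w)
    case Nil show ?case by (simp add: \<zeta>_def)
  next
    case (Cons j w)
    then have IH: "word_apply {..<m} Y w (\<zeta> l) = (\<lambda>p. inner_prod S (word_apply S X w (\<xi> l)) (f p))" by simp
    show ?case unfolding word_apply_Cons IH
      by (rule ext, rule mvY, rule exp) (use that Cons in auto)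
  qed
  have evY: "poly_apply k D pc {..<m} Y \<zeta> i = (\<lambda>p. inner_prod S (poly_apply k D pc S X \<xi> i) (f p))" for i
    unfolding poly_apply_def[abs_def] by (rule ext) (simp add: inner_prod_sum_left inner_prod_mult_left wopY words_def)
  have "l2 {..<m} (\<zeta> l) = l2 S (\<xi> l)" if "l < k" for l
  proof -
    have "inner_prod S (\<xi> l) (\<xi> l) = inner_prod S (\<lambda>a. \<Sum>p<m. inner_prod S (\<xi> l) (f p) * f p a) (\<xi> l)"
      by (rule inner_prod_cong) (use exp[of l "[]"] that D in simp)
    also have "\<dots> = (\<Sum>p<m. \<zeta> l p * cnj (\<zeta> l p))"
      unfolding inner_prod_sum_left inner_prod_mult_left \<zeta>_def using inner_prod_commute[of S _ "\<xi> l"] by simp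
    finally have "(l2 S (\<xi> l))\<^sup>2 = (l2 {..<m} (\<zeta> l))\<^sup>2"
      unfolding inner_prod_self complex_norm_square[symmetric] of_real_sum[symmetric] l2_square[where S = "{..<m}"]
      using of_real_eq_iff by blast
    then show ?thesis by simp
  qed
  then have "block_norm k {..<m} \<zeta> = block_norm k S \<xi>" unfolding block_norm_def by (intro L2_set_cong) auto
  moreover have "block_norm k {..<m} (poly_apply k D pc {..<m} Y \<zeta>) \<le> block_norm k S (poly_apply k D pc S X \<xi>)"
    unfolding block_norm_def evY by (intro L2_set_mono orthosystem_Bessel[OF f]) auto
  ultimately show ?thesis using Y by blast
qed

lemma tendsto_L2_set:
  "(\<And>i. i \<in> I \<Longrightarrow> (\<lambda>n. f n i) \<longlonglongrightarrow> g i) \<Longrightarrow> (\<lambda>n. L2_set (f n) I) \<longlonglongrightarrow> L2_set g I"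
  unfolding L2_set_def by (intro tendsto_real_sqrt tendsto_sum tendsto_power)

text \<open>
  At a fixed matrix size the tuples of norm at most \<open>r\<close> form a compact set, on which
  injectivity is uniform.
\<close>

lemma lower_bound_fixed_level:
  fixes Q :: "'d::finite \<Rightarrow> 'h::complex_hilbert \<Rightarrow> 'h"
  assumes bound: "\<And>X j v. tuple_norm_le Q r {..<m} X \<Longrightarrow> l2 {..<m} (mat_apply {..<m} (X j) v) \<le> C * l2 {..<m} v"
    and inj: "\<And>X \<xi>. tuple_norm_le Q r {..<m} X \<Longrightarrow> block_norm k {..<m} (poly_apply k D pc {..<m} X \<xi>) = 0 \<Longrightarrow> block_norm k {..<m} \<xi> = 0"
  shows "\<exists>K>0. \<forall>X \<xi>. tuple_norm_le Q r {..<m::nat} X \<longrightarrow> block_norm k {..<m} \<xi> \<le> K * block_norm k {..<m} (poly_apply k D pc {..<m} X \<xi>)"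
proof (rule ccontr)
  let ?S = "{..<m}"
  assume "\<not> ?thesis"
  then have neg: "K > 0 \<Longrightarrow> \<exists>X \<xi>. tuple_norm_le Q r ?S X \<and> block_norm k ?S \<xi> > K * block_norm k ?S (poly_apply k D pc ?S X \<xi>)" for K
    by (meson not_le)
  have "\<exists>X \<xi>. tuple_norm_le Q r ?S X \<and> block_norm k ?S \<xi> = 1 \<and> block_norm k ?S (poly_apply k D pc ?S X \<xi>) \<le> 1 / (real n + 1)" for n
  proof -
    obtain X \<xi> where X: "tuple_norm_le Q r ?S X" and \<xi>: "block_norm k ?S \<xi> > (real n + 1) * block_norm k ?S (poly_apply k D pc ?S X \<xi>)"
      using neg[of "real n + 1"] by auto
    define N where "N = block_norm k ?S \<xi>"
    have "0 \<le> (real n + 1) * block_norm k ?S (poly_apply k D pc ?S X \<xi>)" by simp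
    with \<xi> have N: "N > 0" unfolding N_def by linarith
    have "block_norm k ?S (\<lambda>l a. complex_of_real (1 / N) * \<xi> l a) = 1"
      unfolding block_norm_mult using N by (simp add: N_def[symmetric] norm_divide)
    moreover have "block_norm k ?S (poly_apply k D pc ?S X (\<lambda>l a. complex_of_real (1 / N) * \<xi> l a)) \<le> 1 / (real n + 1)"
      unfolding poly_apply_mult block_norm_mult using N \<xi>[folded N_def] by (simp add: norm_divide field_simps)
    ultimately show ?thesis using X by blast
  qed
  then have "\<exists>X. \<forall>n. \<exists>\<xi>. tuple_norm_le Q r ?S (X n) \<and> block_norm k ?S \<xi> = 1 \<and> block_norm k ?S (poly_apply k D pc ?S (X n) \<xi>) \<le> 1 / (real n + 1)"
    by (intro choice allI)
  then obtain X where "\<forall>n. \<exists>\<xi>. tuple_norm_le Q r ?S (X n) \<and> block_norm k ?S \<xi> = 1 \<and> block_norm k ?S (poly_apply k D pc ?S (X n) \<xi>) \<le> 1 / (real n + 1)"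
    by blast
  then have "\<exists>\<xi>. \<forall>n. tuple_norm_le Q r ?S (X n) \<and> block_norm k ?S (\<xi> n) = 1 \<and> block_norm k ?S (poly_apply k D pc ?S (X n) (\<xi> n)) \<le> 1 / (real n + 1)"
    by (intro choice)
  then obtain \<xi> where X: "\<And>n. tuple_norm_le Q r ?S (X n)" and \<xi>: "\<And>n. block_norm k ?S (\<xi> n) = 1"
    and ev: "\<And>n. block_norm k ?S (poly_apply k D pc ?S (X n) (\<xi> n)) \<le> 1 / (real n + 1)"
    by blast
  define F where "F n = case_sum (\<lambda>(j, p, q). X n j p q) (\<lambda>(l, p). \<xi> n l p)" for n
  define I where "I = Inl ` ((UNIV :: 'd set) \<times> ?S \<times> ?S) \<union> Inr ` ({..<k} \<times> ?S)"
  have finI: "finite I" by (simp add: I_def)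
  have bX: "cmod (X n j p q) \<le> C" if "p < m" "q < m" for n j p q
  proof -
    let ?d = "\<lambda>b. if b = q then 1 else (0::complex)"
    have "X n j p q = mat_apply ?S (X n j) ?d p" using that by (simp add: mat_apply_def if_distrib cong: if_cong)
    then have "cmod (X n j p q) \<le> l2 ?S (mat_apply ?S (X n j) ?d)"
      using member_le_L2_set[of ?S p "\<lambda>a. cmod (mat_apply ?S (X n j) ?d a)"] that by simp
    also have "\<dots> \<le> C * l2 ?S ?d" by (rule bound[OF X])
    also have "l2 ?S ?d = 1" using that by (simp add: L2_set_def if_distrib[of norm] if_distrib[of "\<lambda>x. x\<^sup>2"] cong: if_cong)
    finally show ?thesis by simp
  qed
  have b\<xi>: "cmod (\<xi> n l p) \<le> 1" if "l < k" "p < m" for n l p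
    using l2_le_block_norm[OF that(1), where S = ?S and \<xi> = "\<xi> n"] member_le_L2_set[of ?S p "\<lambda>a. cmod (\<xi> n l a)"] that \<xi>[of n] by simp
  have "cmod (F n i) \<le> max C 1" if "i \<in> I" for n i
    using that bX b\<xi> by (auto simp: I_def F_def intro: max.coboundedI1 max.coboundedI2)
  from coordinatewise_bounded_subsequence[where f = F and B = "max C 1", OF finI this] obtain G r'
    where r': "strict_mono (r'::nat\<Rightarrow>nat)" and G: "\<And>i. i \<in> I \<Longrightarrow> (\<lambda>n. F (r' n) i) \<longlonglongrightarrow> G i" by blast
  define X' where "X' j p q = G (Inl (j, p, q))" for j p q
  define \<xi>' where "\<xi>' l p = G (Inr (l, p))" for l p
  have limX: "(\<lambda>n. X (r' n) j p q) \<longlonglongrightarrow> X' j p q" if "p \<in> ?S" "q \<in> ?S" for j p q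
    using G[of "Inl (j, p, q)"] that by (simp add: F_def I_def X'_def)
  have lim\<xi>: "(\<lambda>n. \<xi> (r' n) l p) \<longlonglongrightarrow> \<xi>' l p" if "l < k" "p \<in> ?S" for l p
    using G[of "Inr (l, p)"] that by (simp add: F_def I_def \<xi>'_def)
  have limwop: "(\<lambda>n. word_apply ?S (X (r' n)) w (\<xi> (r' n) l) a) \<longlonglongrightarrow> word_apply ?S X' w (\<xi>' l) a"
    if "l < k" "a \<in> ?S" for l w a
    using that(2)
  proof (induction w arbitrary: a)
    case Nil then show ?case using lim\<xi> that by simp
  next
    case (Cons j w)
    then show ?case unfolding word_apply_Cons mat_apply_def by (intro tendsto_sum tendsto_mult limX) auto
  qed
  have limev: "(\<lambda>n. poly_apply k D pc ?S (X (r' n)) (\<xi> (r' n)) i a) \<longlonglongrightarrow> poly_apply k D pc ?S X' \<xi>' i a"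
    if "a \<in> ?S" for i a
    unfolding poly_apply_def using that by (intro tendsto_sum tendsto_mult tendsto_const limwop) auto
  have r0: "r \<ge> 0" using X[of 0] by (rule tuple_norm_le_nonneg)
  have X': "tuple_norm_le Q r ?S X'"
    unfolding tuple_norm_le_def
  proof (intro conjI allI r0)
    fix h g
    have "(\<lambda>n. cmod (tuple_form Q ?S (X (r' n)) h g)) \<longlonglongrightarrow> cmod (tuple_form Q ?S X' h g)"
      unfolding tuple_form_def by (intro tendsto_norm tendsto_sum tendsto_mult tendsto_const limX) auto
    then show "cmod (tuple_form Q ?S X' h g) \<le> r * (l2 ?S h * l2 ?S g)"
      by (rule LIMSEQ_le_const2) (use tuple_norm_le_bound[OF X] in blast)
  qed simp
  have "(\<lambda>n. block_norm k ?S (poly_apply k D pc ?S (X (r' n)) (\<xi> (r' n)))) \<longlonglongrightarrow> block_norm k ?S (poly_apply k D pc ?S X' \<xi>')"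
    unfolding block_norm_def by (intro tendsto_L2_set tendsto_norm limev)
  moreover have "(\<lambda>n. block_norm k ?S (poly_apply k D pc ?S (X (r' n)) (\<xi> (r' n)))) \<longlonglongrightarrow> 0"
  proof (rule tendsto_sandwich[of "\<lambda>n. 0" _ _ "\<lambda>n. 1 / (real (r' n) + 1)"])
    have "(\<lambda>n. 1 / (real n + 1)) \<longlonglongrightarrow> 0" using LIMSEQ_inverse_real_of_nat by (simp add: inverse_eq_divide add.commute)
    from LIMSEQ_subseq_LIMSEQ[OF this r'] show "(\<lambda>n. 1 / (real (r' n) + 1)) \<longlonglongrightarrow> 0" by (simp add: o_def)
  qed (use ev in auto)
  ultimately have "block_norm k ?S (poly_apply k D pc ?S X' \<xi>') = 0" by (rule LIMSEQ_unique)
  then have "block_norm k ?S \<xi>' = 0" by (rule inj[OF X'])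
  moreover have "(\<lambda>n. block_norm k ?S (\<xi> (r' n))) \<longlonglongrightarrow> block_norm k ?S \<xi>'"
    unfolding block_norm_def by (intro tendsto_L2_set tendsto_norm lim\<xi>) auto
  ultimately have "(\<lambda>n. 1::real) \<longlonglongrightarrow> 0" by (simp add: \<xi>)
  then show False using LIMSEQ_unique[OF _ tendsto_const] by force
qed

text \<open>
  Compression transfers the bound from size \<open>m\<close> to all sizes and all index sets.
\<close>

lemma uniform_lower_bound:
  fixes Q :: "'d::finite \<Rightarrow> 'h::complex_hilbert \<Rightarrow> 'h"
  assumes Q: "\<And>j. bounded_clinear (Q j)" and D: "D > 0" and r: "0 \<le> r" "r < 1"
    and C: "coordinate_bound Q C"
    and inj: "\<And>n X \<xi>. tuple_norm_le Q r {..<n::nat} X \<Longrightarrow>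
      block_norm k {..<n} (poly_apply k D pc {..<n} X \<xi>) = 0 \<Longrightarrow> block_norm k {..<n} \<xi> = 0"
  obtains K where "K > 0"
    "\<And>S X \<xi>. tuple_norm_le Q r (S :: 's set) X \<Longrightarrow> block_norm k S \<xi> \<le> K * block_norm k S (poly_apply k D pc S X \<xi>)"
proof -
  define m where "m = card ({..<k} \<times> (words D :: 'd list set))"
  have b: "l2 {..<m} (mat_apply {..<m} (X j) v) \<le> C * r * l2 {..<m} v" if "tuple_norm_le Q r {..<m} X" for X j v
    by (rule tuple_norm_le_mat_apply_bound[OF C Q that])
  have "\<exists>K>0. \<forall>X \<xi>. tuple_norm_le Q r {..<m} X \<longrightarrow> block_norm k {..<m} \<xi> \<le> K * block_norm k {..<m} (poly_apply k D pc {..<m} X \<xi>)"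
    by (rule lower_bound_fixed_level, erule b, erule (1) inj)
  then obtain K where K: "K > 0"
    "\<And>X \<xi>. tuple_norm_le Q r {..<m} X \<Longrightarrow> block_norm k {..<m} \<xi> \<le> K * block_norm k {..<m} (poly_apply k D pc {..<m} X \<xi>)" by blast
  show ?thesis
  proof (rule that[OF K(1)])
    fix S X \<xi> assume X: "tuple_norm_le Q r (S :: 's set) X"
    from compression[OF Q X m_def D, of \<xi> pc] obtain Y \<zeta> where Y: "tuple_norm_le Q r {..<m} Y"
      "block_norm k {..<m} \<zeta> = block_norm k S \<xi>" "block_norm k {..<m} (poly_apply k D pc {..<m} Y \<zeta>) \<le> block_norm k S (poly_apply k D pc S X \<xi>)"
      by blast
    have "block_norm k S \<xi> \<le> K * block_norm k {..<m} (poly_apply k D pc {..<m} Y \<zeta>)" using K(2)[OF Y(1), of \<zeta>] Y(2) by simp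
    also have "\<dots> \<le> K * block_norm k S (poly_apply k D pc S X \<xi>)" using K(1) Y(3) by (intro mult_left_mono) auto
    finally show "block_norm k S \<xi> \<le> K * block_norm k S (poly_apply k D pc S X \<xi>)" .
  qed
qed

section \<open>Linear systems driven by paths of tuples\<close>

definition linear_form :: "(('b \<Rightarrow> complex) \<Rightarrow> complex) \<Rightarrow> bool" where
  "linear_form \<phi> \<longleftrightarrow> (\<forall>x y. \<phi> (\<lambda>b. x b + y b) = \<phi> x + \<phi> y) \<and> (\<forall>t x. \<phi> (\<lambda>b. t * x b) = t * \<phi> x)"

definition linear_op :: "(('b \<Rightarrow> complex) \<Rightarrow> 'b \<Rightarrow> complex) \<Rightarrow> bool" where
  "linear_op T \<longleftrightarrow> (\<forall>b. linear_form (\<lambda>c. T c b))"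

lemma linear_form_add: "linear_form \<phi> \<Longrightarrow> \<phi> (\<lambda>b. x b + y b) = \<phi> x + \<phi> y"
  and linear_form_mult: "linear_form \<phi> \<Longrightarrow> \<phi> (\<lambda>b. t * x b) = t * \<phi> x"
  by (auto simp: linear_form_def)

lemma linear_form_zero: "linear_form \<phi> \<Longrightarrow> \<phi> (\<lambda>b. 0) = 0"
  using linear_form_mult[of \<phi> 0 "\<lambda>b. 0"] by simp

lemma linear_form_sum: "linear_form \<phi> \<Longrightarrow> \<phi> (\<lambda>b. \<Sum>i\<in>I. x i b) = (\<Sum>i\<in>I. \<phi> (x i))"
proof (induction I rule: infinite_finite_induct)
  case (insert i I)
  then show ?case using linear_form_add[of \<phi> "x i" "\<lambda>b. \<Sum>i\<in>I. x i b"] by simp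
qed (simp_all add: linear_form_zero)

lemma linear_form_lincomb: "linear_form \<phi> \<Longrightarrow> \<phi> (\<lambda>b. \<Sum>i\<in>I. t i * x i b) = (\<Sum>i\<in>I. t i * \<phi> (x i))"
  using linear_form_sum[of \<phi> "\<lambda>i b. t i * x i b" I] by (simp add: linear_form_mult)

lemma linear_op_add: "linear_op T \<Longrightarrow> T (\<lambda>b. x b + y b) = (\<lambda>b. T x b + T y b)"
  and linear_op_mult: "linear_op T \<Longrightarrow> T (\<lambda>b. t * x b) = (\<lambda>b. t * T x b)"
  by (auto simp: linear_op_def linear_form_def fun_eq_iff)

lemma linear_op_sum: "linear_op T \<Longrightarrow> T (\<lambda>b. \<Sum>i\<in>I. x i b) = (\<lambda>b. \<Sum>i\<in>I. T (x i) b)"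
  unfolding linear_op_def using linear_form_sum[of "\<lambda>c. T c _"] by blast

lemma linear_form_comp: "linear_form \<phi> \<Longrightarrow> linear_op T \<Longrightarrow> linear_form (\<lambda>c. \<phi> (T c))"
  unfolding linear_form_def[of "\<lambda>c. \<phi> (T c)"] by (simp add: linear_op_add linear_op_mult linear_form_add linear_form_mult)

lemma linear_op_comp: "linear_op T \<Longrightarrow> linear_op U \<Longrightarrow> linear_op (\<lambda>c. T (U c))"
  unfolding linear_op_def[of "\<lambda>c. T (U c)"] linear_op_def[of T] using linear_form_comp[of "\<lambda>c. T c _" U] by blast

text \<open>
  For a linear system with state maps \<open>A\<close>, initial state \<open>c\<close> and output \<open>\<phi>\<close>, and for a list
  \<open>X\<^sub>1, \<dots>, X\<^sub>m\<close> of tuples, this is the sum of \<open>\<phi> (A\<^sub>w c) X\<^sub>m(w\<^sub>1) \<cdots> X\<^sub>1(w\<^sub>m) v\<close> over all words \<open>w\<close> of length \<open>m\<close>: the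
  homogeneous component of degree \<open>m\<close> of the output series, polarized. The last letter of a word meets
  the first tuple of the list.
\<close>

primrec path_sum :: "('d::finite \<Rightarrow> ('b \<Rightarrow> complex) \<Rightarrow> ('b \<Rightarrow> complex)) \<Rightarrow> nat \<Rightarrow> (('b \<Rightarrow> complex) \<Rightarrow> complex) \<Rightarrow>
   ('b \<Rightarrow> complex) \<Rightarrow> ('d \<Rightarrow> nat \<Rightarrow> nat \<Rightarrow> complex) list \<Rightarrow> (nat \<Rightarrow> complex) \<Rightarrow> nat \<Rightarrow> complex" where
  "path_sum A n \<phi> c [] v = (\<lambda>a. \<phi> c * v a)"
| "path_sum A n \<phi> c (X # Xs) v = (\<lambda>a. \<Sum>j\<in>UNIV. path_sum A n \<phi> (A j c) Xs (mat_apply {..<n} (X j) v) a)"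

lemma path_sum_add_state:
  assumes "linear_form \<phi>" "\<And>j. linear_op (A j)"
  shows "path_sum A n \<phi> (\<lambda>b. x b + y b) Xs v = (\<lambda>a. path_sum A n \<phi> x Xs v a + path_sum A n \<phi> y Xs v a)"
  by (induction Xs arbitrary: x y v)
     (simp_all add: linear_form_add[OF assms(1)] linear_op_add[OF assms(2)] distrib_right sum.distrib)

lemma path_sum_mult_state:
  assumes "linear_form \<phi>" "\<And>j. linear_op (A j)"
  shows "path_sum A n \<phi> (\<lambda>b. t * x b) Xs v = (\<lambda>a. t * path_sum A n \<phi> x Xs v a)"
  by (induction Xs arbitrary: x v)
     (simp_all add: linear_form_mult[OF assms(1)] linear_op_mult[OF assms(2)] mult.assoc sum_distrib_left)

lemma path_sum_zero_state:
  assumes "linear_form \<phi>" "\<And>j. linear_op (A j)"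
  shows "path_sum A n \<phi> (\<lambda>b. 0) Xs v = (\<lambda>a. 0)"
  using path_sum_mult_state[OF assms, where t = 0 and x = "\<lambda>b. 0"] by simp

lemma path_sum_sum_state:
  assumes "linear_form \<phi>" "\<And>j. linear_op (A j)"
  shows "path_sum A n \<phi> (\<lambda>b. \<Sum>i\<in>I. x i b) Xs v = (\<lambda>a. \<Sum>i\<in>I. path_sum A n \<phi> (x i) Xs v a)"
  by (induction I rule: infinite_finite_induct)
     (simp_all add: path_sum_add_state[OF assms] path_sum_zero_state[OF assms])

lemma path_sum_mult_vec: "path_sum A n \<phi> c Xs (\<lambda>b. t * v b) = (\<lambda>a. t * path_sum A n \<phi> c Xs v a)"
  by (induction Xs arbitrary: c v) (simp_all add: mat_apply_mult sum_distrib_left mult_ac)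

text \<open>
  The last tuple of a path acts after all others, so it can be split off at the output side.
\<close>

lemma path_sum_snoc:
  "path_sum A n \<phi> c (Xs @ [X]) v = (\<lambda>a. \<Sum>j\<in>UNIV. mat_apply {..<n} (X j) (path_sum A n (\<lambda>c. \<phi> (A j c)) c Xs v) a)"
proof (induction Xs arbitrary: c v)
  case Nil
  show ?case by (simp add: mat_apply_mult)
next
  case (Cons Y Xs)
  have "path_sum A n \<phi> c ((Y # Xs) @ [X]) v =
    (\<lambda>a. \<Sum>i\<in>UNIV. \<Sum>j\<in>UNIV. mat_apply {..<n} (X j) (path_sum A n (\<lambda>c. \<phi> (A j c)) (A i c) Xs (mat_apply {..<n} (Y i) v)) a)"
    by (simp add: Cons)
  also have "\<dots> = (\<lambda>a. \<Sum>j\<in>UNIV. \<Sum>i\<in>UNIV. mat_apply {..<n} (X j) (path_sum A n (\<lambda>c. \<phi> (A j c)) (A i c) Xs (mat_apply {..<n} (Y i) v)) a)"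
    by (rule ext, rule sum.swap)
  finally show ?case by (simp add: mat_apply_sum)
qed

lemma path_sum_scale:
  "path_sum A n \<phi> c (map (\<lambda>X j a b. t * X j a b) Xs) v = (\<lambda>a. t ^ length Xs * path_sum A n \<phi> c Xs v a)"
proof (induction Xs arbitrary: c v)
  case (Cons X Xs)
  have "mat_apply {..<n} (\<lambda>a b. t * X j a b) v = (\<lambda>b. t * mat_apply {..<n} (X j) v b)" for j
    by (simp add: mat_apply_def sum_distrib_left mult.assoc)
  then show ?case by (simp add: Cons path_sum_mult_vec sum_distrib_left mult_ac)
qed simp

definition unit_tuple :: "('d::finite \<Rightarrow> 'h::complex_hilbert \<Rightarrow> 'h) \<Rightarrow> nat \<Rightarrow> ('d \<Rightarrow> nat \<Rightarrow> nat \<Rightarrow> complex) \<Rightarrow> bool" where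
  "unit_tuple Q n X \<longleftrightarrow> (\<exists>\<rho><1. tuple_norm_le Q \<rho> {..<n} X) \<and> (\<forall>j a b. n \<le> a \<or> n \<le> b \<longrightarrow> X j a b = 0)"

text \<open>
  A path of points of the open ball at one matrix size, with a vector to which it is applied. Vectors and
  tuples are supported below \<open>n\<close>, so a test remains a test with the same value when \<open>n\<close> grows; this is
  how tests of different sizes are concatenated.
\<close>

definition test :: "('d::finite \<Rightarrow> 'h::complex_hilbert \<Rightarrow> 'h) \<Rightarrow> nat \<Rightarrow> ('d \<Rightarrow> nat \<Rightarrow> nat \<Rightarrow> complex) list \<Rightarrow> (nat \<Rightarrow> complex) \<Rightarrow> bool" where
  "test Q n Xs v \<longleftrightarrow> (\<forall>X\<in>set Xs. unit_tuple Q n X) \<and> l2 {..<n} v \<le> 1 \<and> (\<forall>a\<ge>n. v a = 0)"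

lemma unit_tuple_mono: 
  assumes "unit_tuple Q n X" "n \<le> n'" shows "unit_tuple Q n' X"
proof -
  obtain \<rho> where \<rho>: "\<rho> < 1" "tuple_norm_le Q \<rho> {..<n} X" and 0: "\<And>j a b. n \<le> a \<or> n \<le> b \<Longrightarrow> X j a b = 0"
    using assms by (auto simp: unit_tuple_def)
  have "tuple_norm_le Q \<rho> {..<n'} X"
    by (rule tuple_norm_le_pad[OF \<rho>(2)]) (use assms(2) 0 in \<open>auto simp: not_less\<close>)
  with \<rho> 0 assms(2) show ?thesis unfolding unit_tuple_def by (meson le_trans)
qed

lemma mat_apply_unit_tuple_mono:
  assumes "unit_tuple Q n X" "n \<le> n'" shows "mat_apply {..<n'} (X j) v = mat_apply {..<n} (X j) v"
  unfolding mat_apply_def using assms by (intro ext sum.mono_neutral_right) (auto simp: unit_tuple_def)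

lemma mat_apply_unit_tuple_support: "unit_tuple Q n X \<Longrightarrow> n \<le> a \<Longrightarrow> mat_apply {..<n} (X j) v a = 0"
  by (simp add: mat_apply_def unit_tuple_def)

lemma path_sum_mono:
  assumes "\<forall>X\<in>set Xs. unit_tuple Q n X" "n \<le> n'"
  shows "path_sum A n' \<phi> c Xs v = path_sum A n \<phi> c Xs v"
  using assms(1) by (induction Xs arbitrary: c v) (simp_all add: mat_apply_unit_tuple_mono[where Q = Q, OF _ assms(2)])

lemma path_sum_support:
  assumes "\<forall>X\<in>set Xs. unit_tuple Q n X" "\<forall>a\<ge>n. v a = 0" "n \<le> a"
  shows "path_sum A n \<phi> c Xs v a = 0"
  using assms(1,2) by (induction Xs arbitrary: c v) (simp_all add: assms(3) mat_apply_unit_tuple_support[where Q = Q])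

lemma l2_lessThan_mono: "n \<le> n' \<Longrightarrow> (\<And>a. n \<le> a \<Longrightarrow> v a = 0) \<Longrightarrow> l2 {..<n'} v = l2 {..<n::nat} v"
  by (rule l2_superset) auto

lemma test_mono:
  assumes "test Q n Xs v" "n \<le> n'"
  shows "test Q n' Xs v" "l2 {..<n'} (path_sum A n' \<phi> c Xs v) = l2 {..<n} (path_sum A n \<phi> c Xs v)"
proof -
  have X: "\<forall>X\<in>set Xs. unit_tuple Q n X" and v: "\<forall>a\<ge>n. v a = 0" "l2 {..<n} v \<le> 1"
    using assms by (auto simp: test_def)
  then show "test Q n' Xs v"
    using l2_lessThan_mono[of n n' v] assms(2) unit_tuple_mono[OF _ assms(2)] unfolding test_def by auto
  show "l2 {..<n'} (path_sum A n' \<phi> c Xs v) = l2 {..<n} (path_sum A n \<phi> c Xs v)"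
    unfolding path_sum_mono[OF X assms(2)] using path_sum_support[OF X v(1)] by (intro l2_lessThan_mono assms) auto
qed

text \<open>
  The path carries \<open>c \<otimes> v\<close> to an element of states \<open>\<otimes> \<complex>\<^sup>n\<close>; pairing its vector component with
  \<open>f\<close> leaves a state.
\<close>

primrec slice :: "('d::finite \<Rightarrow> ('b \<Rightarrow> complex) \<Rightarrow> ('b \<Rightarrow> complex)) \<Rightarrow> nat \<Rightarrow> (nat \<Rightarrow> complex) \<Rightarrow>
   ('b \<Rightarrow> complex) \<Rightarrow> ('d \<Rightarrow> nat \<Rightarrow> nat \<Rightarrow> complex) list \<Rightarrow> (nat \<Rightarrow> complex) \<Rightarrow> 'b \<Rightarrow> complex" where
  "slice A n f c [] v = (\<lambda>b. inner_prod {..<n} v f * c b)"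
| "slice A n f c (X # Xs) v = (\<lambda>b. \<Sum>j\<in>UNIV. slice A n f (A j c) Xs (mat_apply {..<n} (X j) v) b)"

lemma linear_form_slice:
  assumes "linear_form \<phi>" shows "\<phi> (slice A n f c Xs v) = inner_prod {..<n} (path_sum A n \<phi> c Xs v) f"
proof (induction Xs arbitrary: c v)
  case Nil
  show ?case unfolding slice.simps path_sum.simps inner_prod_mult_left linear_form_mult[OF assms] by (rule mult.commute)
next
  case (Cons X Xs)
  then show ?case by (simp add: linear_form_sum[OF assms] inner_prod_sum_left)
qed

text \<open>
  Inserting \<open>v' f\<^sup>*\<close> in the middle of a path cuts it: the first half is paired with \<open>f\<close> to give a
  state, from which the second half starts afresh with the vector \<open>v'\<close>.
\<close>

lemma path_sum_slice:
  assumes "linear_form \<phi>" "\<And>j. linear_op (A j)"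
  shows "path_sum A n \<phi> c (Xs @ (\<lambda>j a b. mat_apply {..<n} (X j) v' a * cnj (f b)) # Ys) v =
     path_sum A n \<phi> (slice A n f c Xs v) (X # Ys) v'"
proof (induction Xs arbitrary: c v)
  case Nil
  have "mat_apply {..<n} (\<lambda>a b. mat_apply {..<n} (X j) v' a * cnj (f b)) v = (\<lambda>a. inner_prod {..<n} v f * mat_apply {..<n} (X j) v' a)" for j
    unfolding mat_apply_def[of _ _ v] inner_prod_def by (simp add: sum_distrib_left sum_distrib_right mult_ac)
  then show ?case
    by (simp add: path_sum_mult_vec linear_op_mult[OF assms(2)] path_sum_mult_state[OF assms])
next
  case (Cons Y Xs)
  let ?R = "\<lambda>j a b. mat_apply {..<n} (X j) v' a * cnj (f b)"
  have "path_sum A n \<phi> c ((Y # Xs) @ ?R # Ys) v = (\<lambda>a. \<Sum>j\<in>UNIV. path_sum A n \<phi> (A j c) (Xs @ ?R # Ys) (mat_apply {..<n} (Y j) v) a)"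
    by simp
  also have "\<dots> = (\<lambda>a. \<Sum>j\<in>UNIV. path_sum A n \<phi> (slice A n f (A j c) Xs (mat_apply {..<n} (Y j) v)) (X # Ys) v' a)"
    by (simp only: Cons)
  also have "\<dots> = path_sum A n \<phi> (slice A n f c (Y # Xs) v) (X # Ys) v'"
    by (simp only: path_sum_sum_state[OF assms] slice.simps(2))
  finally show ?case .
qed

lemma slice_closed:
  fixes A :: "'d::finite \<Rightarrow> ('b \<Rightarrow> complex) \<Rightarrow> ('b \<Rightarrow> complex)"
  assumes "c \<in> V" "\<And>j c. c \<in> V \<Longrightarrow> A j c \<in> V"
    "\<And>t c. c \<in> V \<Longrightarrow> (\<lambda>b. t * c b) \<in> V" "\<And>x. (\<And>j. x j \<in> V) \<Longrightarrow> (\<lambda>b. \<Sum>j\<in>(UNIV::'d set). x j b) \<in> V"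
  shows "slice A n f c Xs v \<in> V"
  using assms(1)
proof (induction Xs arbitrary: c v)
  case (Cons X Xs)
  show ?case unfolding slice.simps by (rule assms(4)) (intro Cons assms(2))
qed (simp add: assms(3))

section \<open>The state space of the inverse of a polynomial matrix\<close>

text \<open>
  Words are counted by their last letter.
\<close>

lemma words_split:
  fixes f :: "'d::finite list \<Rightarrow> complex"
  assumes "D > 0" "\<And>u. length u = D \<Longrightarrow> f u = 0"
  shows "(\<Sum>u\<in>words D. f u) = f [] + (\<Sum>j\<in>UNIV. \<Sum>u\<in>words D. f (u @ [j]))"
proof -
  let ?g = "\<lambda>(j, u). u @ [j]"
  have eq: "(words (Suc D) :: 'd list set) = insert [] (?g ` (UNIV \<times> words D))" (is "_ = ?R")
  proof
    show "(words (Suc D) :: 'd list set) \<subseteq> ?R"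
    proof
      fix u :: "'d list" assume u: "u \<in> words (Suc D)"
      show "u \<in> ?R"
      proof (cases u rule: rev_cases)
        case (snoc w j)
        with u have "(j, w) \<in> UNIV \<times> words D" "u = ?g (j, w)" by (auto simp: words_def)
        then show ?thesis by blast
      qed simp
    qed
  qed (auto simp: words_def)
  have "(\<Sum>u\<in>words D. f u) = (\<Sum>u\<in>words (Suc D). f u)"
    by (rule sum.mono_neutral_left[OF finite_words]) (use assms(2) in \<open>auto simp: words_def less_Suc_eq\<close>)
  also have "\<dots> = f [] + (\<Sum>u\<in>?g ` (UNIV \<times> words D). f u)"
    unfolding eq by (subst sum.insert) auto
  also have "(\<Sum>u\<in>?g ` (UNIV \<times> words D). f u) = (\<Sum>(j, u)\<in>UNIV \<times> words D. f (u @ [j]))"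
    by (subst sum.reindex) (auto simp: inj_on_def case_prod_unfold)
  finally show ?thesis by (simp add: sum.cartesian_product)
qed

locale nc_system =
  fixes Q :: "'d::finite \<Rightarrow> 'h::complex_hilbert \<Rightarrow> 'h" and C :: real and k D :: nat
    and pc :: "nat \<Rightarrow> nat \<Rightarrow> 'd list \<Rightarrow> complex" and pinv :: "nat \<Rightarrow> nat \<Rightarrow> complex"
  assumes Q: "\<And>j. bounded_clinear (Q j)" and C: "coordinate_bound Q C" and k: "k > 0" and D: "D > 0"
    and deg: "\<And>i l u. D \<le> length u \<Longrightarrow> pc i l u = 0"
    and pinv: "\<And>i m. i < k \<Longrightarrow> m < k \<Longrightarrow> (\<Sum>l<k. pc i l [] * pinv l m) = (if i = m then 1 else 0)"
    and stable: "\<And>r n X \<xi>. r < 1 \<Longrightarrow> tuple_norm_le Q r {..<n::nat} X \<Longrightarrow>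
      block_norm k {..<n} (poly_apply k D pc {..<n} X \<xi>) = 0 \<Longrightarrow> block_norm k {..<n} \<xi> = 0"
begin

definition B :: "(nat \<times> 'd list) set" where "B = {..<k} \<times> words D"

text \<open>
  States are polynomial columns of degree less than \<open>D\<close>; the column \<open>c\<close> stands for the series
  \<open>P\<^sup>-\<^sup>1 c\<close>. The coordinate \<open>(i, u)\<close> is the coefficient of the word \<open>u\<close> in row \<open>i\<close>.
\<close>

definition V :: "(nat \<times> 'd list \<Rightarrow> complex) set" where "V = {c. \<forall>b. b \<notin> B \<longrightarrow> c b = 0}"

text \<open>
  The constant coefficient of \<open>P\<^sup>-\<^sup>1 c\<close>.
\<close>

definition Out :: "nat \<Rightarrow> (nat \<times> 'd list \<Rightarrow> complex) \<Rightarrow> complex" where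
  "Out i c = (\<Sum>l<k. pinv i l * c (l, []))"

text \<open>
  If \<open>x = P\<^sup>-\<^sup>1 c\<close>, then \<open>P\<^sup>-\<^sup>1 (A j c)\<close> is the part of \<open>x\<close> consisting of the words that end in \<open>j\<close>, with this
  letter removed. The subtraction accounts for the words of \<open>P x\<close> whose last letter comes from \<open>P\<close>.
\<close>

definition A :: "'d \<Rightarrow> (nat \<times> 'd list \<Rightarrow> complex) \<Rightarrow> nat \<times> 'd list \<Rightarrow> complex" where
  "A j c = (\<lambda>(i, u). if i < k then c (i, u @ [j]) - (\<Sum>l<k. pc i l (u @ [j]) * Out l c) else 0)"

definition column_apply :: "(nat \<times> 'd list \<Rightarrow> complex) \<Rightarrow> 's set \<Rightarrow> ('d \<Rightarrow> 's \<Rightarrow> 's \<Rightarrow> complex) \<Rightarrow> ('s \<Rightarrow> complex) \<Rightarrow> nat \<Rightarrow> 's \<Rightarrow> complex" where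
  "column_apply c S X v i a = (\<Sum>u\<in>words D. c (i, u) * word_apply S X u v a)"

lemma finite_B: "finite B" by (simp add: B_def)

lemma V_mult: "c \<in> V \<Longrightarrow> (\<lambda>b. t * c b) \<in> V"
  and V_add: "c \<in> V \<Longrightarrow> c' \<in> V \<Longrightarrow> (\<lambda>b. c b + c' b) \<in> V"
  and V_sum: "(\<And>i. i \<in> I \<Longrightarrow> x i \<in> V) \<Longrightarrow> (\<lambda>b. \<Sum>i\<in>I. x i b) \<in> V"
  by (auto simp: V_def intro!: sum.neutral)

lemma linear_form_Out: "linear_form (Out i)"
  by (simp add: linear_form_def Out_def distrib_left sum.distrib sum_distrib_left mult_ac)

lemma linear_op_A: "linear_op (A j)"
proof -
  have "A j (\<lambda>b. x b + y b) b = A j x b + A j y b" "A j (\<lambda>b. t * x b) b = t * A j x b" for x y t b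
    by (cases b; simp add: A_def linear_form_add[OF linear_form_Out] linear_form_mult[OF linear_form_Out] algebra_simps sum.distrib sum_distrib_left)+
  then show ?thesis by (simp add: linear_op_def linear_form_def)
qed

lemma A_V: assumes "c \<in> V" shows "A j c \<in> V"
proof -
  have "A j c (i, u) = 0" if "(i, u) \<notin> B" for i u
  proof (cases "i < k")
    case True
    with that have "D \<le> length u" by (auto simp: B_def words_def)
    moreover from this have "c (i, u @ [j]) = 0" using assms by (auto simp: V_def B_def words_def)
    ultimately show ?thesis by (simp add: A_def deg)
  qed (simp add: A_def)
  then show ?thesis by (auto simp: V_def)
qed

text \<open>
  The identity \<open>c = P x\<^sub>0 + \<Sum>\<^sub>j (A\<^sub>j c) Z\<^sub>j\<close> of polynomial columns, with \<open>x\<^sub>0\<close> the constant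
  coefficient of \<open>P\<^sup>-\<^sup>1 c\<close>, evaluated at \<open>X\<close> and applied to \<open>v\<close>.
\<close>

lemma state_recursion:
  assumes c: "c \<in> V" and i: "i < k"
  shows "column_apply c S X v i a = poly_apply k D pc S X (\<lambda>l a. Out l c * v a) i a + (\<Sum>j\<in>UNIV. column_apply (A j c) S X (mat_apply S (X j) v) i a)"
proof -
  let ?f = "\<lambda>u. (c (i, u) - (\<Sum>l<k. pc i l u * Out l c)) * word_apply S X u v a"
  have P0: "(\<Sum>l<k. pc i l [] * Out l c) = c (i, [])"
  proof -
    have "(\<Sum>l<k. pc i l [] * Out l c) = (\<Sum>l<k. \<Sum>m<k. pc i l [] * pinv l m * c (m, []))"
      by (simp add: Out_def sum_distrib_left mult.assoc)
    also have "\<dots> = (\<Sum>m<k. (\<Sum>l<k. pc i l [] * pinv l m) * c (m, []))"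
      by (subst sum.swap) (simp add: sum_distrib_right)
    also have "\<dots> = (\<Sum>m<k. if i = m then c (m, []) else 0)"
      by (intro sum.cong refl) (simp add: pinv i)
    also have "\<dots> = c (i, [])" using i by simp
    finally show ?thesis .
  qed
  have "(\<Sum>u\<in>words D. ?f u) = ?f [] + (\<Sum>j\<in>UNIV. \<Sum>u\<in>words D. ?f (u @ [j]))"
    by (rule words_split[OF D]) (use c deg in \<open>auto simp: V_def B_def words_def\<close>)
  also have "?f [] = 0" using P0 by simp
  also have "(\<Sum>j\<in>UNIV. \<Sum>u\<in>words D. ?f (u @ [j])) = (\<Sum>j\<in>UNIV. column_apply (A j c) S X (mat_apply S (X j) v) i a)"
    unfolding column_apply_def using i by (intro sum.cong refl) (simp add: A_def word_apply_append)
  finally have *: "(\<Sum>u\<in>words D. ?f u) = (\<Sum>j\<in>UNIV. column_apply (A j c) S X (mat_apply S (X j) v) i a)" by simp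
  have "poly_apply k D pc S X (\<lambda>l a. Out l c * v a) i a = (\<Sum>u\<in>words D. \<Sum>l<k. pc i l u * Out l c * word_apply S X u v a)"
    unfolding poly_apply_def by (subst sum.swap) (simp add: word_apply_mult mult.assoc)
  then have "poly_apply k D pc S X (\<lambda>l a. Out l c * v a) i a + (\<Sum>u\<in>words D. ?f u) = column_apply c S X v i a"
    by (simp add: column_apply_def sum.distrib[symmetric] left_diff_distrib sum_distrib_right sum_subtractf)
  with * show ?thesis by simp
qed

lemma C_pos: "C > 0" using C by (simp add: coordinate_bound_def)

lemma tuple_norm_le_mat_apply_le: "tuple_norm_le Q \<rho> S X \<Longrightarrow> \<rho> \<le> 1 \<Longrightarrow> l2 S (mat_apply S (X j) v) \<le> C * l2 S v"
proof -
  assume X: "tuple_norm_le Q \<rho> S X" and \<rho>: "\<rho> \<le> 1"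
  have "l2 S (mat_apply S (X j) v) \<le> C * \<rho> * l2 S v" by (rule tuple_norm_le_mat_apply_bound[OF C Q X])
  also have "\<dots> \<le> C * 1 * l2 S v" using C_pos \<rho> by (intro mult_right_mono mult_left_mono) auto
  finally show ?thesis by simp
qed

lemma word_apply_le: "tuple_norm_le Q \<rho> S X \<Longrightarrow> \<rho> \<le> 1 \<Longrightarrow> l2 S (word_apply S X u v) \<le> C ^ length u * l2 S v"
  by (rule word_apply_bound) (use tuple_norm_le_mat_apply_le C_pos in auto)

lemma column_apply_le:
  assumes "tuple_norm_le Q \<rho> S X" "\<rho> \<le> 1"
  shows "block_norm k S (column_apply c S X v) \<le> (\<Sum>i<k. \<Sum>u\<in>words D. cmod (c (i, u)) * C ^ length u) * l2 S v"
proof -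
  have "block_norm k S (column_apply c S X v) \<le> (\<Sum>i<k. l2 S (column_apply c S X v i))" by (rule block_norm_le_sum)
  also have "\<dots> \<le> (\<Sum>i<k. \<Sum>u\<in>words D. cmod (c (i, u)) * (C ^ length u * l2 S v))"
  proof (rule sum_mono)
    fix i
    have "l2 S (column_apply c S X v i) \<le> (\<Sum>u\<in>words D. l2 S (\<lambda>a. c (i, u) * word_apply S X u v a))"
      unfolding column_apply_def[abs_def] by (rule l2_sum)
    also have "\<dots> \<le> (\<Sum>u\<in>words D. cmod (c (i, u)) * (C ^ length u * l2 S v))"
      unfolding l2_mult by (intro sum_mono mult_left_mono word_apply_le[OF assms]) auto
    finally show "l2 S (column_apply c S X v i) \<le> (\<Sum>u\<in>words D. cmod (c (i, u)) * (C ^ length u * l2 S v))" .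
  qed
  finally show ?thesis by (simp add: sum_distrib_right mult.assoc)
qed

lemma lower_bound:
  assumes "0 \<le> r" "r < 1"
  obtains K where "K > 0"
    "\<And>S X \<xi>. tuple_norm_le Q r (S :: 's set) X \<Longrightarrow> block_norm k S \<xi> \<le> K * block_norm k S (poly_apply k D pc S X \<xi>)"
proof (rule uniform_lower_bound[where k = k and D = D and pc = pc, OF Q D assms C])
  fix n X \<xi> assume "tuple_norm_le Q r {..<n::nat} X" "block_norm k {..<n} (poly_apply k D pc {..<n} X \<xi>) = 0"
  then show "block_norm k {..<n} \<xi> = 0" by (rule stable[OF assms(2)])
next
  fix K :: real
  assume "K > 0" "\<And>S X \<xi>. tuple_norm_le Q r (S :: 's set) X \<Longrightarrow> block_norm k S \<xi> \<le> K * block_norm k S (poly_apply k D pc S X \<xi>)"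
  then show thesis by (rule that)
qed

definition shift_block :: "('d \<Rightarrow> nat \<Rightarrow> nat \<Rightarrow> complex) list \<Rightarrow> 'd \<Rightarrow> nat \<times> nat \<Rightarrow> nat \<times> nat \<Rightarrow> complex" where
  "shift_block Ys j x y = (if fst x = Suc (fst y) \<and> fst y < length Ys then (Ys ! fst y) j (snd x) (snd y) else 0)"

definition in_block :: "nat \<Rightarrow> (nat \<Rightarrow> complex) \<Rightarrow> nat \<times> nat \<Rightarrow> complex" where
  "in_block p v x = (if fst x = p then v (snd x) else 0)"

lemma mat_apply_shift_block:
  assumes "p \<le> length Ys"
  shows "mat_apply ({..<Suc (length Ys)} \<times> {..<n}) (shift_block Ys j) (in_block p v) =
    (if p < length Ys then in_block (Suc p) (mat_apply {..<n} ((Ys ! p) j) v) else (\<lambda>x. 0))"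
proof
  fix x :: "nat \<times> nat"
  let ?t = "\<lambda>p' b. if fst x = Suc p' \<and> p' < length Ys then (Ys ! p') j (snd x) b else 0"
  have "mat_apply ({..<Suc (length Ys)} \<times> {..<n}) (shift_block Ys j) (in_block p v) x =
     (\<Sum>p'<Suc (length Ys). \<Sum>b<n. shift_block Ys j x (p', b) * in_block p v (p', b))"
    unfolding mat_apply_def sum.cartesian_product' by simp
  also have "\<dots> = (\<Sum>p'<Suc (length Ys). if p' = p then (\<Sum>b<n. ?t p b * v b) else 0)"
    by (intro sum.cong refl) (auto simp: shift_block_def in_block_def intro!: sum.cong)
  also have "\<dots> = (\<Sum>b<n. ?t p b * v b)" using assms by (subst sum.delta) auto
  finally show "mat_apply ({..<Suc (length Ys)} \<times> {..<n}) (shift_block Ys j) (in_block p v) x =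
    (if p < length Ys then in_block (Suc p) (mat_apply {..<n} ((Ys ! p) j) v) else (\<lambda>x. 0)) x"
    by (simp add: in_block_def mat_apply_def)
qed

lemma column_apply_zero_vec [simp]: "column_apply c S X (\<lambda>x. 0) i a = 0"
  by (simp add: column_apply_def)

text \<open>
  On a nilpotent tuple the recursion of states ends after finitely many steps and solves \<open>P(X) y = c(X) v\<close>
  exactly. Each step moves one block down, so the last block of the solution is the polarized
  component of \<open>P\<^sup>-\<^sup>1 c\<close> of top degree.
\<close>

lemma shift_block_solution:
  fixes n :: nat
  assumes "p \<le> length Ys" "c \<in> V"
  defines "S \<equiv> {..<Suc (length Ys)} \<times> {..<n}"
  shows "\<exists>y. (\<forall>i<k. \<forall>x. column_apply c S (shift_block Ys) (in_block p v) i x = poly_apply k D pc S (shift_block Ys) y i x) \<and>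
     (\<forall>i a. y i (length Ys, a) = path_sum A n (Out i) c (drop p Ys) v a)"
  using assms(1,2)
proof (induction "length Ys - p" arbitrary: p c v)
  case 0
  then have p: "p = length Ys" by simp
  have mv0: "mat_apply S (shift_block Ys j) (in_block p v) = (\<lambda>x. 0)" for j
    unfolding S_def using mat_apply_shift_block[of p Ys n j v] p by simp
  show ?case
    by (rule exI[of _ "\<lambda>l x. Out l c * in_block p v x"])
       (simp add: state_recursion[OF \<open>c \<in> V\<close>] mv0, simp add: p in_block_def)
next
  case (Suc m)
  then have p: "p < length Ys" by simp
  have mv1: "mat_apply S (shift_block Ys j) (in_block p v) = in_block (Suc p) (mat_apply {..<n} ((Ys ! p) j) v)" for j
    unfolding S_def using mat_apply_shift_block[of p Ys n j v] p by simp
  have "\<exists>y. (\<forall>i<k. \<forall>x. column_apply (A j c) S (shift_block Ys) (in_block (Suc p) (mat_apply {..<n} ((Ys ! p) j) v)) i x =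
        poly_apply k D pc S (shift_block Ys) y i x) \<and>
     (\<forall>i a. y i (length Ys, a) = path_sum A n (Out i) (A j c) (drop (Suc p) Ys) (mat_apply {..<n} ((Ys ! p) j) v) a)" for j
    using Suc p by (intro Suc.hyps(1) A_V) auto
  then have "\<exists>y. \<forall>j. (\<forall>i<k. \<forall>x. column_apply (A j c) S (shift_block Ys) (in_block (Suc p) (mat_apply {..<n} ((Ys ! p) j) v)) i x =
        poly_apply k D pc S (shift_block Ys) (y j) i x) \<and>
     (\<forall>i a. y j i (length Ys, a) = path_sum A n (Out i) (A j c) (drop (Suc p) Ys) (mat_apply {..<n} ((Ys ! p) j) v) a)"
    by (intro choice allI)
  then obtain y where y1: "\<And>j i x. i < k \<Longrightarrow> column_apply (A j c) S (shift_block Ys) (in_block (Suc p) (mat_apply {..<n} ((Ys ! p) j) v)) i x =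
        poly_apply k D pc S (shift_block Ys) (y j) i x"
    and y2: "\<And>j i a. y j i (length Ys, a) = path_sum A n (Out i) (A j c) (drop (Suc p) Ys) (mat_apply {..<n} ((Ys ! p) j) v) a"
    by blast
  have dr: "drop p Ys = Ys ! p # drop (Suc p) Ys" using p by (simp add: Cons_nth_drop_Suc)
  show ?case
  proof (intro exI conjI allI impI)
    fix i x assume "i < k"
    then show "column_apply c S (shift_block Ys) (in_block p v) i x =
      poly_apply k D pc S (shift_block Ys) (\<lambda>l x. Out l c * in_block p v x + (\<Sum>j\<in>UNIV. y j l x)) i x"
      by (simp add: state_recursion[OF \<open>c \<in> V\<close>] mv1 y1 poly_apply_add poly_apply_sum)
  next
    fix i a
    show "Out i c * in_block p v (length Ys, a) + (\<Sum>j\<in>UNIV. y j i (length Ys, a)) = path_sum A n (Out i) c (drop p Ys) v a"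
      using p by (simp add: y2 dr in_block_def)
  qed
qed

text \<open>
  The lower bound for \<open>P\<close> at block shifts of norm at most \<open>r\<close> bounds the solution \<open>y\<close> above, and its last
  block carries the factor \<open>r\<^sup>m\<close>.
\<close>

lemma path_growth:
  assumes r: "0 \<le> r" "r < 1" and c: "c \<in> V"
  obtains K where "\<And>i n Xs v. i < k \<Longrightarrow> test Q n Xs v \<Longrightarrow> r ^ length Xs * l2 {..<n} (path_sum A n (Out i) c Xs v) \<le> K"
proof -
  obtain K where K: "K > 0"
    "\<And>S X \<xi>. tuple_norm_le Q r (S :: (nat \<times> nat) set) X \<Longrightarrow> block_norm k S \<xi> \<le> K * block_norm k S (poly_apply k D pc S X \<xi>)"
    using lower_bound[OF r] by blast
  define M where "M = (\<Sum>i<k. \<Sum>u\<in>words D. cmod (c (i, u)) * C ^ length u)"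
  have M0: "M \<ge> 0" unfolding M_def using C_pos by (intro sum_nonneg mult_nonneg_nonneg) auto
  show ?thesis
  proof (rule that[of "K * M"])
    fix i n Xs v assume i: "i < k" and t: "test Q n Xs v"
    define Ys where "Ys = map (\<lambda>X j a b. complex_of_real r * X j a b) Xs"
    let ?S = "{..<Suc (length Ys)} \<times> {..<n}"
    have "tuple_norm_le Q r {..<n} (Ys ! p)" if "p < length Ys" for p
    proof -
      have "unit_tuple Q n (Xs ! p)" using t that by (simp add: test_def Ys_def)
      then obtain \<rho> where "\<rho> < 1" "tuple_norm_le Q \<rho> {..<n} (Xs ! p)" by (auto simp: unit_tuple_def)
      from tuple_norm_le_scale[OF this(2), of "complex_of_real r"]
      show ?thesis using that r \<open>\<rho> < 1\<close> mult_left_mono[of \<rho> 1 r]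
        by (simp add: Ys_def) (erule tuple_norm_le_mono, simp)
    qed
    from tuple_norm_le_block_shift[where X = "(!) Ys" and m = "length Ys", OF this r(1)]
    have qc: "tuple_norm_le Q r ?S (shift_block Ys)"
      by (rule tuple_norm_le_cong) (auto simp: shift_block_def)
    obtain y where y1: "\<And>i x. i < k \<Longrightarrow> column_apply c ?S (shift_block Ys) (in_block 0 v) i x = poly_apply k D pc ?S (shift_block Ys) y i x"
      and y2: "\<And>i a. y i (length Ys, a) = path_sum A n (Out i) c Ys v a"
      using shift_block_solution[of 0 Ys c n v] c by auto
    have "r ^ length Xs * l2 {..<n} (path_sum A n (Out i) c Xs v) = l2 {..<n} (path_sum A n (Out i) c Ys v)"
      unfolding Ys_def path_sum_scale l2_mult using r by (simp add: norm_power)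
    also have "\<dots> = l2 {..<n} (\<lambda>a. y i (length Ys, a))" by (simp add: y2)
    also have "\<dots> \<le> l2 ?S (y i)" unfolding l2_product
      by (rule member_le_L2_set) auto
    also have "\<dots> \<le> block_norm k ?S y" by (rule l2_le_block_norm[OF i])
    also have "\<dots> \<le> K * block_norm k ?S (poly_apply k D pc ?S (shift_block Ys) y)" by (rule K(2)[OF qc])
    also have "block_norm k ?S (poly_apply k D pc ?S (shift_block Ys) y) = block_norm k ?S (column_apply c ?S (shift_block Ys) (in_block 0 v))"
      by (rule block_norm_cong) (simp add: y1)
    also have "K * \<dots> \<le> K * (M * l2 ?S (in_block 0 v))"
      unfolding M_def using K(1) r by (intro mult_left_mono column_apply_le[OF qc]) auto
    also have "l2 ?S (in_block 0 v) = l2 {..<n} v"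
    proof -
      have "(\<Sum>p<Suc (length Ys). (l2 {..<n} (\<lambda>b. in_block 0 v (p, b)))\<^sup>2) =
        (\<Sum>p<Suc (length Ys). if p = 0 then (l2 {..<n} v)\<^sup>2 else 0)"
        by (intro sum.cong refl) (auto simp: in_block_def L2_set_def)
      also have "\<dots> = (l2 {..<n} v)\<^sup>2" by (subst sum.delta) auto
      finally show ?thesis unfolding l2_product by (simp add: L2_set_def[of _ "{..<Suc _}"])
    qed
    also have "K * (M * l2 {..<n} v) \<le> K * (M * 1)"
      using K(1) M0 t by (intro mult_left_mono) (auto simp: test_def)
    finally show "r ^ length Xs * l2 {..<n} (path_sum A n (Out i) c Xs v) \<le> K * M" by simp
  qed
qed

end

section \<open>Growth along paths\<close>

text \<open>
  The upper limit of a pointwise bounded sequence of seminorms is a seminorm. It is given by its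
  two defining properties.
\<close>

lemma limsup_seminorm:
  assumes q: "\<And>n. seminorm (q n)" and bdd: "\<And>x. \<exists>M. \<forall>n. q n x \<le> M"
  obtains h where "seminorm h"
    and "\<And>x \<epsilon>. \<epsilon> > 0 \<Longrightarrow> eventually (\<lambda>n::nat. q n x \<le> h x + \<epsilon>) sequentially"
    and "\<And>x y. eventually (\<lambda>n. q n x \<le> y) sequentially \<Longrightarrow> h x \<le> y"
proof -
  define Y where "Y x = {y. eventually (\<lambda>n. q n x \<le> y) sequentially}" for x
  define h where "h x = Inf (Y x)" for x
  have ne: "Y x \<noteq> {}" for x
  proof -
    obtain M where "\<forall>n. q n x \<le> M" using bdd by blast
    then have "M \<in> Y x" by (simp add: Y_def)
    then show ?thesis by blast
  qed
  have below: "bdd_below (Y x)" for x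
  proof (rule bdd_belowI)
    fix y assume "y \<in> Y x"
    then obtain n where "q n x \<le> y" unfolding Y_def eventually_sequentially by blast
    then show "0 \<le> y" using seminorm_nonneg[OF q, of n x] by linarith
  qed
  have upper: "eventually (\<lambda>n. q n x \<le> h x + \<epsilon>) sequentially" if "\<epsilon> > 0" for x \<epsilon>
  proof -
    have "h x < h x + \<epsilon>" using that by simp
    then obtain y where "y \<in> Y x" "y < h x + \<epsilon>" using cInf_lessD[OF ne] unfolding h_def by blast
    then show ?thesis unfolding Y_def by (auto elim!: eventually_mono)
  qed
  have lower: "h x \<le> y" if "eventually (\<lambda>n. q n x \<le> y) sequentially" for x y
    unfolding h_def using that by (intro cInf_lower below) (simp add: Y_def)
  have "seminorm h"
    unfolding seminorm_def
  proof (intro conjI allI; rule field_le_epsilon)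
    fix x y and \<epsilon> :: real assume "\<epsilon> > 0"
    then have "\<epsilon> / 2 > 0" by simp
    from upper[OF this, of x] upper[OF this, of y]
    have "eventually (\<lambda>n. q n (\<lambda>i. x i + y i) \<le> h x + h y + \<epsilon>) sequentially"
    proof eventually_elim
      case (elim n)
      then show ?case using seminorm_add[OF q, of n x y] by linarith
    qed
    then show "h (\<lambda>i. x i + y i) \<le> h x + h y + \<epsilon>" by (rule lower)
  next
    fix t x and \<epsilon> :: real assume \<epsilon>: "\<epsilon> > 0"
    have t: "cmod t + 1 > 0" by (simp add: add_nonneg_pos)
    with \<epsilon> have "\<epsilon> / (cmod t + 1) > 0" by simp
    from upper[OF this, of x]
    have "eventually (\<lambda>n. q n (\<lambda>i. t * x i) \<le> cmod t * h x + \<epsilon>) sequentially"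
    proof eventually_elim
      case (elim n)
      have "q n (\<lambda>i. t * x i) \<le> cmod t * q n x" by (rule seminorm_mult[OF q])
      also have "\<dots> \<le> cmod t * (h x + \<epsilon> / (cmod t + 1))" using elim by (intro mult_left_mono) auto
      also have "\<dots> = cmod t * h x + cmod t / (cmod t + 1) * \<epsilon>" by (simp add: distrib_left)
      also have "cmod t / (cmod t + 1) * \<epsilon> \<le> 1 * \<epsilon>" using t \<epsilon> by (intro mult_right_mono) auto
      finally show ?case by simp
    qed
    then show "h (\<lambda>i. t * x i) \<le> cmod t * h x + \<epsilon>" by (rule lower)
  qed
  with upper lower show ?thesis by (intro that[of h]) auto
qed

context nc_system begin

definition tests :: "(nat \<times> nat \<times> ('d \<Rightarrow> nat \<Rightarrow> nat \<Rightarrow> complex) list \<times> (nat \<Rightarrow> complex)) set" where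
  "tests = {(i, n, Xs, v). i < k \<and> test Q n Xs v}"

definition truncate :: "(nat \<times> 'd list \<Rightarrow> complex) \<Rightarrow> nat \<times> 'd list \<Rightarrow> complex" where
  "truncate c = (\<lambda>b. if b \<in> B then c b else 0)"

definition test_value :: "real \<Rightarrow> (nat \<times> 'd list \<Rightarrow> complex) \<Rightarrow> nat \<times> nat \<times> ('d \<Rightarrow> nat \<Rightarrow> nat \<Rightarrow> complex) list \<times> (nat \<Rightarrow> complex) \<Rightarrow> real" where
  "test_value r c = (\<lambda>(i, n, Xs, v). r ^ length Xs * l2 {..<n} (path_sum A n (Out i) c Xs v))"

text \<open>
  The supremum of the polarized components of \<open>P\<^sup>-\<^sup>1 c\<close>, weighted by \<open>r\<close> to their degree. Restricting
  \<open>c\<close> to the coordinates of states makes this a seminorm on all functions.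
\<close>

definition growth :: "real \<Rightarrow> (nat \<times> 'd list \<Rightarrow> complex) \<Rightarrow> real" where
  "growth r c = (SUP \<tau>\<in>tests. test_value r (truncate c) \<tau>)"

lemma truncate_V: "truncate c \<in> V" and truncate_id: "c \<in> V \<Longrightarrow> truncate c = c"
  by (auto simp: truncate_def V_def)

lemma tests_ne: "tests \<noteq> {}"
proof -
  have "(0, 0, [], \<lambda>_. 0) \<in> tests" using k by (simp add: tests_def test_def)
  then show ?thesis by blast
qed

lemma growth_bdd:
  assumes "0 \<le> r" "r < 1" shows "bdd_above (test_value r (truncate c) ` tests)"
proof -
  obtain K where "\<And>i n Xs v. i < k \<Longrightarrow> test Q n Xs v \<Longrightarrow> r ^ length Xs * l2 {..<n} (path_sum A n (Out i) (truncate c) Xs v) \<le> K"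
    using path_growth[OF assms truncate_V] by blast
  then show ?thesis by (intro bdd_aboveI2[where M = K]) (auto simp: tests_def test_value_def)
qed

lemma growth_upper:
  assumes "0 \<le> r" "r < 1" "c \<in> V" "i < k" "test Q n Xs v"
  shows "r ^ length Xs * l2 {..<n} (path_sum A n (Out i) c Xs v) \<le> growth r c"
  using cSUP_upper[OF _ growth_bdd[OF assms(1,2), of c], of "(i, n, Xs, v)"] assms
  by (simp add: growth_def tests_def test_value_def truncate_id)

lemma growth_least:
  assumes "c \<in> V" "\<And>i n Xs v. i < k \<Longrightarrow> test Q n Xs v \<Longrightarrow> r ^ length Xs * l2 {..<n} (path_sum A n (Out i) c Xs v) \<le> M"
  shows "growth r c \<le> M"
  unfolding growth_def using assms by (intro cSUP_least tests_ne) (auto simp: tests_def test_value_def truncate_id)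

lemma seminorm_growth:
  assumes "0 \<le> r" "r < 1" shows "seminorm (growth r)"
  unfolding growth_def[abs_def]
proof (rule seminorm_SUP[OF _ tests_ne growth_bdd[OF assms]])
  fix \<tau> :: "nat \<times> nat \<times> ('d \<Rightarrow> nat \<Rightarrow> nat \<Rightarrow> complex) list \<times> (nat \<Rightarrow> complex)"
  obtain i n Xs v where \<tau>: "\<tau> = (i, n, Xs, v)" by (metis surj_pair)
  have r1: "truncate (\<lambda>b. x b + y b) = (\<lambda>b. truncate x b + truncate y b)" for x y by (auto simp: truncate_def)
  have r2: "truncate (\<lambda>b. t * x b) = (\<lambda>b. t * truncate x b)" for t x by (auto simp: truncate_def)
  show "seminorm (\<lambda>c. test_value r (truncate c) \<tau>)"
    unfolding seminorm_def \<tau> test_value_def r1 r2 using assms(1)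
    by (auto simp: path_sum_add_state[OF linear_form_Out linear_op_A] path_sum_mult_state[OF linear_form_Out linear_op_A] l2_mult
        distrib_left[symmetric] intro!: mult_left_mono l2_triangle)
qed

lemma growth_mono:
  assumes "0 \<le> r" "r \<le> r'" "r' < 1" "c \<in> V" shows "growth r c \<le> growth r' c"
proof (rule growth_least[OF assms(4)])
  fix i n Xs v assume t: "i < k" "test Q n Xs v"
  have "r ^ length Xs * l2 {..<n} (path_sum A n (Out i) c Xs v) \<le> r' ^ length Xs * l2 {..<n} (path_sum A n (Out i) c Xs v)"
    using assms by (intro mult_right_mono power_mono) auto
  also have "\<dots> \<le> growth r' c" using assms t by (intro growth_upper) auto
  finally show "r ^ length Xs * l2 {..<n} (path_sum A n (Out i) c Xs v) \<le> growth r' c" .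
qed

definition basis_state :: "nat \<times> 'd list \<Rightarrow> nat \<times> 'd list \<Rightarrow> complex" where
  "basis_state b = (\<lambda>b'. if b' = b then 1 else 0)"

lemma basis_state_V: "b \<in> B \<Longrightarrow> basis_state b \<in> V" by (auto simp: basis_state_def V_def)

lemma V_expand: "c \<in> V \<Longrightarrow> (\<lambda>b. \<Sum>b'\<in>B. c b' * basis_state b' b) = c"
  using finite_B by (auto simp: basis_state_def V_def fun_eq_iff if_distrib cong: if_cong)

definition total_growth :: "real \<Rightarrow> real" where "total_growth r = (\<Sum>b\<in>B. growth r (basis_state b))"

lemma growth_le_total_growth:
  assumes "0 \<le> r" "r < 1" "c \<in> V" shows "growth r c \<le> (\<Sum>b\<in>B. cmod (c b)) * total_growth r"
proof -
  note semi = seminorm_growth[OF assms(1,2)]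
  have "growth r c \<le> (\<Sum>b\<in>B. cmod (c b) * growth r (basis_state b))"
    using seminorm_sum[OF semi, of c basis_state B] by (simp add: V_expand[OF assms(3)])
  also have "\<dots> \<le> (\<Sum>b\<in>B. cmod (c b) * total_growth r)"
    unfolding total_growth_def by (intro sum_mono mult_left_mono member_le_sum) (auto simp: finite_B seminorm_nonneg[OF semi])
  finally show ?thesis by (simp add: sum_distrib_right)
qed

lemma total_growth_mono: "0 \<le> r \<Longrightarrow> r \<le> r' \<Longrightarrow> r' < 1 \<Longrightarrow> total_growth r \<le> total_growth r'"
  unfolding total_growth_def by (intro sum_mono growth_mono basis_state_V)

definition A_word :: "'d list \<Rightarrow> (nat \<times> 'd list \<Rightarrow> complex) \<Rightarrow> nat \<times> 'd list \<Rightarrow> complex" where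
  "A_word w c = foldr A w c"

lemma A_word_Nil [simp]: "A_word [] c = c" and A_word_Cons [simp]: "A_word (j # w) c = A j (A_word w c)"
  and A_word_append: "A_word (w @ w') c = A_word w (A_word w' c)"
  by (simp_all add: A_word_def)

lemma A_word_V: "c \<in> V \<Longrightarrow> A_word w c \<in> V" by (induction w) (simp_all add: A_V)

lemma linear_op_A_word: "linear_op (A_word w)"
proof (induction w)
  case Nil show ?case by (simp add: linear_op_def linear_form_def)
next
  case (Cons j w) then show ?case using linear_op_comp[OF linear_op_A, of "A_word w" j] by simp
qed

definition scalar_tuple :: "real \<Rightarrow> nat \<Rightarrow> 'd \<Rightarrow> 'd \<Rightarrow> nat \<Rightarrow> nat \<Rightarrow> complex" where
  "scalar_tuple \<epsilon> n j0 = (\<lambda>j a b. if j = j0 \<and> a = b \<and> a < n then complex_of_real \<epsilon> else 0)"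

lemma scalar_tuple_unit: "\<exists>\<epsilon>>0. \<forall>n j. unit_tuple Q n (scalar_tuple \<epsilon> n j)"
proof -
  have "\<exists>\<epsilon>>0. \<forall>S j0. finite S \<longrightarrow>
    tuple_norm_le Q (1/2) (S :: nat set) (\<lambda>j a b. if j = j0 \<and> a = b then complex_of_real \<epsilon> else 0)"
    by (rule tuple_norm_le_scalar_point[OF Q])
  then obtain \<epsilon> where \<epsilon>: "\<epsilon> > 0" "\<And>S j0. finite S \<Longrightarrow>
    tuple_norm_le Q (1/2) (S :: nat set) (\<lambda>j a b. if j = j0 \<and> a = b then complex_of_real \<epsilon> else 0)"
    by blast
  have "tuple_norm_le Q (1/2) {..<n} (scalar_tuple \<epsilon> n j)" for n j
    by (rule tuple_norm_le_cong[OF \<epsilon>(2)]) (auto simp: scalar_tuple_def)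
  then have "unit_tuple Q n (scalar_tuple \<epsilon> n j)" for n j
    unfolding unit_tuple_def by (intro conjI exI[of _ "1/2"]) (auto simp: scalar_tuple_def)
  with \<epsilon>(1) show ?thesis by blast
qed

lemma mat_apply_scalar_tuple: 
  assumes "\<forall>a\<ge>n. v a = 0" 
  shows "mat_apply {..<n} (scalar_tuple \<epsilon> n j0 j) v = (\<lambda>a. if j = j0 then complex_of_real \<epsilon> * v a else 0)"
proof
  fix a
  have "mat_apply {..<n} (scalar_tuple \<epsilon> n j0 j) v a = (\<Sum>b<n. if b = a then (if j = j0 then complex_of_real \<epsilon> * v a else 0) else 0)"
    unfolding mat_apply_def by (intro sum.cong refl) (auto simp: scalar_tuple_def)
  then show "mat_apply {..<n} (scalar_tuple \<epsilon> n j0 j) v a = (if j = j0 then complex_of_real \<epsilon> * v a else 0)"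
    using assms by (simp add: not_less)
qed

lemma path_sum_zero_vec: "path_sum A n \<phi> c Xs (\<lambda>b. 0) = (\<lambda>a. 0)"
  using path_sum_mult_vec[of A n \<phi> c Xs 0 "\<lambda>b. 0"] by simp

lemma path_sum_scalar_Cons:
  assumes "\<forall>a\<ge>n. v a = 0"
  shows "path_sum A n \<phi> c (scalar_tuple \<epsilon> n j # Xs) v = (\<lambda>a. complex_of_real \<epsilon> * path_sum A n \<phi> (A j c) Xs v a)"
proof
  fix a
  have "path_sum A n \<phi> c (scalar_tuple \<epsilon> n j # Xs) v a =
    (\<Sum>i\<in>UNIV. if i = j then complex_of_real \<epsilon> * path_sum A n \<phi> (A j c) Xs v a else 0)"
    unfolding path_sum.simps(2) mat_apply_scalar_tuple[OF assms]
    by (intro sum.cong refl) (auto simp: path_sum_mult_vec path_sum_zero_vec)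
  then show "path_sum A n \<phi> c (scalar_tuple \<epsilon> n j # Xs) v a = complex_of_real \<epsilon> * path_sum A n \<phi> (A j c) Xs v a" by simp
qed

lemma test_Cons: "unit_tuple Q n X \<Longrightarrow> test Q n Xs v \<Longrightarrow> test Q n (X # Xs) v"
  and test_Nil: "test Q n Xs v \<Longrightarrow> test Q n [] v"
  and test_support: "test Q n Xs v \<Longrightarrow> \<forall>a\<ge>n. v a = 0"
  by (auto simp: test_def)

lemma unit_tuple_mat_apply_le: "unit_tuple Q n X \<Longrightarrow> l2 {..<n} (mat_apply {..<n} (X j) v) \<le> C * l2 {..<n} v"
  unfolding unit_tuple_def using tuple_norm_le_mat_apply_le less_imp_le by blast

text \<open>
  A scalar tuple \<open>\<epsilon>\<close> in direction \<open>j\<close> at the start of a path applies \<open>\<epsilon> A\<^sub>j\<close> to the state.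
\<close>

lemma growth_shift:
  obtains M where "M > 0" "\<And>r c j. 1/2 \<le> r \<Longrightarrow> r < 1 \<Longrightarrow> c \<in> V \<Longrightarrow> growth r (A j c) \<le> M * growth r c"
proof -
  obtain \<epsilon> where \<epsilon>: "\<epsilon> > 0" "\<And>n j. unit_tuple Q n (scalar_tuple \<epsilon> n j)" using scalar_tuple_unit by blast
  have "growth r (A j c) \<le> (2 / \<epsilon>) * growth r c" if r: "1/2 \<le> r" "r < 1" and c: "c \<in> V" for r c j
  proof (rule growth_least[OF A_V[OF c]])
    fix i n Xs v assume i: "i < k" and t: "test Q n Xs v"
    let ?G = "l2 {..<n} (path_sum A n (Out i) (A j c) Xs v)"
    have "(r * r ^ length Xs) * (\<epsilon> * ?G) = r ^ length (scalar_tuple \<epsilon> n j # Xs) * l2 {..<n} (path_sum A n (Out i) c (scalar_tuple \<epsilon> n j # Xs) v)"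
      unfolding path_sum_scalar_Cons[OF test_support[OF t]] l2_mult using \<epsilon>(1) by simp
    also have "\<dots> \<le> growth r c" by (rule growth_upper) (use r c i t \<epsilon> test_Cons in auto)
    finally have *: "(r * r ^ length Xs) * (\<epsilon> * ?G) \<le> growth r c" .
    have "(1/2) * (r ^ length Xs * (\<epsilon> * ?G)) \<le> r * (r ^ length Xs * (\<epsilon> * ?G))"
      using r \<epsilon> by (intro mult_right_mono) auto
    with * have "(1/2) * (r ^ length Xs * (\<epsilon> * ?G)) \<le> growth r c" by (simp add: mult.assoc)
    then show "r ^ length Xs * ?G \<le> (2 / \<epsilon>) * growth r c" using \<epsilon>(1) by (simp add: field_simps)
  qed
  then show ?thesis using \<epsilon>(1) by (intro that[of "2 / \<epsilon>"]) auto
qed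

lemma l2_normalize:
  assumes "l2 {..<n} w \<le> M" "M > 0"
  shows "l2 {..<n} (\<lambda>a. complex_of_real (1 / M) * w a) \<le> 1"
  unfolding l2_mult using assms by (simp add: norm_divide field_simps)

text \<open>
  Splitting off the first tuple of a path expresses its value through the states \<open>A\<^sub>j c\<close>; only
  the empty path is left over.
\<close>

lemma growth_unshift:
  assumes r: "1/2 \<le> r" "r < 1" and c: "c \<in> V"
  shows "growth r c \<le> growth (1/2) c + C * (\<Sum>j\<in>UNIV. growth r (A j c))"
proof (rule growth_least[OF c])
  fix i n Xs v assume i: "i < k" and t: "test Q n Xs v"
  have nonneg: "growth r c' \<ge> 0" if "0 \<le> r" "r < 1" for r c'
    by (rule seminorm_nonneg[OF seminorm_growth[OF that]])
  have sum0: "(\<Sum>j\<in>UNIV. growth r (A j c)) \<ge> 0" using r by (intro sum_nonneg nonneg) auto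
  show "r ^ length Xs * l2 {..<n} (path_sum A n (Out i) c Xs v) \<le> growth (1/2) c + C * (\<Sum>j\<in>UNIV. growth r (A j c))"
  proof (cases Xs)
    case Nil
    have "l2 {..<n} (path_sum A n (Out i) c [] v) \<le> growth (1/2) c"
      using growth_upper[of "1/2" c i n "[]" v] c i test_Nil[OF t] by simp
    with Nil sum0 C_pos show ?thesis by (simp add: add_increasing2)
  next
    case (Cons X Ys)
    then have X: "unit_tuple Q n X" and Ys: "\<forall>X\<in>set Ys. unit_tuple Q n X" using t by (auto simp: test_def)
    have tj: "r ^ length Ys * l2 {..<n} (path_sum A n (Out i) (A j c) Ys (mat_apply {..<n} (X j) v)) \<le> C * growth r (A j c)" for j
    proof -
      let ?w = "\<lambda>a. complex_of_real (1 / C) * mat_apply {..<n} (X j) v a"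
      have "l2 {..<n} (mat_apply {..<n} (X j) v) \<le> C * l2 {..<n} v" by (rule unit_tuple_mat_apply_le[OF X])
      also have "\<dots> \<le> C * 1" using t C_pos by (intro mult_left_mono) (auto simp: test_def)
      finally have "l2 {..<n} ?w \<le> 1" using C_pos by (intro l2_normalize) auto
      then have tw: "test Q n Ys ?w" using Ys mat_apply_unit_tuple_support[OF X] by (simp add: test_def)
      have "r ^ length Ys * l2 {..<n} (path_sum A n (Out i) (A j c) Ys ?w) \<le> growth r (A j c)"
        using r by (intro growth_upper A_V c i tw) auto
      then show ?thesis unfolding path_sum_mult_vec l2_mult using C_pos by (simp add: norm_divide field_simps)
    qed
    have "r ^ length Xs * l2 {..<n} (path_sum A n (Out i) c Xs v) \<le>
      1 * (r ^ length Ys * (\<Sum>j\<in>UNIV. l2 {..<n} (path_sum A n (Out i) (A j c) Ys (mat_apply {..<n} (X j) v))))"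
      unfolding Cons path_sum.simps(2) length_Cons power_Suc mult.assoc
      using r by (intro mult_mono l2_sum) (auto intro!: mult_nonneg_nonneg sum_nonneg)
    also have "\<dots> \<le> (\<Sum>j\<in>UNIV. C * growth r (A j c))"
      unfolding mult_1 sum_distrib_left by (intro sum_mono tj)
    finally have "r ^ length Xs * l2 {..<n} (path_sum A n (Out i) c Xs v) \<le> C * (\<Sum>j\<in>UNIV. growth r (A j c))"
      by (simp add: sum_distrib_left)
    then show ?thesis using nonneg[of "1/2" c] by linarith
  qed
qed

text \<open>
  A slice of a path is tested by prolonging that path through a rank one operator, so
  paths in the ball are contractive for the weighted growth.
\<close>

lemma growth_slice:
  assumes r: "0 \<le> r" "r < 1" and c: "c \<in> V" and t: "test Q n Xs v" and f: "l2 {..<n} f \<le> 1" "\<forall>a\<ge>n. f a = 0"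
  shows "r ^ length Xs * growth r (slice A n f c Xs v) \<le> growth r c"
proof (cases "r = 0 \<and> Xs \<noteq> []")
  case True
  then have z: "r ^ length Xs = 0" by simp
  show ?thesis unfolding z using seminorm_nonneg[OF seminorm_growth[OF r], of c] by simp
next
  case False
  then have rp: "r ^ length Xs > 0" using r(1) by (cases "Xs = []") auto
  let ?z = "slice A n f c Xs v"
  have zV: "?z \<in> V" by (rule slice_closed[OF c]) (auto intro: A_V V_mult V_sum)
  have "growth r ?z \<le> growth r c / r ^ length Xs"
  proof (rule growth_least[OF zV])
    fix i n' Ys v' assume i: "i < k" and t': "test Q n' Ys v'"
    have "r ^ length Xs * (r ^ length Ys * l2 {..<n'} (path_sum A n' (Out i) ?z Ys v')) \<le> growth r c"
    proof (cases Ys)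
      case Nil
      have "cmod (Out i ?z) \<le> l2 {..<n} (path_sum A n (Out i) c Xs v) * 1"
        unfolding linear_form_slice[OF linear_form_Out]
        by (rule order_trans[OF inner_prod_CS]) (intro mult_left_mono f, simp)
      moreover have "l2 {..<n'} v' \<le> 1" using t' by (simp add: test_def)
      ultimately have "cmod (Out i ?z) * l2 {..<n'} v' \<le> l2 {..<n} (path_sum A n (Out i) c Xs v) * 1"
        by (intro mult_mono) auto
      then have "r ^ length Xs * (cmod (Out i ?z) * l2 {..<n'} v') \<le> r ^ length Xs * l2 {..<n} (path_sum A n (Out i) c Xs v)"
        using rp by (intro mult_left_mono) auto
      also have "\<dots> \<le> growth r c" by (rule growth_upper[OF r c i t])
      finally show ?thesis by (simp add: Nil l2_mult)
    next
      case (Cons X Zs)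
      define m where "m = max n n'"
      have nm: "n \<le> m" "n' \<le> m" by (auto simp: m_def)
      have t1: "test Q m Xs v" by (rule test_mono(1)[OF t nm(1)])
      have t2: "test Q m (X # Zs) v'" using test_mono(1)[OF t' nm(2)] Cons by simp
      have f': "l2 {..<m} f \<le> 1" using l2_lessThan_mono[OF nm(1), of f] f by auto
      have z_eq: "slice A m f c Xs v = ?z"
      proof -
        have Xs: "\<forall>X\<in>set Xs. unit_tuple Q n X" "\<forall>a\<ge>n. v a = 0" using t by (auto simp: test_def)
        then show ?thesis
        proof (induction Xs arbitrary: c v)
          case Nil
          have "inner_prod {..<m} v f = inner_prod {..<n} v f" unfolding inner_prod_def
            using nm(1) f(2) by (intro sum.mono_neutral_right) auto
          then show ?case by simp
        next
          case (Cons Y Xs)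
          then show ?case using mat_apply_unit_tuple_support[of Q n Y] mat_apply_unit_tuple_mono[of Q n Y m] nm(1) by simp
        qed
      qed
      let ?R = "\<lambda>j a b. mat_apply {..<m} (X j) v' a * cnj (f b)"
      have X: "unit_tuple Q m X" and v': "l2 {..<m} v' \<le> 1" using t2 by (auto simp: test_def)
      then obtain \<rho> where "\<rho> < 1" "tuple_norm_le Q \<rho> {..<m} X" by (auto simp: unit_tuple_def)
      from tuple_norm_le_rank1[OF Q this(2) v' f'] this(1)
      have R: "unit_tuple Q m ?R"
        unfolding unit_tuple_def using mat_apply_unit_tuple_support[OF X] f(2) nm(1) by (auto intro: exI[of _ \<rho>])
      have tt: "test Q m (Xs @ ?R # Zs) v" using t1 t2 R by (auto simp: test_def)
      have "r ^ length Xs * (r ^ length Ys * l2 {..<n'} (path_sum A n' (Out i) ?z Ys v')) =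
        r ^ length (Xs @ ?R # Zs) * l2 {..<m} (path_sum A m (Out i) c (Xs @ ?R # Zs) v)"
        unfolding path_sum_slice[OF linear_form_Out linear_op_A] z_eq using test_mono(2)[OF t' nm(2), of A "Out i" ?z]
        by (simp add: Cons power_add mult.assoc del: path_sum.simps)
      also have "\<dots> \<le> growth r c" by (rule growth_upper[OF r c i tt])
      finally show ?thesis .
    qed
    then show "r ^ length Ys * l2 {..<n'} (path_sum A n' (Out i) ?z Ys v') \<le> growth r c / r ^ length Xs"
      using rp by (simp add: pos_le_divide_eq mult.commute)
  qed
  then show ?thesis using rp by (simp add: pos_le_divide_eq mult.commute)
qed

text \<open>
  The constant may depend on the state, but neither on the length of the path nor on the
  matrix size.
\<close>

definition bounded_growth :: "((nat \<times> 'd list \<Rightarrow> complex) \<Rightarrow> complex) \<Rightarrow> bool" where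
  "bounded_growth \<phi> \<longleftrightarrow> (\<forall>c\<in>V. \<exists>K. \<forall>n Xs v. test Q n Xs v \<longrightarrow> l2 {..<n} (path_sum A n \<phi> c Xs v) \<le> K)"

text \<open>
  Each nonempty path ends with a tuple of the ball, which is bounded; what precedes it is measured by
  the functionals \<open>\<phi> \<circ> A\<^sub>j\<close>.
\<close>

lemma bounded_growth_lift:
  assumes "\<And>j. bounded_growth (\<lambda>c. \<phi> (A j c))" shows "bounded_growth \<phi>"
  unfolding bounded_growth_def
proof
  fix c assume c: "c \<in> V"
  have "\<exists>K. \<forall>n Xs v. test Q n Xs v \<longrightarrow> l2 {..<n} (path_sum A n (\<lambda>c. \<phi> (A j c)) c Xs v) \<le> K" for j
    using assms c by (simp add: bounded_growth_def)
  then have "\<exists>K. \<forall>j n Xs v. test Q n Xs v \<longrightarrow> l2 {..<n} (path_sum A n (\<lambda>c. \<phi> (A j c)) c Xs v) \<le> K j"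
    by (intro choice allI)
  then obtain K where K: "\<And>j n Xs v. test Q n Xs v \<Longrightarrow> l2 {..<n} (path_sum A n (\<lambda>c. \<phi> (A j c)) c Xs v) \<le> K j"
    by blast
  show "\<exists>K. \<forall>n Xs v. test Q n Xs v \<longrightarrow> l2 {..<n} (path_sum A n \<phi> c Xs v) \<le> K"
  proof (intro exI allI impI)
    fix n Xs v assume t: "test Q n Xs v"
    have K0: "K j \<ge> 0" for j using K[of 0 "[]" "\<lambda>_. 0" j] by (simp add: test_def)
    then have K0': "C * (\<Sum>j\<in>UNIV. K j) \<ge> 0" using C_pos by (intro mult_nonneg_nonneg sum_nonneg) auto
    show "l2 {..<n} (path_sum A n \<phi> c Xs v) \<le> cmod (\<phi> c) + C * (\<Sum>j\<in>UNIV. K j)"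
    proof (cases Xs rule: rev_cases)
      case Nil
      have "l2 {..<n} (path_sum A n \<phi> c Xs v) \<le> cmod (\<phi> c) * 1"
        unfolding Nil path_sum.simps l2_mult using t by (intro mult_left_mono) (auto simp: test_def)
      then show ?thesis using K0' by simp
    next
      case (snoc Ys X)
      then have X: "unit_tuple Q n X" and Ys: "test Q n Ys v" using t by (auto simp: test_def)
      have "l2 {..<n} (path_sum A n \<phi> c Xs v) \<le> (\<Sum>j\<in>UNIV. l2 {..<n} (mat_apply {..<n} (X j) (path_sum A n (\<lambda>c. \<phi> (A j c)) c Ys v)))"
        unfolding snoc path_sum_snoc by (rule l2_sum)
      also have "\<dots> \<le> (\<Sum>j\<in>UNIV. C * K j)"
      proof (rule sum_mono)
        fix j
        have "l2 {..<n} (mat_apply {..<n} (X j) (path_sum A n (\<lambda>c. \<phi> (A j c)) c Ys v)) \<le> C * l2 {..<n} (path_sum A n (\<lambda>c. \<phi> (A j c)) c Ys v)"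
          by (rule unit_tuple_mat_apply_le[OF X])
        also have "\<dots> \<le> C * K j" using C_pos by (intro mult_left_mono K Ys) auto
        finally show "l2 {..<n} (mat_apply {..<n} (X j) (path_sum A n (\<lambda>c. \<phi> (A j c)) c Ys v)) \<le> C * K j" .
      qed
      finally show ?thesis by (simp add: sum_distrib_left add_increasing)
    qed
  qed
qed

text \<open>
  A scalar tuple at the end of a path replaces the functional \<open>\<phi>\<close> by a multiple of \<open>\<phi> \<circ> A\<^sub>j\<close>.
\<close>

lemma bounded_growth_shift:
  assumes "bounded_growth \<phi>" shows "bounded_growth (\<lambda>c. \<phi> (A j c))"
  unfolding bounded_growth_def
proof
  fix c assume c: "c \<in> V"
  obtain \<epsilon> where \<epsilon>: "\<epsilon> > 0" "\<And>n j. unit_tuple Q n (scalar_tuple \<epsilon> n j)" using scalar_tuple_unit by blast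
  obtain K where K: "\<And>n Xs v. test Q n Xs v \<Longrightarrow> l2 {..<n} (path_sum A n \<phi> c Xs v) \<le> K"
    using assms c unfolding bounded_growth_def by blast
  show "\<exists>K. \<forall>n Xs v. test Q n Xs v \<longrightarrow> l2 {..<n} (path_sum A n (\<lambda>c. \<phi> (A j c)) c Xs v) \<le> K"
  proof (intro exI allI impI)
    fix n Xs v assume t: "test Q n Xs v"
    let ?G = "\<lambda>i. path_sum A n (\<lambda>c. \<phi> (A i c)) c Xs v"
    have supp: "\<forall>a\<ge>n. ?G i a = 0" for i using path_sum_support[of Xs Q n v] t by (auto simp: test_def)
    have "path_sum A n \<phi> c (Xs @ [scalar_tuple \<epsilon> n j]) v = (\<lambda>a. complex_of_real \<epsilon> * ?G j a)"
    proof
      fix a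
      have "path_sum A n \<phi> c (Xs @ [scalar_tuple \<epsilon> n j]) v a = (\<Sum>i\<in>UNIV. if i = j then complex_of_real \<epsilon> * ?G j a else 0)"
        unfolding path_sum_snoc mat_apply_scalar_tuple[OF supp] by (intro sum.cong refl) auto
      then show "path_sum A n \<phi> c (Xs @ [scalar_tuple \<epsilon> n j]) v a = complex_of_real \<epsilon> * ?G j a" by simp
    qed
    then have "\<epsilon> * l2 {..<n} (?G j) = l2 {..<n} (path_sum A n \<phi> c (Xs @ [scalar_tuple \<epsilon> n j]) v)"
      using \<epsilon>(1) by (simp add: l2_mult)
    also have "\<dots> \<le> K" by (rule K) (use t \<epsilon>(2) in \<open>auto simp: test_def\<close>)
    finally show "l2 {..<n} (?G j) \<le> K / \<epsilon>" using \<epsilon>(1) by (simp add: field_simps)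
  qed
qed

end

section \<open>Bounded growth from a dichotomy for invariant subspaces\<close>

context nc_system begin

lemma growth_truncate: "growth r (truncate c) = growth r c"
  by (simp add: growth_def truncate_id[OF truncate_V])

text \<open>
  The seminorm is the upper limit of the normalized growths. The normalization makes
  it nonzero, since finitely many normalized growths always add up to one. The other properties
  hold for each weight up to constants that disappear in the limit: the contribution of the
  empty path is divided by a quantity tending to infinity, and for a path of fixed length the weight
  \<open>r\<^sup>m\<close> tends to one.
\<close>

lemma growth_blow_up_seminorm:
  fixes \<rho> :: "nat \<Rightarrow> real"
  assumes \<rho>: "\<And>n. 1/2 \<le> \<rho> n" "\<And>n. \<rho> n < 1" and lim: "\<rho> \<longlonglongrightarrow> 1"
    and blow: "filterlim (\<lambda>n. total_growth (\<rho> n)) at_top sequentially"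
  obtains h where "seminorm h"
    and "\<And>c j. c \<in> V \<Longrightarrow> h c = 0 \<Longrightarrow> h (A j c) = 0"
    and "(\<Sum>b\<in>B. h (basis_state b)) \<ge> 1"
    and "\<And>c. c \<in> V \<Longrightarrow> \<forall>j. h (A j c) = 0 \<Longrightarrow> h c = 0"
    and "\<And>c n Xs v f. c \<in> V \<Longrightarrow> test Q n Xs v \<Longrightarrow> l2 {..<n} f \<le> 1 \<Longrightarrow> \<forall>a\<ge>n. f a = 0 \<Longrightarrow> h (slice A n f c Xs v) \<le> h c"
proof -
  have \<rho>0: "0 \<le> \<rho> n" for n using \<rho>(1)[of n] by linarith
  define q where "q n c = growth (\<rho> n) c / total_growth (\<rho> n)" for n c
  have s0: "total_growth (\<rho> n) \<ge> 0" for n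
    unfolding total_growth_def by (intro sum_nonneg seminorm_nonneg[OF seminorm_growth[OF \<rho>0 \<rho>(2)]])
  have q_semi: "seminorm (q n)" for n
    using seminorm_growth[OF \<rho>0 \<rho>(2), of n] s0[of n] unfolding q_def seminorm_def
    by (simp add: add_divide_distrib[symmetric] divide_right_mono)
  have "q n c \<le> (\<Sum>b\<in>B. cmod (truncate c b))" for n c
  proof (cases "total_growth (\<rho> n) = 0")
    case True then show ?thesis by (simp add: q_def sum_nonneg)
  next
    case False
    with s0[of n] have "total_growth (\<rho> n) > 0" by simp
    then show ?thesis using growth_le_total_growth[OF \<rho>0 \<rho>(2) truncate_V, of n c]
      by (simp add: q_def growth_truncate pos_divide_le_eq)
  qed
  then have bdd: "\<exists>M. \<forall>n. q n c \<le> M" for c by blast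
  obtain h where h: "seminorm h"
    and upper: "\<And>c \<epsilon>. \<epsilon> > 0 \<Longrightarrow> eventually (\<lambda>n. q n c \<le> h c + \<epsilon>) sequentially"
    and lower: "\<And>c y. eventually (\<lambda>n. q n c \<le> y) sequentially \<Longrightarrow> h c \<le> y"
    by (rule limsup_seminorm[of q, OF q_semi bdd]) (rule that)
  have h0: "h c \<ge> 0" for c by (rule seminorm_nonneg[OF h])
  have pos: "eventually (\<lambda>n. total_growth (\<rho> n) > 0) sequentially"
    using blow by (simp add: filterlim_at_top_dense)
  show ?thesis
  proof (rule that[OF h])
    fix c j assume c: "c \<in> V" "h c = 0"
    obtain M where M: "M > 0" "\<And>r c j. 1/2 \<le> r \<Longrightarrow> r < 1 \<Longrightarrow> c \<in> V \<Longrightarrow> growth r (A j c) \<le> M * growth r c"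
      using growth_shift by blast
    have "h (A j c) \<le> 0 + \<epsilon>" if "\<epsilon> > 0" for \<epsilon>
    proof (rule lower)
      have "\<epsilon> / M > 0" using that M by simp
      from upper[OF this, of c] show "eventually (\<lambda>n. q n (A j c) \<le> 0 + \<epsilon>) sequentially"
      proof eventually_elim
        case (elim n)
        have "q n (A j c) \<le> (M * growth (\<rho> n) c) / total_growth (\<rho> n)"
          unfolding q_def using M(2)[OF \<rho>(1,2) c(1)] s0 by (rule divide_right_mono)
        also have "\<dots> = M * q n c" by (simp add: q_def)
        also have "\<dots> \<le> M * (\<epsilon> / M)" using elim M(1) c(2) by (intro mult_left_mono) auto
        finally show ?case using M(1) by simp
      qed
    qed
    then have "h (A j c) \<le> 0" by (rule field_le_epsilon)
    then show "h (A j c) = 0" using h0[of "A j c"] by simp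
  next
    have "1 \<le> (\<Sum>b\<in>B. h (basis_state b)) + \<epsilon>" if "\<epsilon> > 0" for \<epsilon>
    proof -
      define \<delta> where "\<delta> = \<epsilon> / (real (card B) + 1)"
      have \<delta>: "\<delta> > 0" using that by (simp add: \<delta>_def add_nonneg_pos)
      have "eventually (\<lambda>n. \<forall>b\<in>B. q n (basis_state b) \<le> h (basis_state b) + \<delta>) sequentially"
        by (intro eventually_ball_finite finite_B ballI upper \<delta>)
      with pos have "eventually (\<lambda>n. total_growth (\<rho> n) > 0 \<and> (\<forall>b\<in>B. q n (basis_state b) \<le> h (basis_state b) + \<delta>)) sequentially"
        by eventually_elim simp
      then obtain n where n: "total_growth (\<rho> n) > 0" "\<And>b. b \<in> B \<Longrightarrow> q n (basis_state b) \<le> h (basis_state b) + \<delta>"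
        unfolding eventually_sequentially by blast
      have "1 = (\<Sum>b\<in>B. q n (basis_state b))" using n(1) by (simp add: q_def sum_divide_distrib[symmetric] total_growth_def[symmetric])
      also have "\<dots> \<le> (\<Sum>b\<in>B. h (basis_state b) + \<delta>)" by (intro sum_mono n)
      also have "\<dots> = (\<Sum>b\<in>B. h (basis_state b)) + real (card B) * \<delta>" by (simp add: sum.distrib)
      also have "real (card B) * \<delta> \<le> \<epsilon>" using that by (simp add: \<delta>_def field_simps)
      finally show ?thesis by simp
    qed
    then show "1 \<le> (\<Sum>b\<in>B. h (basis_state b))" by (rule field_le_epsilon)
  next
    fix c assume c: "c \<in> V" "\<forall>j. h (A j c) = 0"
    have "h c \<le> 0 + \<epsilon>" if "\<epsilon> > 0" for \<epsilon>
    proof (rule lower)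
      define N where "N = real (card (UNIV :: 'd set))"
      have N: "N > 0" by (simp add: N_def card_gt_0_iff)
      define \<delta> where "\<delta> = \<epsilon> / (2 * C * N)"
      have \<delta>: "\<delta> > 0" using that C_pos N by (simp add: \<delta>_def)
      have "eventually (\<lambda>n. \<forall>j\<in>UNIV. q n (A j c) \<le> h (A j c) + \<delta>) sequentially"
        by (intro eventually_ball_finite finite ballI upper \<delta>)
      moreover have "eventually (\<lambda>n. total_growth (\<rho> n) > 2 * growth (1/2) c / \<epsilon>) sequentially"
        using blow by (simp add: filterlim_at_top_dense)
      ultimately show "eventually (\<lambda>n. q n c \<le> 0 + \<epsilon>) sequentially"
        using pos
      proof eventually_elim
        case (elim n)
        have "q n c \<le> (growth (1/2) c + C * (\<Sum>j\<in>UNIV. growth (\<rho> n) (A j c))) / total_growth (\<rho> n)"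
          unfolding q_def by (rule divide_right_mono[OF growth_unshift[OF \<rho>(1,2) c(1)] s0])
        also have "\<dots> = growth (1/2) c / total_growth (\<rho> n) + C * (\<Sum>j\<in>UNIV. q n (A j c))"
          by (simp add: add_divide_distrib q_def sum_divide_distrib[symmetric])
        also have "growth (1/2) c / total_growth (\<rho> n) \<le> \<epsilon> / 2" using elim that by (simp add: field_simps)
        also have "C * (\<Sum>j\<in>UNIV. q n (A j c)) \<le> C * (\<Sum>j\<in>(UNIV::'d set). \<delta>)"
          using C_pos elim c(2) by (intro mult_left_mono sum_mono) auto
        also have "C * (\<Sum>j\<in>(UNIV::'d set). \<delta>) = \<epsilon> / 2" using C_pos N by (simp add: \<delta>_def N_def[symmetric])
        finally show ?case by simp
      qed
    qed
    then have "h c \<le> 0" by (rule field_le_epsilon)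
    then show "h c = 0" using h0[of c] by simp
  next
    fix c n Xs v and f :: "nat \<Rightarrow> complex"
    assume c: "c \<in> V" and t: "test Q n Xs v" and f: "l2 {..<n} f \<le> 1" "\<forall>a\<ge>n. f a = 0"
    let ?z = "slice A n f c Xs v"
    have "h ?z \<le> h c + \<epsilon>" if "\<epsilon> > 0" for \<epsilon>
    proof (rule lower)
      have "(\<lambda>m. \<rho> m ^ length Xs * (h c + \<epsilon>)) \<longlonglongrightarrow> 1 ^ length Xs * (h c + \<epsilon>)"
        by (intro tendsto_mult tendsto_power lim tendsto_const)
      then have "eventually (\<lambda>m. h c + \<epsilon>/2 < \<rho> m ^ length Xs * (h c + \<epsilon>)) sequentially"
        by (rule order_tendstoD) (use that in simp)
      moreover have "\<epsilon> / 2 > 0" using that by simp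
      note upper[OF this, of c]
      ultimately show "eventually (\<lambda>m. q m ?z \<le> h c + \<epsilon>) sequentially"
        using pos
      proof eventually_elim
        case (elim m)
        have "\<rho> m ^ length Xs * q m ?z = (\<rho> m ^ length Xs * growth (\<rho> m) ?z) / total_growth (\<rho> m)" by (simp add: q_def)
        also have "\<dots> \<le> q m c" unfolding q_def
          by (rule divide_right_mono[OF growth_slice[OF \<rho>0 \<rho>(2) c t f] s0])
        also have "\<dots> \<le> \<rho> m ^ length Xs * (h c + \<epsilon>)" using elim by linarith
        finally have *: "\<rho> m ^ length Xs * q m ?z \<le> \<rho> m ^ length Xs * (h c + \<epsilon>)" .
        have "\<rho> m > 0" using \<rho>(1)[of m] by linarith
        then have "\<rho> m ^ length Xs > 0" by simp
        with * show ?case by simp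
      qed
    qed
    then show "h ?z \<le> h c" by (rule field_le_epsilon)
  qed
qed

text \<open>
  Pairing the output of a path with its own direction \<open>f\<close> shows that its norm is the
  value of \<open>\<phi>\<close> at a slice, and slices do not increase the seminorm \<open>h\<close>.
\<close>

lemma bounded_growth_functional:
  assumes \<phi>: "linear_form \<phi>" and M: "M \<ge> 0" "\<And>c. c \<in> V \<Longrightarrow> cmod (\<phi> c) \<le> M * h c"
    and slice: "\<And>c n Xs v f. c \<in> V \<Longrightarrow> test Q n Xs v \<Longrightarrow> l2 {..<n} f \<le> 1 \<Longrightarrow> \<forall>a\<ge>n. f a = 0 \<Longrightarrow> h (slice A n f c Xs v) \<le> h c"
  shows "bounded_growth \<phi>"
  unfolding bounded_growth_def
proof (intro ballI exI allI impI)
  fix c n Xs v assume c: "c \<in> V" and t: "test Q n Xs v"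
  define Y where "Y = path_sum A n \<phi> c Xs v"
  define N where "N = l2 {..<n} Y"
  show "l2 {..<n} (path_sum A n \<phi> c Xs v) \<le> M * max 0 (h c)"
  proof (cases "N = 0")
    case True then show ?thesis using M(1) by (simp add: N_def Y_def)
  next
    case False
    then have N: "N > 0" unfolding N_def by (simp add: less_le)
    define f where "f = (\<lambda>a. complex_of_real (1 / N) * Y a)"
    have f1: "l2 {..<n} f \<le> 1" unfolding f_def by (rule l2_normalize) (use N in \<open>auto simp: N_def\<close>)
    have f0: "\<forall>a\<ge>n. f a = 0" using path_sum_support[of Xs Q n v] t by (auto simp: f_def Y_def test_def)
    let ?z = "slice A n f c Xs v"
    have zV: "?z \<in> V" by (rule slice_closed[OF c]) (auto intro: A_V V_mult V_sum)
    have "\<phi> ?z = inner_prod {..<n} Y f" unfolding Y_def by (rule linear_form_slice[OF \<phi>])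
    also have "\<dots> = complex_of_real N"
      unfolding f_def inner_prod_mult_right inner_prod_self N_def[symmetric] using N by (simp add: power2_eq_square)
    finally have "N = cmod (\<phi> ?z)" using N by simp
    also have "\<dots> \<le> M * h ?z" by (rule M(2)[OF zV])
    also have "\<dots> \<le> M * max 0 (h c)"
      using slice[OF c t f1 f0] M(1) by (intro mult_left_mono) auto
    finally show ?thesis by (simp add: N_def Y_def)
  qed
qed

text \<open>
  If the growth blows up, the limiting seminorm \<open>h\<close> has a kernel spanned by the vectors \<open>e\<close>. In the
  second alternative of the hypothesis, every state would be moved into the kernel by long words, and \<open>h\<close> would vanish because a
  state all of whose shifts lie in the kernel lies there too. In the first alternative, the output after a long
  word vanishes on the kernel, so it is dominated by \<open>h\<close> and has bounded growth; shorter
  words follow by descending induction on the length.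
\<close>

theorem bounded_growth_Out:
  assumes dich: "\<And>J e. finite J \<Longrightarrow> (\<And>l. l \<in> J \<Longrightarrow> e l \<in> V) \<Longrightarrow>
      (\<And>l j. l \<in> J \<Longrightarrow> A j (e l) = (\<lambda>b. \<Sum>m\<in>J. A j (e l) m * e m b)) \<Longrightarrow>
      (\<exists>N. \<forall>l\<in>J. \<forall>w. N \<le> length w \<longrightarrow> (\<forall>i<k. Out i (A_word w (e l)) = 0)) \<or>
      (\<forall>c\<in>V. \<exists>N. \<forall>w. N \<le> length w \<longrightarrow> (\<exists>t. A_word w c = (\<lambda>b. \<Sum>l\<in>J. t l * e l b)))"
    and i: "i < k"
  shows "bounded_growth (Out i)"
proof -
  define \<rho> :: "nat \<Rightarrow> real" where "\<rho> n = 1 - 1 / (real n + 2)" for n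
  have \<rho>: "1/2 \<le> \<rho> n" "\<rho> n < 1" "0 \<le> \<rho> n" for n by (simp_all add: \<rho>_def field_simps)
  have \<rho>_mono: "\<rho> m \<le> \<rho> n" if "m \<le> n" for m n using that by (simp add: \<rho>_def frac_le)
  have lim: "\<rho> \<longlonglongrightarrow> 1"
  proof -
    have "(\<lambda>n. 1 - inverse (real (Suc (Suc n)))) \<longlonglongrightarrow> 1 - 0"
      by (rule tendsto_diff[OF tendsto_const LIMSEQ_Suc[OF LIMSEQ_inverse_real_of_nat]])
    moreover have "\<rho> = (\<lambda>n. 1 - inverse (real (Suc (Suc n))))"
      by (rule ext) (simp add: \<rho>_def inverse_eq_divide)
    ultimately show ?thesis by simp
  qed
  show ?thesis
  proof (cases "\<exists>M. \<forall>n. total_growth (\<rho> n) \<le> M")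
    case True
    then obtain M where M: "\<And>n. total_growth (\<rho> n) \<le> M" by blast
    show ?thesis unfolding bounded_growth_def
    proof (intro ballI exI allI impI)
      fix c n Xs v assume c: "c \<in> V" and t: "test Q n Xs v"
      let ?G = "l2 {..<n} (path_sum A n (Out i) c Xs v)"
      have "\<rho> m ^ length Xs * ?G \<le> (\<Sum>b\<in>B. cmod (c b)) * M" for m
      proof -
        have "\<rho> m ^ length Xs * ?G \<le> growth (\<rho> m) c" by (rule growth_upper[OF \<rho>(3,2) c i t])
        also have "\<dots> \<le> (\<Sum>b\<in>B. cmod (c b)) * total_growth (\<rho> m)" by (rule growth_le_total_growth[OF \<rho>(3,2) c])
        also have "\<dots> \<le> (\<Sum>b\<in>B. cmod (c b)) * M" by (intro mult_left_mono M sum_nonneg) auto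
        finally show ?thesis .
      qed
      moreover have "(\<lambda>m. \<rho> m ^ length Xs * ?G) \<longlonglongrightarrow> 1 ^ length Xs * ?G"
        by (intro tendsto_mult tendsto_power lim tendsto_const)
      ultimately have "1 ^ length Xs * ?G \<le> (\<Sum>b\<in>B. cmod (c b)) * M" by (intro LIMSEQ_le_const2) auto
      then show "?G \<le> (\<Sum>b\<in>B. cmod (c b)) * M" by simp
    qed
  next
    case False
    \<comment> \<open>\<open>total_growth\<close> is monotone in the weight, so being unbounded means tending to infinity\<close>
    have "eventually (\<lambda>n. total_growth (\<rho> n) > M) sequentially" for M
    proof -
      obtain n0 where "total_growth (\<rho> n0) > M" using False by (meson not_le)
      then have "total_growth (\<rho> n) > M" if "n \<ge> n0" for n using total_growth_mono[OF \<rho>(3) \<rho>_mono[OF that] \<rho>(2)] by linarith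
      then show ?thesis unfolding eventually_sequentially by blast
    qed
    then have "filterlim (\<lambda>n. total_growth (\<rho> n)) at_top sequentially" by (simp add: filterlim_at_top_dense)
    then obtain h where h: "seminorm h"
      and hA: "\<And>c j. c \<in> V \<Longrightarrow> h c = 0 \<Longrightarrow> h (A j c) = 0"
      and h1: "(\<Sum>b\<in>B. h (basis_state b)) \<ge> 1"
      and hA': "\<And>c. c \<in> V \<Longrightarrow> \<forall>j. h (A j c) = 0 \<Longrightarrow> h c = 0"
      and slice: "\<And>c n Xs v f. c \<in> V \<Longrightarrow> test Q n Xs v \<Longrightarrow> l2 {..<n} f \<le> 1 \<Longrightarrow> \<forall>a\<ge>n. f a = 0 \<Longrightarrow> h (slice A n f c Xs v) \<le> h c"
      by (rule growth_blow_up_seminorm[OF \<rho>(1,2) lim]) (rule that)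
    obtain J e M where JB: "J \<subseteq> B" and M: "M > 0"
      and he: "\<And>l. l \<in> J \<Longrightarrow> h (e l) = 0" and eB: "\<And>l b. l \<in> J \<Longrightarrow> b \<notin> B \<Longrightarrow> e l b = 0"
      and span: "\<And>z. \<forall>b. b \<notin> B \<longrightarrow> z b = 0 \<Longrightarrow> h z = 0 \<Longrightarrow> z = (\<lambda>b. \<Sum>l\<in>J. z l * e l b)"
      and rest: "\<And>z b. \<forall>b. b \<notin> B \<longrightarrow> z b = 0 \<Longrightarrow> cmod (z b - (\<Sum>l\<in>J. z l * e l b)) \<le> M * h z"
      by (rule seminorm_kernel_echelon[OF finite_B h]) (rule that)
    have finJ: "finite J" using JB finite_B by (rule finite_subset)
    have eV: "e l \<in> V" if "l \<in> J" for l using eB[OF that] by (simp add: V_def)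
    have inv: "A j (e l) = (\<lambda>b. \<Sum>m\<in>J. A j (e l) m * e m b)" if "l \<in> J" for l j
      by (rule span) (use A_V[OF eV[OF that], of j] hA[OF eV[OF that] he[OF that]] in \<open>auto simp: V_def\<close>)
    from dich[OF finJ eV inv] show ?thesis
    proof
      assume ev: "\<forall>c\<in>V. \<exists>N. \<forall>w. N \<le> length w \<longrightarrow> (\<exists>t. A_word w c = (\<lambda>b. \<Sum>l\<in>J. t l * e l b))"
      have "h c = 0" if cV: "c \<in> V" for c
      proof -
        obtain N where N: "\<And>w. N \<le> length w \<Longrightarrow> \<exists>t. A_word w c = (\<lambda>b. \<Sum>l\<in>J. t l * e l b)"
          using ev cV by blast
        have "h (A_word w c) = 0" if lw: "N - m \<le> length w" for w m
          using lw
        proof (induction m arbitrary: w)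
          case 0
          then obtain t where t: "A_word w c = (\<lambda>b. \<Sum>l\<in>J. t l * e l b)" using N by auto
          have "h (A_word w c) \<le> 0" unfolding t using seminorm_sum[OF h, of t e J] he by simp
          then show ?case using seminorm_nonneg[OF h, of "A_word w c"] by simp
        next
          case (Suc m)
          have "h (A j (A_word w c)) = 0" for j using Suc.IH[of "j # w"] Suc.prems by simp
          then show ?case using hA'[OF A_word_V[OF cV]] by blast
        qed
        from this[of N "[]"] show ?thesis by simp
      qed
      then have "(\<Sum>b\<in>B. h (basis_state b)) = 0" by (intro sum.neutral) (auto simp: basis_state_V)
      with h1 show ?thesis by simp
    next
      assume "\<exists>N. \<forall>l\<in>J. \<forall>w. N \<le> length w \<longrightarrow> (\<forall>i<k. Out i (A_word w (e l)) = 0)"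
      then obtain N where N: "\<And>l w. l \<in> J \<Longrightarrow> N \<le> length w \<Longrightarrow> Out i (A_word w (e l)) = 0" using i by blast
      have "bounded_growth (\<lambda>c. Out i (A_word w c))" if "N - m \<le> length w" for m w
        using that
      proof (induction m arbitrary: w)
        case 0
        then have w: "N \<le> length w" by simp
        let ?\<phi> = "\<lambda>c. Out i (A_word w c)"
        have \<phi>: "linear_form ?\<phi>" by (rule linear_form_comp[OF linear_form_Out linear_op_A_word])
        define M' where "M' = (\<Sum>b\<in>B. M * cmod (?\<phi> (basis_state b)))"
        have "cmod (?\<phi> c) \<le> M' * h c" if c: "c \<in> V" for c
        proof -
          \<comment> \<open>removing the kernel part of \<open>c\<close> does not change the value of the functional\<close>
          define y where "y b = c b + (\<Sum>l\<in>J. (- c l) * e l b)" for b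
          have yV: "y \<in> V" unfolding y_def by (intro V_add V_sum V_mult c eV)
          have "?\<phi> y = ?\<phi> c + (\<Sum>l\<in>J. (- c l) * ?\<phi> (e l))"
            unfolding y_def linear_form_add[OF \<phi>] linear_form_lincomb[OF \<phi>] ..
          also have "\<dots> = ?\<phi> c" using N[OF _ w] by simp
          finally have "?\<phi> c = ?\<phi> (\<lambda>b. \<Sum>b'\<in>B. y b' * basis_state b' b)" by (simp add: V_expand[OF yV])
          also have "\<dots> = (\<Sum>b\<in>B. y b * ?\<phi> (basis_state b))" by (rule linear_form_lincomb[OF \<phi>])
          also have "cmod \<dots> \<le> (\<Sum>b\<in>B. (M * h c) * cmod (?\<phi> (basis_state b)))"
          proof (rule order_trans[OF norm_sum], rule sum_mono)
            fix b
            have "cmod (y b) \<le> M * h c"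
              using rest[of c b] c by (simp add: y_def V_def sum_negf)
            then show "cmod (y b * ?\<phi> (basis_state b)) \<le> (M * h c) * cmod (?\<phi> (basis_state b))"
              by (simp add: norm_mult mult_right_mono)
          qed
          also have "\<dots> = M' * h c" unfolding M'_def sum_distrib_right by (intro sum.cong) auto
          finally show ?thesis .
        qed
        moreover have "M' \<ge> 0" unfolding M'_def using M by (intro sum_nonneg mult_nonneg_nonneg) auto
        ultimately show ?case by (intro bounded_growth_functional[OF \<phi> _ _ slice])
      next
        case (Suc m)
        have "bounded_growth (\<lambda>c. Out i (A_word w (A j c)))" for j
          using Suc.IH[of "w @ [j]"] Suc.prems by (simp add: A_word_append)
        then show ?case by (rule bounded_growth_lift)
      qed
      from this[of N "[]"] show ?thesis by simp
    qed
  qed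
qed

text \<open>
  The coefficients of \<open>c = P x\<close> are combinations of the outputs of finitely many shifts of \<open>c\<close>.
\<close>

lemma bounded_growth_coordinate:
  assumes Out: "\<And>l. l < k \<Longrightarrow> bounded_growth (Out l)" and i: "i < k"
  shows "bounded_growth (\<lambda>c. c (i, u))"
proof -
  have comb: "bounded_growth (\<lambda>c. \<phi> c + (\<Sum>l<k. t l * Out l c))" if \<phi>: "bounded_growth \<phi>" for \<phi> t
    unfolding bounded_growth_def
  proof
    fix c assume c: "c \<in> V"
    obtain K where K: "\<And>n Xs v. test Q n Xs v \<Longrightarrow> l2 {..<n} (path_sum A n \<phi> c Xs v) \<le> K"
      using \<phi> c unfolding bounded_growth_def by blast
    have "\<exists>K. \<forall>l<k. \<forall>n Xs v. test Q n Xs v \<longrightarrow> l2 {..<n} (path_sum A n (Out l) c Xs v) \<le> K l"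
      using Out c unfolding bounded_growth_def by (intro choice) blast
    then obtain L where L: "\<And>l n Xs v. l < k \<Longrightarrow> test Q n Xs v \<Longrightarrow> l2 {..<n} (path_sum A n (Out l) c Xs v) \<le> L l"
      by blast
    have split: "path_sum A n (\<lambda>c. \<phi> c + (\<Sum>l<k. t l * Out l c)) c Xs v =
      (\<lambda>a. path_sum A n \<phi> c Xs v a + (\<Sum>l<k. t l * path_sum A n (Out l) c Xs v a))" for n Xs v
    proof (induction Xs arbitrary: c v)
      case Nil show ?case by (simp add: distrib_right sum_distrib_right mult.assoc)
    next
      case (Cons X Xs)
      show ?case
        by (rule ext) (simp add: Cons sum.distrib sum_distrib_left sum.swap[of _ "{..<k}"])
    qed
    show "\<exists>K. \<forall>n Xs v. test Q n Xs v \<longrightarrow> l2 {..<n} (path_sum A n (\<lambda>c. \<phi> c + (\<Sum>l<k. t l * Out l c)) c Xs v) \<le> K"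
    proof (intro exI allI impI)
      fix n Xs v assume T: "test Q n Xs v"
      have "l2 {..<n} (path_sum A n (\<lambda>c. \<phi> c + (\<Sum>l<k. t l * Out l c)) c Xs v) \<le>
        l2 {..<n} (path_sum A n \<phi> c Xs v) + (\<Sum>l<k. l2 {..<n} (\<lambda>a. t l * path_sum A n (Out l) c Xs v a))"
        unfolding split by (rule order_trans[OF l2_triangle]) (intro add_left_mono l2_sum)
      also have "\<dots> \<le> K + (\<Sum>l<k. cmod (t l) * L l)"
        unfolding l2_mult by (intro add_mono sum_mono mult_left_mono K L T) auto
      finally show "l2 {..<n} (path_sum A n (\<lambda>c. \<phi> c + (\<Sum>l<k. t l * Out l c)) c Xs v) \<le> K + (\<Sum>l<k. cmod (t l) * L l)" .
    qed
  qed
  have zero: "bounded_growth (\<lambda>c. 0)"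
    unfolding bounded_growth_def
  proof (intro ballI exI allI impI)
    fix c n Xs v
    have "path_sum A n (\<lambda>c. 0) c Xs v = (\<lambda>a. 0)" by (induction Xs arbitrary: c v) simp_all
    then show "l2 {..<n} (path_sum A n (\<lambda>c. 0) c Xs v) \<le> 0" by (simp add: L2_set_def)
  qed
  show ?thesis
  proof (induction u rule: rev_induct)
    case Nil
    have "(\<Sum>l<k. pc i l [] * Out l c) = c (i, [])" for c
    proof -
      have "(\<Sum>l<k. pc i l [] * Out l c) = (\<Sum>m<k. (\<Sum>l<k. pc i l [] * pinv l m) * c (m, []))"
        unfolding Out_def sum_distrib_left sum_distrib_right by (subst sum.swap) (simp add: mult.assoc)
      also have "\<dots> = (\<Sum>m<k. if i = m then c (m, []) else 0)"
        by (intro sum.cong refl) (simp add: pinv i)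
      finally show ?thesis using i by simp
    qed
    then show ?case using comb[OF zero, of "\<lambda>l. pc i l []"] by simp
  next
    case (snoc j u)
    have "(\<lambda>c. c (i, u @ [j])) = (\<lambda>c. A j c (i, u) + (\<Sum>l<k. pc i l (u @ [j]) * Out l c))"
      using i by (simp add: A_def fun_eq_iff)
    with comb[OF bounded_growth_shift[OF snoc, of j], of "\<lambda>l. pc i l (u @ [j])"] show ?case by simp
  qed
qed

end

section \<open>The resolvent estimate\<close>

context nc_system begin

text \<open>
  \<open>M\<close> steps of the state recursion: the partial sum of \<open>P\<^sup>-\<^sup>1 c\<close> of degree less than \<open>M\<close>, and a
  remainder that is measured by coordinate functionals of the states reached after \<open>M\<close> steps.
\<close>

lemma iterated_recursion:
  assumes c: "c \<in> V" and i: "i < k"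
  shows "column_apply c {..<n} Y v i a =
    poly_apply k D pc {..<n} Y (\<lambda>l a. \<Sum>m<M. path_sum A n (Out l) c (replicate m Y) v a) i a +
    (\<Sum>u\<in>words D. word_apply {..<n} Y u (path_sum A n (\<lambda>c. c (i, u)) c (replicate M Y) v) a)"
  using c
proof (induction M arbitrary: c v)
  case 0
  show ?case by (simp add: column_apply_def word_apply_mult)
next
  case (Suc M)
  let ?w = "\<lambda>j. mat_apply {..<n} (Y j) v"
  let ?y = "\<lambda>j l a. \<Sum>m<M. path_sum A n (Out l) (A j c) (replicate m Y) (?w j) a"
  have "column_apply c {..<n} Y v i a = poly_apply k D pc {..<n} Y (\<lambda>l a. Out l c * v a) i a + (\<Sum>j\<in>UNIV. column_apply (A j c) {..<n} Y (?w j) i a)"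
    by (rule state_recursion[OF Suc.prems i])
  also have "(\<Sum>j\<in>UNIV. column_apply (A j c) {..<n} Y (?w j) i a) =
    (\<Sum>j\<in>UNIV. poly_apply k D pc {..<n} Y (?y j) i a) +
    (\<Sum>j\<in>UNIV. \<Sum>u\<in>words D. word_apply {..<n} Y u (path_sum A n (\<lambda>c. c (i, u)) (A j c) (replicate M Y) (?w j)) a)"
    by (simp only: Suc.IH[OF A_V[OF Suc.prems]] sum.distrib)
  also have "(\<Sum>j\<in>UNIV. \<Sum>u\<in>words D. word_apply {..<n} Y u (path_sum A n (\<lambda>c. c (i, u)) (A j c) (replicate M Y) (?w j)) a) =
    (\<Sum>u\<in>words D. word_apply {..<n} Y u (path_sum A n (\<lambda>c. c (i, u)) c (replicate (Suc M) Y) v) a)"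
    by (subst sum.swap) (simp add: word_apply_sum)
  also have "poly_apply k D pc {..<n} Y (\<lambda>l a. Out l c * v a) i a + ((\<Sum>j\<in>UNIV. poly_apply k D pc {..<n} Y (?y j) i a) + x) =
    poly_apply k D pc {..<n} Y (\<lambda>l a. \<Sum>m<Suc M. path_sum A n (Out l) c (replicate m Y) v a) i a + x" for x
  proof -
    have "(\<lambda>l a. \<Sum>m<Suc M. path_sum A n (Out l) c (replicate m Y) v a) = (\<lambda>l a. Out l c * v a + (\<Sum>j\<in>UNIV. ?y j l a))"
      unfolding sum.lessThan_Suc_shift by (simp add: sum.swap[of _ "{..<M}"])
    then show ?thesis by (simp add: poly_apply_add poly_apply_sum)
  qed
  finally show ?case .
qed

text \<open>
  Applying the truncated series of \<open>P\<^sup>-\<^sup>1\<close> to \<open>\<eta> = P(rX) \<xi>\<close> gives a vector of norm at most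
  \<open>(\<Sum>\<^sub>m r\<^sup>m) K \<parallel>\<eta>\<parallel>\<close>. It approximates \<open>\<xi>\<close>, since \<open>P(rX)\<close> is bounded below and the remainder is of
  order \<open>r\<^sup>M\<close>.
\<close>

theorem resolvent_bound:
  assumes growth: "\<And>l. l < k \<Longrightarrow> bounded_growth (Out l)"
  obtains K where "K \<ge> 0" "\<And>r n X \<xi>. 0 \<le> r \<Longrightarrow> r < 1 \<Longrightarrow> unit_tuple Q n X \<Longrightarrow> \<forall>l a. n \<le> a \<longrightarrow> \<xi> l a = 0 \<Longrightarrow>
    (1 - r) * block_norm k {..<n} \<xi> \<le> K * block_norm k {..<n} (poly_apply k D pc {..<n} (\<lambda>j a b. complex_of_real r * X j a b) \<xi>)"
proof -
  define E where "E i = basis_state (i, [])" for i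
  have EV: "E i \<in> V" if "i < k" for i unfolding E_def using that D by (intro basis_state_V) (simp add: B_def words_def)
  have "\<exists>K. \<forall>i l. i < k \<longrightarrow> l < k \<longrightarrow> (\<forall>n Xs v. test Q n Xs v \<longrightarrow> l2 {..<n} (path_sum A n (Out l) (E i) Xs v) \<le> K i l)"
    using growth EV unfolding bounded_growth_def by (intro choice) (intro allI choice, blast)
  then obtain K1 where K1: "\<And>i l n Xs v. i < k \<Longrightarrow> l < k \<Longrightarrow> test Q n Xs v \<Longrightarrow> l2 {..<n} (path_sum A n (Out l) (E i) Xs v) \<le> K1 i l"
    by blast
  have "\<exists>K. \<forall>b i. b \<in> B \<longrightarrow> i < k \<longrightarrow> (\<forall>n Xs v. test Q n Xs v \<longrightarrow> l2 {..<n} (path_sum A n (\<lambda>c. c b) (E i) Xs v) \<le> K b i)"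
  proof (intro choice allI)
    fix b i
    show "\<exists>K. b \<in> B \<longrightarrow> i < k \<longrightarrow> (\<forall>n Xs v. test Q n Xs v \<longrightarrow> l2 {..<n} (path_sum A n (\<lambda>c. c b) (E i) Xs v) \<le> K)"
    proof (cases b)
      case (Pair i' u)
      show ?thesis
        using bounded_growth_coordinate[OF growth, of i' u] EV unfolding bounded_growth_def Pair B_def by blast
    qed
  qed
  then obtain K2 where K2: "\<And>b i n Xs v. b \<in> B \<Longrightarrow> i < k \<Longrightarrow> test Q n Xs v \<Longrightarrow> l2 {..<n} (path_sum A n (\<lambda>c. c b) (E i) Xs v) \<le> K2 b i"
    by blast
  have scaled: "l2 {..<n} (path_sum A n \<phi> c Xs v) \<le> K * l2 {..<n} v"
    if K: "\<And>n Xs v. test Q n Xs v \<Longrightarrow> l2 {..<n} (path_sum A n \<phi> c Xs v) \<le> K"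
      and Xs: "\<forall>X\<in>set Xs. unit_tuple Q n X" and v: "\<forall>a\<ge>n. v a = 0" for \<phi> c Xs v K n
  proof (cases "l2 {..<n} v = 0")
    case True
    then have "v a = 0" for a using v by (cases "a < n") (auto simp: L2_set_eq_0_iff)
    then have "v = (\<lambda>a. 0)" by blast
    then show ?thesis by (simp add: path_sum_zero_vec L2_set_def)
  next
    case False
    define N where "N = l2 {..<n} v"
    have N: "N > 0" using False by (simp add: N_def less_le)
    have "test Q n Xs (\<lambda>a. complex_of_real (1 / N) * v a)"
      using Xs v l2_normalize[where n = n and w = v and M = N] N by (simp add: test_def N_def)
    from K[OF this] show ?thesis
      unfolding path_sum_mult_vec l2_mult using N by (simp add: norm_divide field_simps N_def)
  qed
  define K where "K = (\<Sum>i<k. \<Sum>l<k. \<bar>K1 i l\<bar>)"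
  have K0: "K \<ge> 0" by (simp add: K_def sum_nonneg)
  define R where "R = (\<Sum>i<k. \<Sum>i'<k. \<Sum>u\<in>words D. C ^ length u * \<bar>K2 (i', u) i\<bar>)"
  show ?thesis
  proof (rule that[OF K0])
    fix r :: real and n X and \<xi> :: "nat \<Rightarrow> nat \<Rightarrow> complex"
    assume r: "0 \<le> r" "r < 1" and X: "unit_tuple Q n X" and \<xi>: "\<forall>l a. n \<le> a \<longrightarrow> \<xi> l a = 0"
    let ?S = "{..<n}"
    define Y where "Y = (\<lambda>j a b. complex_of_real r * X j a b)"
    define \<eta> where "\<eta> = poly_apply k D pc ?S Y \<xi>"
    obtain \<rho> where \<rho>: "\<rho> < 1" "tuple_norm_le Q \<rho> ?S X" using X by (auto simp: unit_tuple_def)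
    have Y: "tuple_norm_le Q r ?S Y"
      using tuple_norm_le_scale[OF \<rho>(2), of "complex_of_real r"] mult_left_mono[of \<rho> 1 r] \<rho>(1) r
      unfolding Y_def by (simp add: tuple_norm_le_mono)
    obtain L where L: "L > 0" "\<And>S X \<xi>. tuple_norm_le Q r (S :: nat set) X \<Longrightarrow> block_norm k S \<xi> \<le> L * block_norm k S (poly_apply k D pc S X \<xi>)"
      using lower_bound[OF r] by blast
    have wop0: "word_apply ?S Y u w a = 0" if "n \<le> a" "\<forall>a\<ge>n. w a = 0" for u w a
      using that X by (cases u) (simp_all add: mat_apply_def Y_def unit_tuple_def)
    have \<eta>0: "\<forall>a\<ge>n. \<eta> i a = 0" for i
      unfolding \<eta>_def poly_apply_def using wop0 \<xi> by simp
    have l2\<eta>: "l2 ?S (\<eta> i) \<le> block_norm k ?S \<eta>" if "i < k" for i by (rule l2_le_block_norm[OF that])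
    have Xm: "\<forall>X'\<in>set (replicate m X). unit_tuple Q n X'" for m using X by simp
    have rep: "path_sum A n \<phi> c (replicate m Y) v = (\<lambda>a. complex_of_real r ^ m * path_sum A n \<phi> c (replicate m X) v a)" for \<phi> c m v
      using path_sum_scale[of A n \<phi> c "complex_of_real r" "replicate m X" v] by (simp add: Y_def)
    define y where "y M l a = (\<Sum>i<k. \<Sum>m<M. path_sum A n (Out l) (E i) (replicate m Y) (\<eta> i) a)" for M l a
    define z where "z M i' a = (\<Sum>i<k. \<Sum>u\<in>words D. word_apply ?S Y u (path_sum A n (\<lambda>c. c (i', u)) (E i) (replicate M Y) (\<eta> i)) a)" for M i' a
    have y_bound: "block_norm k ?S (y M) \<le> (K / (1 - r)) * block_norm k ?S \<eta>" for M
    proof -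
      have "block_norm k ?S (y M) \<le> (\<Sum>l<k. l2 ?S (y M l))" by (rule block_norm_le_sum)
      also have "\<dots> \<le> (\<Sum>l<k. \<Sum>i<k. \<Sum>m<M. r ^ m * (\<bar>K1 i l\<bar> * block_norm k ?S \<eta>))"
      proof (rule sum_mono)
        fix l assume l: "l \<in> {..<k}"
        have "l2 ?S (y M l) \<le> (\<Sum>i<k. \<Sum>m<M. l2 ?S (path_sum A n (Out l) (E i) (replicate m Y) (\<eta> i)))"
          unfolding y_def[abs_def] by (rule order_trans[OF l2_sum]) (intro sum_mono l2_sum)
        also have "\<dots> \<le> (\<Sum>i<k. \<Sum>m<M. r ^ m * (\<bar>K1 i l\<bar> * block_norm k ?S \<eta>))"
        proof (intro sum_mono)
          fix i m assume i: "i \<in> {..<k}"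
          have "l2 ?S (path_sum A n (Out l) (E i) (replicate m X) (\<eta> i)) \<le> K1 i l * l2 ?S (\<eta> i)"
            by (rule scaled[OF K1 Xm \<eta>0]) (use i l in auto)
          also have "\<dots> \<le> \<bar>K1 i l\<bar> * block_norm k ?S \<eta>" using i l2\<eta> by (intro mult_mono) auto
          finally show "l2 ?S (path_sum A n (Out l) (E i) (replicate m Y) (\<eta> i)) \<le> r ^ m * (\<bar>K1 i l\<bar> * block_norm k ?S \<eta>)"
            unfolding rep l2_mult using r by (simp add: norm_power mult_left_mono)
        qed
        finally show "l2 ?S (y M l) \<le> (\<Sum>i<k. \<Sum>m<M. r ^ m * (\<bar>K1 i l\<bar> * block_norm k ?S \<eta>))" .
      qed
      also have "\<dots> = (\<Sum>m<M. r ^ m) * (K * block_norm k ?S \<eta>)"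
        unfolding K_def sum_distrib_right[symmetric]
        by (subst sum.swap) (simp add: sum_distrib_left sum_distrib_right)
      also have "\<dots> \<le> (1 / (1 - r)) * (K * block_norm k ?S \<eta>)"
      proof (rule mult_right_mono)
        have "(\<Sum>m<M. r ^ m) = (1 - r ^ M) / (1 - r)" using r by (simp add: sum_gp_strict)
        also have "\<dots> \<le> 1 / (1 - r)" using r by (intro divide_right_mono) auto
        finally show "(\<Sum>m<M. r ^ m) \<le> 1 / (1 - r)" .
      qed (use K0 in simp)
      finally show ?thesis by simp
    qed
    have z_bound: "block_norm k ?S (z M) \<le> r ^ M * (R * block_norm k ?S \<eta>)" for M
    proof -
      have "block_norm k ?S (z M) \<le> (\<Sum>i'<k. l2 ?S (z M i'))" by (rule block_norm_le_sum)
      also have "\<dots> \<le> (\<Sum>i'<k. \<Sum>i<k. \<Sum>u\<in>words D. C ^ length u * (r ^ M * (\<bar>K2 (i', u) i\<bar> * block_norm k ?S \<eta>)))"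
      proof (rule sum_mono)
        fix i' assume i': "i' \<in> {..<k}"
        have "l2 ?S (z M i') \<le> (\<Sum>i<k. \<Sum>u\<in>words D. l2 ?S (word_apply ?S Y u (path_sum A n (\<lambda>c. c (i', u)) (E i) (replicate M Y) (\<eta> i))))"
          unfolding z_def[abs_def] by (rule order_trans[OF l2_sum]) (intro sum_mono l2_sum)
        also have "\<dots> \<le> (\<Sum>i<k. \<Sum>u\<in>words D. C ^ length u * (r ^ M * (\<bar>K2 (i', u) i\<bar> * block_norm k ?S \<eta>)))"
        proof (intro sum_mono)
          fix i u assume i: "i \<in> {..<k}" and u: "u \<in> (words D :: 'd list set)"
          have "l2 ?S (path_sum A n (\<lambda>c. c (i', u)) (E i) (replicate M X) (\<eta> i)) \<le> K2 (i', u) i * l2 ?S (\<eta> i)"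
            by (rule scaled[OF K2 Xm \<eta>0]) (use i i' u in \<open>auto simp: B_def\<close>)
          also have "\<dots> \<le> \<bar>K2 (i', u) i\<bar> * block_norm k ?S \<eta>" using i l2\<eta> by (intro mult_mono) auto
          finally have "l2 ?S (path_sum A n (\<lambda>c. c (i', u)) (E i) (replicate M Y) (\<eta> i)) \<le> r ^ M * (\<bar>K2 (i', u) i\<bar> * block_norm k ?S \<eta>)"
            unfolding rep l2_mult using r by (simp add: norm_power mult_left_mono)
          then have "C ^ length u * l2 ?S (path_sum A n (\<lambda>c. c (i', u)) (E i) (replicate M Y) (\<eta> i)) \<le> C ^ length u * (r ^ M * (\<bar>K2 (i', u) i\<bar> * block_norm k ?S \<eta>))"
            using C_pos by (intro mult_left_mono) auto
          with word_apply_le[OF Y, of u] r show "l2 ?S (word_apply ?S Y u (path_sum A n (\<lambda>c. c (i', u)) (E i) (replicate M Y) (\<eta> i))) \<le> C ^ length u * (r ^ M * (\<bar>K2 (i', u) i\<bar> * block_norm k ?S \<eta>))"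
            by (meson less_imp_le order_trans)
        qed
        finally show "l2 ?S (z M i') \<le> (\<Sum>i<k. \<Sum>u\<in>words D. C ^ length u * (r ^ M * (\<bar>K2 (i', u) i\<bar> * block_norm k ?S \<eta>)))" .
      qed
      also have "\<dots> = (\<Sum>i'<k. \<Sum>i<k. \<Sum>u\<in>words D. (C ^ length u * \<bar>K2 (i', u) i\<bar>) * (r ^ M * block_norm k ?S \<eta>))"
        by (simp add: mult_ac)
      also have "\<dots> = R * (r ^ M * block_norm k ?S \<eta>)"
        unfolding R_def sum_distrib_right[symmetric] by (subst sum.swap) simp
      finally show ?thesis by (simp add: mult_ac)
    qed
    have column_apply_E: "column_apply (E i) ?S Y v i' a = (if i' = i then v a else 0)" for i v i' a
    proof -
      have "column_apply (E i) ?S Y v i' a = (\<Sum>u\<in>(words D :: 'd list set). if u = [] then (if i' = i then v a else 0) else 0)"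
        unfolding column_apply_def by (intro sum.cong refl) (auto simp: E_def basis_state_def)
      also have "\<dots> = (if i' = i then v a else 0)" using D by (subst sum.delta[OF finite_words]) (auto simp: words_def)
      finally show ?thesis .
    qed
    have main: "\<eta> i' a = poly_apply k D pc ?S Y (y M) i' a + z M i' a" if "i' < k" for M i' a
    proof -
      have "\<eta> i' a = (\<Sum>i<k. column_apply (E i) ?S Y (\<eta> i) i' a)" using that by (simp add: column_apply_E)
      also have "\<dots> = (\<Sum>i<k. poly_apply k D pc ?S Y (\<lambda>l a. \<Sum>m<M. path_sum A n (Out l) (E i) (replicate m Y) (\<eta> i) a) i' a) + z M i' a"
        unfolding z_def sum.distrib[symmetric]
        by (intro sum.cong refl iterated_recursion EV that) auto
      also have "(\<Sum>i<k. poly_apply k D pc ?S Y (\<lambda>l a. \<Sum>m<M. path_sum A n (Out l) (E i) (replicate m Y) (\<eta> i) a) i' a) = poly_apply k D pc ?S Y (y M) i' a"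
        unfolding y_def[abs_def] poly_apply_sum ..
      finally show ?thesis .
    qed
    have "block_norm k ?S \<xi> \<le> (K / (1 - r)) * block_norm k ?S \<eta> + L * (r ^ M * (R * block_norm k ?S \<eta>))" for M
    proof -
      have "block_norm k ?S (\<lambda>l a. \<xi> l a + (-1) * y M l a) \<le> L * block_norm k ?S (poly_apply k D pc ?S Y (\<lambda>l a. \<xi> l a + (-1) * y M l a))"
        by (rule L(2)[OF Y])
      also have "block_norm k ?S (poly_apply k D pc ?S Y (\<lambda>l a. \<xi> l a + (-1) * y M l a)) = block_norm k ?S (z M)"
        unfolding poly_apply_add poly_apply_mult \<eta>_def[symmetric] by (rule block_norm_cong) (simp add: main[of _ _ M])
      also have "L * block_norm k ?S (z M) \<le> L * (r ^ M * (R * block_norm k ?S \<eta>))" using L(1) by (intro mult_left_mono z_bound) auto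
      finally have "block_norm k ?S (\<lambda>l a. \<xi> l a + (-1) * y M l a) \<le> L * (r ^ M * (R * block_norm k ?S \<eta>))" .
      moreover have "block_norm k ?S \<xi> \<le> block_norm k ?S (\<lambda>l a. \<xi> l a + (-1) * y M l a) + block_norm k ?S (y M)"
        using block_norm_triangle[of k ?S "\<lambda>l a. \<xi> l a + (-1) * y M l a" "y M"] by simp
      ultimately show ?thesis using y_bound[of M] by linarith
    qed
    moreover have "(\<lambda>M. (K / (1 - r)) * block_norm k ?S \<eta> + L * (r ^ M * (R * block_norm k ?S \<eta>))) \<longlonglongrightarrow> (K / (1 - r)) * block_norm k ?S \<eta> + L * (0 * (R * block_norm k ?S \<eta>))"
      by (intro tendsto_add tendsto_mult tendsto_const LIMSEQ_power_zero) (use r in simp)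
    ultimately have "block_norm k ?S \<xi> \<le> (K / (1 - r)) * block_norm k ?S \<eta>" by (intro LIMSEQ_le_const[where X = "\<lambda>M. (K / (1 - r)) * block_norm k ?S \<eta> + L * (r ^ M * (R * block_norm k ?S \<eta>))"]) auto
    then show "(1 - r) * block_norm k ?S \<xi> \<le> K * block_norm k ?S (poly_apply k D pc ?S (\<lambda>j a b. complex_of_real r * X j a b) \<xi>)"
      using r by (simp add: \<eta>_def Y_def field_simps)
  qed
qed

text \<open>
  Bernoulli's inequality \<open>1 - r\<^sup>m \<le> m (1 - r)\<close>, one word at a time.
\<close>

lemma dilation_difference:
  obtains K where "K \<ge> 0" "\<And>r n X \<xi>. 0 \<le> r \<Longrightarrow> r \<le> 1 \<Longrightarrow> unit_tuple Q n X \<Longrightarrow>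
    block_norm k {..<n} (\<lambda>i a. poly_apply k D pc {..<n} X \<xi> i a - poly_apply k D pc {..<n} (\<lambda>j a b. complex_of_real r * X j a b) \<xi> i a)
      \<le> K * (1 - r) * block_norm k {..<n} \<xi>"
proof -
  define K where "K = (\<Sum>i<k. \<Sum>l<k. \<Sum>u\<in>words D. cmod (pc i l u) * (real (length u) * C ^ length u))"
  have K0: "K \<ge> 0" unfolding K_def using C_pos by (intro sum_nonneg mult_nonneg_nonneg) auto
  have bern: "1 - r ^ m \<le> real m * (1 - r)" if "0 \<le> r" "r \<le> 1" for r :: real and m
    using Bernoulli_inequality[of "r - 1" m] that by (simp add: algebra_simps)
  show ?thesis
  proof (rule that[OF K0])
    fix r :: real and n X and \<xi> :: "nat \<Rightarrow> nat \<Rightarrow> complex" assume r: "0 \<le> r" "r \<le> 1" and X: "unit_tuple Q n X"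
    let ?S = "{..<n}"
    let ?Y = "\<lambda>j a b. complex_of_real r * X j a b"
    obtain \<rho> where \<rho>: "\<rho> < 1" "tuple_norm_le Q \<rho> ?S X" using X by (auto simp: unit_tuple_def)
    have wopY: "word_apply ?S ?Y u v = (\<lambda>a. complex_of_real r ^ length u * word_apply ?S X u v a)" for u v
    proof (induction u)
      case (Cons j u)
      show ?case unfolding word_apply_Cons Cons mat_apply_mult by (simp add: mat_apply_def sum_distrib_left mult_ac)
    qed simp
    have "block_norm k ?S (\<lambda>i a. poly_apply k D pc ?S X \<xi> i a - poly_apply k D pc ?S ?Y \<xi> i a) \<le>
      (\<Sum>i<k. l2 ?S (\<lambda>a. poly_apply k D pc ?S X \<xi> i a - poly_apply k D pc ?S ?Y \<xi> i a))" by (rule block_norm_le_sum)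
    also have "\<dots> \<le> (\<Sum>i<k. \<Sum>l<k. \<Sum>u\<in>words D. (cmod (pc i l u) * (real (length u) * C ^ length u)) * ((1 - r) * block_norm k ?S \<xi>))"
    proof (rule sum_mono)
      fix i
      have eq: "poly_apply k D pc ?S X \<xi> i a - poly_apply k D pc ?S ?Y \<xi> i a =
        (\<Sum>l<k. \<Sum>u\<in>words D. (pc i l u * (1 - complex_of_real r ^ length u)) * word_apply ?S X u (\<xi> l) a)" for a
        unfolding poly_apply_def wopY sum_subtractf[symmetric] by (simp add: algebra_simps)
      have "l2 ?S (\<lambda>a. poly_apply k D pc ?S X \<xi> i a - poly_apply k D pc ?S ?Y \<xi> i a) \<le>
        (\<Sum>l<k. \<Sum>u\<in>words D. l2 ?S (\<lambda>a. (pc i l u * (1 - complex_of_real r ^ length u)) * word_apply ?S X u (\<xi> l) a))"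
        unfolding eq by (rule order_trans[OF l2_sum]) (intro sum_mono l2_sum)
      also have "\<dots> \<le> (\<Sum>l<k. \<Sum>u\<in>words D. (cmod (pc i l u) * (real (length u) * C ^ length u)) * ((1 - r) * block_norm k ?S \<xi>))"
      proof (intro sum_mono)
        fix l u assume l: "l \<in> {..<k}"
        have "l2 ?S (word_apply ?S X u (\<xi> l)) \<le> C ^ length u * l2 ?S (\<xi> l)"
          using \<rho> by (intro word_apply_le[OF \<rho>(2)]) auto
        also have "\<dots> \<le> C ^ length u * block_norm k ?S \<xi>"
          using C_pos l by (intro mult_left_mono l2_le_block_norm) auto
        finally have 1: "l2 ?S (word_apply ?S X u (\<xi> l)) \<le> C ^ length u * block_norm k ?S \<xi>" .
        have "1 - complex_of_real r ^ length u = complex_of_real (1 - r ^ length u)" by simp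
        moreover have "r ^ length u \<le> 1" by (intro power_le_one r)
        ultimately have "cmod (1 - complex_of_real r ^ length u) = 1 - r ^ length u"
          by (simp only: norm_of_real)
        then have 2: "cmod (1 - complex_of_real r ^ length u) \<le> real (length u) * (1 - r)" using bern[OF r] by simp
        have "cmod (pc i l u) * (cmod (1 - complex_of_real r ^ length u) * l2 ?S (word_apply ?S X u (\<xi> l))) \<le>
          cmod (pc i l u) * ((real (length u) * (1 - r)) * (C ^ length u * block_norm k ?S \<xi>))"
          using r by (intro mult_left_mono mult_mono 1 2) auto
        then show "l2 ?S (\<lambda>a. (pc i l u * (1 - complex_of_real r ^ length u)) * word_apply ?S X u (\<xi> l) a) \<le>
          (cmod (pc i l u) * (real (length u) * C ^ length u)) * ((1 - r) * block_norm k ?S \<xi>)"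
          unfolding l2_mult unfolding norm_mult by (simp add: mult_ac)
      qed
      finally show "l2 ?S (\<lambda>a. poly_apply k D pc ?S X \<xi> i a - poly_apply k D pc ?S ?Y \<xi> i a) \<le>
        (\<Sum>l<k. \<Sum>u\<in>words D. (cmod (pc i l u) * (real (length u) * C ^ length u)) * ((1 - r) * block_norm k ?S \<xi>))" .
    qed
    also have "\<dots> = K * (1 - r) * block_norm k ?S \<xi>" unfolding K_def by (simp only: sum_distrib_right mult.assoc)
    finally show "block_norm k ?S (\<lambda>i a. poly_apply k D pc ?S X \<xi> i a - poly_apply k D pc ?S ?Y \<xi> i a) \<le> K * (1 - r) * block_norm k ?S \<xi>" .
  qed
qed

end

section \<open>The weak algorithm and factorization of submodules\<close>

abbreviation wcoeff :: "'d nc_poly \<Rightarrow> 'd list \<Rightarrow> complex" where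
  "wcoeff p w \<equiv> Poly_Mapping.lookup p (Word w)"

lemma nc_poly_eqI: "(\<And>w. wcoeff p w = wcoeff q w) \<Longrightarrow> p = q"
  by (rule poly_mapping_eqI) (metis word.collapse)

lemma wcoeff_mult: "wcoeff (p * q) w = (\<Sum>t\<le>length w. wcoeff p (take t w) * wcoeff q (drop t w))"
proof -
  let ?g = "\<lambda>l. Poly_Mapping.lookup p l * (\<Sum>x. Poly_Mapping.lookup q x when Word w = l + x)"
  let ?T = "(\<lambda>t. Word (take t w)) ` {..length w}"
  have inner: "(\<Sum>x. Poly_Mapping.lookup q x when Word w = Word (take t w) + x) = wcoeff q (drop t w)" for t
  proof -
    have "(Word w = Word (take t w) + x) = (x = Word (drop t w))" for x
    proof
      assume "Word w = Word (take t w) + x"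
      then have "w = take t w @ letters x" by (simp add: plus_word_def)
      then have "take t w @ drop t w = take t w @ letters x" by (metis append_take_drop_id)
      then have "letters x = drop t w" by (metis same_append_eq)
      then show "x = Word (drop t w)" by (metis word.collapse)
    qed (simp add: plus_word_def)
    then show ?thesis by simp
  qed
  have out: "?g l = 0" if "l \<notin> ?T" for l
  proof -
    have "Word w \<noteq> l + x" for x
    proof
      assume eq: "Word w = l + x"
      then have w: "w = letters l @ letters x" by (simp add: plus_word_def)
      then have "l = Word (take (length (letters l)) w)" by simp
      moreover have "length (letters l) \<le> length w" using w by simp
      ultimately show False using that by blast
    qed
    then show ?thesis by simp
  qed
  have "wcoeff (p * q) w = (\<Sum>l. ?g l)" by (simp add: lookup_mult)
  also have "\<dots> = (\<Sum>l\<in>?T. ?g l)" by (rule Sum_any.expand_superset) (use out in auto)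
  also have "\<dots> = (\<Sum>t\<le>length w. ?g (Word (take t w)))"
  proof (rule sum.reindex_cong[of "\<lambda>t. Word (take t w)"])
    show "inj_on (\<lambda>t. Word (take t w)) {..length w}"
      by (rule inj_onI) (metis atMost_iff length_take min.absorb2 word.inject)
  qed auto
  finally show ?thesis by (simp only: inner)
qed

lemma wcoeff_one: "wcoeff 1 w = (if w = [] then 1 else 0)"
  by (simp add: lookup_one zero_word_def when_def)

lemma wcoeff_sum: "wcoeff (sum f I) w = (\<Sum>i\<in>I. wcoeff (f i) w)"
  by (simp add: lookup_sum)

lemma finite_degree: "\<exists>d. \<forall>w. d \<le> length w \<longrightarrow> wcoeff p w = 0"
proof -
  have "finite (length ` letters ` Poly_Mapping.keys p)" by simp
  then obtain d where d: "\<forall>n\<in>length ` letters ` Poly_Mapping.keys p. n < d"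
    using finite_nat_set_iff_bounded by blast
  have "wcoeff p w = 0" if "d \<le> length w" for w
  proof (rule ccontr)
    assume "wcoeff p w \<noteq> 0"
    then have "Word w \<in> Poly_Mapping.keys p" by (simp add: in_keys_iff)
    then have "length w < d" using d by force
    with that show False by simp
  qed
  then show ?thesis by blast
qed

text \<open>
  One more than the largest degree occurring in \<open>A\<close>, and zero exactly when all polynomials in \<open>A\<close>
  vanish. This convention makes it a termination measure.
\<close>

definition strict_degree :: "'d nc_poly set \<Rightarrow> nat" where
  "strict_degree A = (LEAST d. \<forall>p\<in>A. \<forall>w. d \<le> length w \<longrightarrow> wcoeff p w = 0)"

lemma strict_degree_ex:
  fixes A :: "'d nc_poly set"
  assumes "finite A" shows "\<exists>d. \<forall>p\<in>A. \<forall>w. d \<le> length w \<longrightarrow> wcoeff p w = 0"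
proof -
  obtain d :: "'d nc_poly \<Rightarrow> nat" where d: "\<And>p w. d p \<le> length w \<Longrightarrow> wcoeff p w = 0" using finite_degree by metis
  have "wcoeff p w = 0" if "p \<in> A" "Max (insert 0 (d ` A)) \<le> length w" for p w
    using that assms by (intro d) (meson Max.coboundedI finite_imageI finite_insert imageI insertCI order_trans)
  then show ?thesis by blast
qed

lemma strict_degree_zero: "finite A \<Longrightarrow> p \<in> A \<Longrightarrow> strict_degree A \<le> length w \<Longrightarrow> wcoeff p w = 0"
  using LeastI_ex[OF strict_degree_ex[of A]] unfolding strict_degree_def by blast

lemma strict_degree_le: "(\<And>p w. p \<in> A \<Longrightarrow> d \<le> length w \<Longrightarrow> wcoeff p w = 0) \<Longrightarrow> strict_degree A \<le> d"
  unfolding strict_degree_def by (rule Least_le) blast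

lemma strict_degree_eq_0: assumes "finite A" shows "strict_degree A = 0 \<longleftrightarrow> (\<forall>p\<in>A. p = 0)"
proof
  assume 0: "strict_degree A = 0"
  show "\<forall>p\<in>A. p = 0"
  proof
    fix p assume "p \<in> A"
    then have "wcoeff p w = 0" for w using strict_degree_zero[OF assms, of p w] 0 by simp
    then show "p = 0" by (intro nc_poly_eqI) simp
  qed
next
  assume "\<forall>p\<in>A. p = 0"
  then have "strict_degree A \<le> 0" by (intro strict_degree_le) auto
  then show "strict_degree A = 0" by simp
qed

lemma strict_degree_attained:
  fixes A :: "'d nc_poly set"
  assumes "finite A" "strict_degree A = Suc d" shows "\<exists>p\<in>A. \<exists>w. length w = d \<and> wcoeff p w \<noteq> 0"
proof (rule ccontr)
  assume neg: "\<not> ?thesis"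
  have "strict_degree A \<le> d"
  proof (rule strict_degree_le)
    fix p and w :: "'d list" assume "p \<in> A" "d \<le> length w"
    then show "wcoeff p w = 0" using neg strict_degree_zero[OF assms(1), of p w] assms(2)
      by (cases "length w = d") auto
  qed
  with assms(2) show False by simp
qed

text \<open>
  The words of \<open>p\<close> that end in \<open>u\<close>, with this ending removed.
\<close>

definition right_quotient :: "'d list \<Rightarrow> 'd nc_poly \<Rightarrow> 'd nc_poly" where
  "right_quotient u p = Poly_Mapping.map_key (\<lambda>w. w + Word u) p"

lemma wcoeff_right_quotient: "wcoeff (right_quotient u p) w = wcoeff p (w @ u)"
proof -
  have "inj (\<lambda>w. w + Word u)"
    by (rule injI) (auto simp: plus_word_def intro: word.expand)
  then show ?thesis by (simp add: right_quotient_def map_key.rep_eq plus_word_def)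
qed

definition const_poly :: "complex \<Rightarrow> 'd nc_poly" where
  "const_poly t = Poly_Mapping.single 0 t"

lemma wcoeff_const_poly: "wcoeff (const_poly t) w = (if w = [] then t else 0)"
  by (auto simp: const_poly_def lookup_single zero_word_def when_def)

lemma wcoeff_mult_const_poly: "wcoeff (p * const_poly t) w = wcoeff p w * t"
proof -
  have "wcoeff (p * const_poly t) w = (\<Sum>s\<le>length w. if s = length w then wcoeff p w * t else 0)"
    unfolding wcoeff_mult by (intro sum.cong refl) (auto simp: wcoeff_const_poly)
  then show ?thesis by simp
qed

lemma mat_mult_entry:
  assumes "X \<in> carrier_mat m n" "Y \<in> carrier_mat n l" "a < m" "b < l"
  shows "(X * Y) $$ (a, b) = (\<Sum>i<n. X $$ (a, i) * Y $$ (i, b))"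
  using assms by (simp add: scalar_prod_def lessThan_atLeast0)

text \<open>
  The nonzero columns are right linearly independent. Zero columns are permitted, which
  avoids permuting columns during the reduction.
\<close>

definition independent_columns :: "nat \<Rightarrow> nat \<Rightarrow> 'd nc_poly mat \<Rightarrow> bool" where
  "independent_columns m n X \<longleftrightarrow> (\<forall>y. (\<forall>a<m. (\<Sum>i<n. X $$ (a, i) * y i) = 0) \<longrightarrow>
     (\<forall>i<n. (\<forall>a<m. X $$ (a, i) = 0) \<or> y i = 0))"

definition col_strict_degree :: "nat \<Rightarrow> 'd nc_poly mat \<Rightarrow> nat \<Rightarrow> nat" where
  "col_strict_degree m X i = strict_degree ((\<lambda>a. X $$ (a, i)) ` {..<m})"

lemma col_strict_degree_zero: "a < m \<Longrightarrow> col_strict_degree m X i \<le> length w \<Longrightarrow> wcoeff (X $$ (a, i)) w = 0"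
  unfolding col_strict_degree_def by (rule strict_degree_zero) auto

text \<open>
  Cohn's weak algorithm. In a relation \<open>\<Sum>\<^sub>i X\<^sub>i y\<^sub>i = 0\<close> between columns, let \<open>i0\<close> be an index for
  which the degree of \<open>X\<^sub>i y\<^sub>i\<close> is largest and, among these, the degree of \<open>X\<^sub>i\<close> is largest. Comparing
  the words that end in a fixed word \<open>u\<close> of top degree in \<open>y\<^sub>i\<^sub>0\<close> shows that \<open>\<Sum>\<^sub>i X\<^sub>i (y\<^sub>i / u)\<close> has smaller
  degree than \<open>X\<^sub>i\<^sub>0\<close>, while the coefficient \<open>y\<^sub>i\<^sub>0 / u\<close> is a nonzero constant.
\<close>

lemma weak_algorithm_step:
  assumes X: "X \<in> carrier_mat m n" and dep: "\<not> independent_columns m n X"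
  shows "\<exists>i0<n. \<exists>q. q i0 = 1 \<and> (\<exists>d < col_strict_degree m X i0. \<forall>a<m. \<forall>w. d \<le> length w \<longrightarrow> wcoeff (\<Sum>i<n. X $$ (a, i) * q i) w = 0)"
proof -
  obtain y i1 a1 where y: "\<And>a. a < m \<Longrightarrow> (\<Sum>i<n. X $$ (a, i) * y i) = 0"
    and i1: "i1 < n" "a1 < m" "X $$ (a1, i1) \<noteq> 0" "y i1 \<noteq> 0"
    using dep unfolding independent_columns_def by blast
  define d where "d i = col_strict_degree m X i" for i
  define e where "e i = strict_degree {y i}" for i
  define I where "I = {i. i < n \<and> d i > 0 \<and> e i > 0}"
  have finI: "finite I" by (simp add: I_def)
  have "d i1 > 0" using i1 unfolding d_def col_strict_degree_def by (auto simp: neq0_conv[symmetric] strict_degree_eq_0 simp del: neq0_conv)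
  moreover have "e i1 > 0" using i1 by (auto simp: e_def neq0_conv[symmetric] strict_degree_eq_0 simp del: neq0_conv)
  ultimately have "i1 \<in> I" using i1 by (simp add: I_def)
  \<comment> \<open>\<open>T\<close> exceeds the largest degree of a product \<open>X\<^sub>i y\<^sub>i\<close> by two, because both degrees are strict.\<close>
  define T where "T = Max ((\<lambda>i. d i + e i) ` I)"
  have T: "d i + e i \<le> T" if "i \<in> I" for i unfolding T_def using finI that by (intro Max_ge) auto
  define I' where "I' = {i \<in> I. d i + e i = T}"
  have "T \<in> (\<lambda>i. d i + e i) ` I" unfolding T_def using finI \<open>i1 \<in> I\<close> by (intro Max_in) auto
  then have I': "I' \<noteq> {}" "finite I'" using finI by (auto simp: I'_def)
  then have "Max (d ` I') \<in> d ` I'" by (intro Max_in) auto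
  then obtain i0 where i0: "i0 \<in> I'" "d i0 = Max (d ` I')" by auto
  have max: "d i \<le> d i0" if "i \<in> I'" for i unfolding i0(2) using I' that by (intro Max_ge) auto
  have i0I: "i0 < n" "d i0 > 0" "e i0 > 0" "d i0 + e i0 = T" using i0(1) by (auto simp: I'_def I_def)
  have "strict_degree {y i0} = Suc (e i0 - 1)" using i0I by (simp add: e_def)
  from strict_degree_attained[OF _ this] obtain u where "length u = e i0 - 1" and u2: "wcoeff (y i0) u \<noteq> 0" by auto
  then have u: "Suc (length u) = e i0" "wcoeff (y i0) u \<noteq> 0" using i0I by auto
  define q where "q i = (if i \<in> I then right_quotient u (y i) * const_poly (1 / wcoeff (y i0) u) else 0)" for i
  have "q i0 = 1"
  proof (rule nc_poly_eqI)
    fix w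
    have "wcoeff (y i0) (w @ u) = 0" if "w \<noteq> []"
    proof -
      have "length w > 0" using that by simp
      then have "strict_degree {y i0} \<le> length (w @ u)" using u unfolding e_def length_append by linarith
      then show ?thesis by (intro strict_degree_zero[of "{y i0}"]) auto
    qed
    then show "wcoeff (q i0) w = wcoeff 1 w"
      using i0 u by (auto simp: q_def I'_def wcoeff_mult_const_poly wcoeff_right_quotient wcoeff_one)
  qed
  moreover have "wcoeff (\<Sum>i<n. X $$ (a, i) * q i) w = 0" if a: "a < m" and w: "d i0 - 1 \<le> length w" for a w
  proof -
    let ?x = "\<lambda>i t. wcoeff (X $$ (a, i)) (take t (w @ u)) * wcoeff (y i) (drop t (w @ u))"
    \<comment> \<open>a cut inside \<open>u\<close> would need a factor of degree larger than the choice of \<open>i0\<close> permits\<close>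
    have rest: "?x i t = 0" if t: "length w < t" "t \<le> length (w @ u)" and i: "i < n" for i t
    proof (rule ccontr)
      assume nz: "?x i t \<noteq> 0"
      have len: "length (take t (w @ u)) = t" "length (drop t (w @ u)) = length w + length u - t" using t by auto
      have nz': "wcoeff (X $$ (a, i)) (take t (w @ u)) \<noteq> 0" "wcoeff (y i) (drop t (w @ u)) \<noteq> 0"
        using nz by (metis mult_zero_left, metis mult_zero_right)
      have "\<not> col_strict_degree m X i \<le> length (take t (w @ u))" using nz'(1) col_strict_degree_zero[OF a] by blast
      then have 1: "t < d i" unfolding len d_def by simp
      have "\<not> strict_degree {y i} \<le> length (drop t (w @ u))" using nz'(2) strict_degree_zero[of "{y i}" "y i"] by blast
      then have 2: "length w + length u - t < e i" unfolding len e_def by simp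
      have "i \<in> I" using 1 2 i by (simp add: I_def)
      then have sum: "d i + e i \<le> d i0 + e i0" using T i0I by simp
      have "d i + e i = T" using 1 2 sum w u(1) i0I t by simp
      then have "d i \<le> d i0" using max \<open>i \<in> I\<close> by (simp add: I'_def)
      then show False using 1 t w by simp
    qed
    have "0 = wcoeff (\<Sum>i<n. X $$ (a, i) * y i) (w @ u)" using y[OF a] by simp
    also have "\<dots> = (\<Sum>i<n. \<Sum>t\<le>length (w @ u). ?x i t)" by (simp only: wcoeff_sum wcoeff_mult)
    also have "\<dots> = (\<Sum>i<n. \<Sum>t\<le>length w. ?x i t)"
      by (intro sum.cong refl sum.mono_neutral_right) (use rest in \<open>auto simp: not_le\<close>)
    finally have zero: "(\<Sum>i<n. \<Sum>t\<le>length w. ?x i t) = 0" ..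
    have "wcoeff (X $$ (a, i) * q i) w = (1 / wcoeff (y i0) u) * (\<Sum>t\<le>length w. ?x i t)" if i: "i < n" for i
    proof (cases "i \<in> I")
      case True
      then show ?thesis
        by (simp add: q_def mult.assoc[symmetric] wcoeff_mult_const_poly) (simp add: wcoeff_mult wcoeff_right_quotient)
    next
      case False
      then have "X $$ (a, i) = 0 \<or> y i = 0" using i a
        by (auto simp: I_def d_def e_def col_strict_degree_def strict_degree_eq_0)
      with False show ?thesis by (auto simp: q_def)
    qed
    then have "wcoeff (\<Sum>i<n. X $$ (a, i) * q i) w = (1 / wcoeff (y i0) u) * (\<Sum>i<n. \<Sum>t\<le>length w. ?x i t)"
      by (simp add: wcoeff_sum sum_distrib_left)
    with zero show ?thesis by simp
  qed
  ultimately show ?thesis using i0I by (intro exI[of _ i0] conjI exI[of _ q] exI[of _ "d i0 - 1"]) (auto simp: d_def)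
qed

text \<open>
  Each dependency allows an elementary column operation that lowers the degree of one column and leaves
  the others unchanged, so the process stops at independent columns.
\<close>

lemma column_reduction:
  assumes "X \<in> carrier_mat m n"
  shows "\<exists>E\<in>carrier_mat n n. \<exists>E'\<in>carrier_mat n n. E * E' = 1\<^sub>m n \<and> E' * E = 1\<^sub>m n \<and> independent_columns m n (X * E)"
  using assms
proof (induction "\<Sum>i<n. col_strict_degree m X i" arbitrary: X rule: less_induct)
  case less
  show ?case
  proof (cases "independent_columns m n X")
    case True
    then show ?thesis using less.prems by (intro bexI[of _ "1\<^sub>m n"]) auto
  next
    case False
    then obtain i0 q d where i0: "i0 < n" "q i0 = 1" and d: "d < col_strict_degree m X i0"
      and q: "\<And>a w. a < m \<Longrightarrow> d \<le> length w \<Longrightarrow> wcoeff (\<Sum>i<n. X $$ (a, i) * q i) w = 0"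
      using weak_algorithm_step[OF less.prems] by blast
    define E where "E = mat n n (\<lambda>(a, b). if b = i0 then q a else if a = b then 1 else 0)"
    define E' where "E' = mat n n (\<lambda>(a, b). if b = i0 then (if a = i0 then 1 else - q a) else if a = b then 1 else 0)"
    have carr: "E \<in> carrier_mat n n" "E' \<in> carrier_mat n n" by (simp_all add: E_def E'_def)
    have elem: "(\<Sum>c<n. f c * (if b = i0 then g c else if c = b then 1 else 0)) = (if b = i0 then (\<Sum>c<n. f c * g c) else f b)"
      if "b < n" for b and f g :: "nat \<Rightarrow> 'a nc_poly"
    proof (cases "b = i0")
      case False
      then have "(\<Sum>c<n. f c * (if b = i0 then g c else if c = b then 1 else 0)) = (\<Sum>c<n. if c = b then f c else 0)"
        by (intro sum.cong refl) simp
      with that False show ?thesis by simp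
    qed simp
    have EE': "E * E' = 1\<^sub>m n"
    proof (rule eq_matI)
      fix a b assume ab: "a < dim_row (1\<^sub>m n :: 'a nc_poly mat)" "b < dim_col (1\<^sub>m n :: 'a nc_poly mat)"
      then have "(E * E') $$ (a, b) = (\<Sum>c<n. E $$ (a, c) * (if b = i0 then (if c = i0 then 1 else - q c) else if c = b then 1 else 0))"
        by (subst mat_mult_entry[OF carr]) (auto simp: E'_def)
      also have "\<dots> = (if b = i0 then (\<Sum>c<n. E $$ (a, c) * (if c = i0 then 1 else - q c)) else E $$ (a, b))"
        using ab by (intro elem) simp
      also have "(\<Sum>c<n. E $$ (a, c) * (if c = i0 then 1 else - q c)) = (if a = i0 then 1 else 0)"
      proof -
        have "(\<Sum>c<n. E $$ (a, c) * (if c = i0 then 1 else - q c)) = (\<Sum>c<n. (if c = i0 then q a else 0) + (if c = a then (if a = i0 then 0 else - q a) else 0))"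
          using ab i0 by (intro sum.cong refl) (auto simp: E_def)
        also have "\<dots> = (if a = i0 then 1 else 0)" using ab i0 by (simp add: sum.distrib)
        finally show ?thesis .
      qed
      finally show "(E * E') $$ (a, b) = 1\<^sub>m n $$ (a, b)" using ab i0 by (auto simp: E_def)
    qed (use carr in auto)
    have E'E: "E' * E = 1\<^sub>m n"
    proof (rule eq_matI)
      fix a b assume ab: "a < dim_row (1\<^sub>m n :: 'a nc_poly mat)" "b < dim_col (1\<^sub>m n :: 'a nc_poly mat)"
      then have "(E' * E) $$ (a, b) = (\<Sum>c<n. E' $$ (a, c) * (if b = i0 then q c else if c = b then 1 else 0))"
        by (subst mat_mult_entry[OF carr(2,1)]) (auto simp: E_def)
      also have "\<dots> = (if b = i0 then (\<Sum>c<n. E' $$ (a, c) * q c) else E' $$ (a, b))"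
        using ab by (intro elem) simp
      also have "(\<Sum>c<n. E' $$ (a, c) * q c) = (if a = i0 then 1 else 0)"
      proof -
        have "(\<Sum>c<n. E' $$ (a, c) * q c) = (\<Sum>c<n. (if c = i0 then (if a = i0 then 1 else - q a) else 0) + (if c = a then (if a = i0 then 0 else q a) else 0))"
          using ab i0 by (intro sum.cong refl) (auto simp: E'_def)
        also have "\<dots> = (if a = i0 then 1 else 0)" using ab i0 by (simp add: sum.distrib)
        finally show ?thesis .
      qed
      finally show "(E' * E) $$ (a, b) = 1\<^sub>m n $$ (a, b)" using ab i0 by (auto simp: E'_def)
    qed (use carr in auto)
    have XE: "X * E \<in> carrier_mat m n" using less.prems carr by simp
    have entry: "(X * E) $$ (a, b) = (if b = i0 then (\<Sum>c<n. X $$ (a, c) * q c) else X $$ (a, b))" if "a < m" "b < n" for a b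
      using that elem[of b "\<lambda>c. X $$ (a, c)" q] by (subst mat_mult_entry[OF less.prems carr(1)]) (auto simp: E_def)
    have "(\<Sum>i<n. col_strict_degree m (X * E) i) < (\<Sum>i<n. col_strict_degree m X i)"
    proof (rule sum_strict_mono_ex1)
      have same: "col_strict_degree m (X * E) i = col_strict_degree m X i" if "i < n" "i \<noteq> i0" for i
        unfolding col_strict_degree_def using that entry by (intro arg_cong[of _ _ strict_degree] image_cong) auto
      have less0: "col_strict_degree m (X * E) i0 < col_strict_degree m X i0"
      proof -
        have "col_strict_degree m (X * E) i0 \<le> d" unfolding col_strict_degree_def
          by (rule strict_degree_le) (use entry i0 q in auto)
        with d show ?thesis by simp
      qed
      show "\<forall>i\<in>{..<n}. col_strict_degree m (X * E) i \<le> col_strict_degree m X i" using same less0 by (metis lessThan_iff less_imp_le order_refl)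
      show "\<exists>i\<in>{..<n}. col_strict_degree m (X * E) i < col_strict_degree m X i" using less0 i0 by blast
    qed simp
    from less.hyps[OF this XE] obtain E2 E2' where E2: "E2 \<in> carrier_mat n n" "E2' \<in> carrier_mat n n"
      "E2 * E2' = 1\<^sub>m n" "E2' * E2 = 1\<^sub>m n" "independent_columns m n (X * E * E2)" by blast
    note assoc = assoc_mult_mat[where ?n\<^sub>1 = n and ?n\<^sub>2 = n and ?n\<^sub>3 = n and ?n\<^sub>4 = n]
    have "E * E2 * (E2' * E') = E * (E2 * (E2' * E'))" using carr E2 by (intro assoc) auto
    also have "E2 * (E2' * E') = E2 * E2' * E'" using carr E2 by (intro assoc[symmetric]) auto
    finally have 1: "E * E2 * (E2' * E') = 1\<^sub>m n" using carr E2 EE' by simp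
    have "E2' * E' * (E * E2) = E2' * (E' * (E * E2))" using carr E2 by (intro assoc) auto
    also have "E' * (E * E2) = E' * E * E2" using carr E2 by (intro assoc[symmetric]) auto
    finally have 2: "E2' * E' * (E * E2) = 1\<^sub>m n" using carr E2 E'E by simp
    have "X * (E * E2) = X * E * E2" using less.prems carr E2 by simp
    then show ?thesis using 1 2 carr E2
      by (intro bexI[of _ "E * E2"] bexI[of _ "E2' * E'"]) auto
  qed
qed

text \<open>
  The identity matrix of size \<open>k\<close> does not factor through a smaller space.
\<close>

lemma rank_le_card:
  fixes a :: "nat \<Rightarrow> 'i \<Rightarrow> complex"
  assumes "finite S" and prod: "\<And>p q. p < k \<Longrightarrow> q < k \<Longrightarrow> (\<Sum>i\<in>S. a p i * b i q) = (if p = q then 1 else 0)"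
  shows "k \<le> card S"
proof (rule ccontr)
  assume "\<not> k \<le> card S"
  define s where "s = card S"
  have s: "s < k" using \<open>\<not> k \<le> card S\<close> by (simp add: s_def)
  obtain e where e: "bij_betw e {0..<s} S" using ex_bij_betw_nat_finite[OF \<open>finite S\<close>] unfolding s_def by blast
  define M where "M = mat k k (\<lambda>(p, i). if i < s then a p (e i) else 0)"
  define N where "N = mat k k (\<lambda>(i, q). if i < s then b (e i) q else 0)"
  have MN: "M \<in> carrier_mat k k" "N \<in> carrier_mat k k" by (simp_all add: M_def N_def)
  have "M * N = 1\<^sub>m k"
  proof (rule eq_matI)
    fix p q assume pq: "p < dim_row (1\<^sub>m k :: complex mat)" "q < dim_col (1\<^sub>m k :: complex mat)"
    then have "(M * N) $$ (p, q) = (\<Sum>i<k. M $$ (p, i) * N $$ (i, q))" by (simp add: scalar_prod_def M_def N_def lessThan_atLeast0)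
    also have "\<dots> = (\<Sum>i\<in>{0..<s}. a p (e i) * b (e i) q)"
      using pq s by (intro sum.mono_neutral_cong_right) (auto simp: M_def N_def)
    also have "\<dots> = (\<Sum>i\<in>S. a p i * b i q)" by (rule sum.reindex_bij_betw[OF e])
    finally show "(M * N) $$ (p, q) = 1\<^sub>m k $$ (p, q)" using pq prod by simp
  qed (use MN in auto)
  then have "N * M = 1\<^sub>m k" using mat_mult_left_right_inverse[OF MN] by blast
  then have "(N * M) $$ (s, s) = 1" using s by simp
  moreover have "(N * M) $$ (s, s) = (\<Sum>i<k. N $$ (s, i) * M $$ (i, s))"
    using s by (simp add: scalar_prod_def M_def N_def lessThan_atLeast0)
  moreover have "\<dots> = 0" using s by (intro sum.neutral) (auto simp: M_def)
  ultimately show False by simp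
qed

lemma wcoeff_mult_Nil: "wcoeff (p * q) [] = wcoeff p [] * wcoeff q []"
  by (simp add: wcoeff_mult)

text \<open>
  The columns of \<open>Vm\<close> and \<open>P\<close> generate a right submodule of the free module of rank \<open>k\<close>. After
  column reduction of the row of blocks \<open>[Vm, P]\<close> the nonzero columns \<open>F\<close> form a basis of it. Their number is
  determined at the constant terms: it is at least \<open>k\<close> because \<open>P\<close> is invertible there, and at most \<open>k\<close>
  because the relations express \<open>t\<close> independent vectors annihilated by \<open>[Vm, P]\<close>.
\<close>

lemma submodule_factorization:
  fixes P Vm :: "'d nc_poly mat"
  assumes P: "P \<in> carrier_mat k k" and Vm: "Vm \<in> carrier_mat k t"
    and rel: "\<And>a l. a < k \<Longrightarrow> l < t \<Longrightarrow> Vm $$ (a, l) = (\<Sum>i<k. P $$ (a, i) * Co i l) + (\<Sum>m<t. Vm $$ (a, m) * N m l)"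
    and N0: "\<And>m l. wcoeff (N m l) [] = 0"
    and pinv: "\<And>i m. i < k \<Longrightarrow> m < k \<Longrightarrow> (\<Sum>l<k. wcoeff (P $$ (i, l)) [] * pinv l m) = (if i = m then 1 else 0)"
  obtains F G H a b where "F \<in> carrier_mat k k" "G \<in> carrier_mat k k" "H \<in> carrier_mat k t"
    "a \<in> carrier_mat t k" "b \<in> carrier_mat k k" "P = F * G" "Vm = F * H" "F = Vm * a + P * b"
proof -
  define X where "X = mat k (t + k) (\<lambda>(a, i). if i < t then Vm $$ (a, i) else P $$ (a, i - t))"
  have X: "X \<in> carrier_mat k (t + k)" by (simp add: X_def)
  have X_sum: "(\<Sum>c<t+k. X $$ (a, c) * f c) = (\<Sum>c<t. Vm $$ (a, c) * f c) + (\<Sum>c<k. P $$ (a, c) * f (t + c))"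
    if "a < k" for a f
  proof -
    have "(\<Sum>c<t+k. X $$ (a, c) * f c) = (\<Sum>c<t. X $$ (a, c) * f c) + (\<Sum>c\<in>{t..<t+k}. X $$ (a, c) * f c)"
      using sum.union_disjoint[of "{..<t}" "{t..<t+k}" "\<lambda>c. X $$ (a, c) * f c"]
      by (simp add: ivl_disj_un_one(2) ivl_disj_int_one(2))
    also have "(\<Sum>c\<in>{t..<t+k}. X $$ (a, c) * f c) = (\<Sum>c<k. X $$ (a, t + c) * f (t + c))"
      using sum.shift_bounds_nat_ivl[of "\<lambda>c. X $$ (a, c) * f c" 0 t k] by (simp add: lessThan_atLeast0 add.commute)
    finally show ?thesis using that by (simp add: X_def)
  qed
  obtain E E' where E: "E \<in> carrier_mat (t+k) (t+k)" "E' \<in> carrier_mat (t+k) (t+k)"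
    "E * E' = 1\<^sub>m (t+k)" "E' * E = 1\<^sub>m (t+k)" and indep: "independent_columns k (t+k) (X * E)"
    using column_reduction[OF X] by blast
  define Z where "Z = X * E"
  have Z: "Z \<in> carrier_mat k (t+k)" using X E by (simp add: Z_def)
  have ZE': "Z * E' = X" unfolding Z_def using assoc_mult_mat[OF X E(1,2)] E(3) X by simp
  define S where "S = {i. i < t + k \<and> (\<exists>a<k. Z $$ (a, i) \<noteq> 0)}"
  have finS: "finite S" "S \<subseteq> {..<t+k}" by (auto simp: S_def)
  have X_entry: "X $$ (a, c) = (\<Sum>i\<in>S. Z $$ (a, i) * E' $$ (i, c))" if "a < k" "c < t + k" for a c
  proof -
    have "X $$ (a, c) = (\<Sum>i<t+k. Z $$ (a, i) * E' $$ (i, c))"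
      using mat_mult_entry[OF Z E(2) that] ZE' by simp
    also have "\<dots> = (\<Sum>i\<in>S. Z $$ (a, i) * E' $$ (i, c))"
      using that by (intro sum.mono_neutral_right) (auto simp: S_def)
    finally show ?thesis .
  qed
  \<comment> \<open>the constant term of \<open>P\<close> factors through the nonzero columns\<close>
  have "k \<le> card S"
  proof (rule rank_le_card[OF finS(1)])
    fix p q assume pq: "p < k" "q < k"
    have P_entry: "wcoeff (P $$ (p, l)) [] = (\<Sum>i\<in>S. wcoeff (Z $$ (p, i)) [] * wcoeff (E' $$ (i, t + l)) [])" if "l < k" for l
      using X_entry[OF pq(1), of "t + l"] that pq by (simp add: X_def wcoeff_sum wcoeff_mult_Nil)
    have "(if p = q then 1 else 0) = (\<Sum>l<k. wcoeff (P $$ (p, l)) [] * pinv l q)" using pinv[OF pq] by simp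
    also have "\<dots> = (\<Sum>l<k. \<Sum>i\<in>S. wcoeff (Z $$ (p, i)) [] * (wcoeff (E' $$ (i, t + l)) [] * pinv l q))"
      by (intro sum.cong refl) (simp add: P_entry sum_distrib_right mult.assoc)
    also have "\<dots> = (\<Sum>i\<in>S. wcoeff (Z $$ (p, i)) [] * (\<Sum>l<k. wcoeff (E' $$ (i, t + l)) [] * pinv l q))"
      by (subst sum.swap) (simp add: sum_distrib_left)
    finally show "(\<Sum>i\<in>S. wcoeff (Z $$ (p, i)) [] * (\<Sum>l<k. wcoeff (E' $$ (i, t + l)) [] * pinv l q)) = (if p = q then 1 else 0)" ..
  qed
  \<comment> \<open>the relations \<open>Y\<close> are supported, after the base change, away from the independent columns,
    and their constant terms contain an identity matrix of size \<open>t\<close>\<close>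
  moreover have "t \<le> card ({..<t+k} - S)"
  proof (rule rank_le_card)
    fix c l assume cl: "c < t" "l < t"
    define Y where "Y c = (if c < t then (if c = l then 1 else 0) - N c l else - Co (c - t) l)" for c
    define y where "y i = (\<Sum>c<t+k. E' $$ (i, c) * Y c)" for i
    have swap: "(\<Sum>i<t+k. M $$ (r, i) * y i) = (\<Sum>c<t+k. (M * E') $$ (r, c) * Y c)"
      if "M \<in> carrier_mat m (t+k)" "r < m" for M m r
    proof -
      have "(\<Sum>i<t+k. M $$ (r, i) * y i) = (\<Sum>i<t+k. \<Sum>c<t+k. M $$ (r, i) * E' $$ (i, c) * Y c)"
        by (simp add: y_def sum_distrib_left mult.assoc)
      also have "\<dots> = (\<Sum>c<t+k. (\<Sum>i<t+k. M $$ (r, i) * E' $$ (i, c)) * Y c)"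
        by (subst sum.swap) (simp add: sum_distrib_right)
      also have "\<dots> = (\<Sum>c<t+k. (M * E') $$ (r, c) * Y c)"
        by (intro sum.cong refl) (simp add: mat_mult_entry[OF that(1) E(2) that(2)])
      finally show ?thesis .
    qed
    have "(\<Sum>i<t+k. Z $$ (a, i) * y i) = 0" if "a < k" for a
    proof -
      have "(\<Sum>i<t+k. Z $$ (a, i) * y i) = (\<Sum>c<t. Vm $$ (a, c) * Y c) + (\<Sum>c<k. P $$ (a, c) * Y (t + c))"
        unfolding swap[OF Z that] ZE' by (rule X_sum[OF that])
      also have "(\<Sum>c<t. Vm $$ (a, c) * Y c) = Vm $$ (a, l) - (\<Sum>c<t. Vm $$ (a, c) * N c l)"
      proof -
        have "(\<Sum>c<t. Vm $$ (a, c) * Y c) = (\<Sum>c<t. (if c = l then Vm $$ (a, c) else 0) - Vm $$ (a, c) * N c l)"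
          by (intro sum.cong refl) (auto simp: Y_def right_diff_distrib)
        then show ?thesis using cl by (simp add: sum_subtractf)
      qed
      also have "(\<Sum>c<k. P $$ (a, c) * Y (t + c)) = - (\<Sum>c<k. P $$ (a, c) * Co c l)"
        by (simp add: Y_def sum_negf)
      finally show ?thesis using rel[OF that cl(2)] by simp
    qed
    then have y0: "y i = 0" if "i \<in> S" for i
      using indep that unfolding independent_columns_def Z_def[symmetric] S_def by blast
    have "Y c = (\<Sum>c'<t+k. (E * E') $$ (c, c') * Y c')"
    proof -
      have "(\<Sum>c'<t+k. (E * E') $$ (c, c') * Y c') = (\<Sum>c'<t+k. if c' = c then Y c else 0)"
        unfolding E(3) using cl by (intro sum.cong refl) auto
      then show ?thesis using cl by simp
    qed
    also have "\<dots> = (\<Sum>i<t+k. E $$ (c, i) * y i)" using swap[OF E(1), of c] cl by simp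
    also have "\<dots> = (\<Sum>i\<in>{..<t+k} - S. E $$ (c, i) * y i)"
      by (intro sum.mono_neutral_right) (auto simp: y0)
    finally have "wcoeff (Y c) [] = (\<Sum>i\<in>{..<t+k} - S. wcoeff (E $$ (c, i)) [] * wcoeff (y i) [])"
      by (simp add: wcoeff_sum wcoeff_mult_Nil)
    moreover have "wcoeff (Y c) [] = (if c = l then 1 else 0)"
      using cl N0 by (simp add: Y_def lookup_minus wcoeff_one)
    moreover have "wcoeff (y i) [] = (\<Sum>c<t+k. wcoeff (E' $$ (i, c)) [] * (if c < t then (if c = l then 1 else 0) else - wcoeff (Co (c - t) l) []))" for i
      unfolding y_def wcoeff_sum wcoeff_mult_Nil by (intro sum.cong refl) (auto simp: Y_def lookup_minus wcoeff_one N0)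
    ultimately show "(\<Sum>i\<in>{..<t+k} - S. wcoeff (E $$ (c, i)) [] * (\<Sum>c<t+k. wcoeff (E' $$ (i, c)) [] * (if c < t then (if c = l then 1 else 0) else - wcoeff (Co (c - t) l) []))) = (if c = l then 1 else 0)"
      by simp
  qed simp
  then have "t \<le> t + k - card S" using card_Diff_subset[OF finS] by simp
  moreover have "card S \<le> t + k" using card_mono[OF _ finS(2)] by simp
  ultimately have cS: "card S = k" by linarith
  then obtain \<sigma> where \<sigma>: "bij_betw \<sigma> {..<k} S"
    using ex_bij_betw_nat_finite[OF finS(1)] by (auto simp: lessThan_atLeast0)
  have \<sigma>lt: "\<sigma> b < t + k" if "b < k" for b using \<sigma> that finS(2) by (auto simp: bij_betw_def)
  define F where "F = mat k k (\<lambda>(a, b). Z $$ (a, \<sigma> b))"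
  define G where "G = mat k k (\<lambda>(b, c). E' $$ (\<sigma> b, t + c))"
  define H where "H = mat k t (\<lambda>(b, c). E' $$ (\<sigma> b, c))"
  define a where "a = mat t k (\<lambda>(c, b). E $$ (c, \<sigma> b))"
  define b where "b = mat k k (\<lambda>(c, b). E $$ (t + c, \<sigma> b))"
  have carr: "F \<in> carrier_mat k k" "G \<in> carrier_mat k k" "H \<in> carrier_mat k t" "a \<in> carrier_mat t k" "b \<in> carrier_mat k k"
    by (simp_all add: F_def G_def H_def a_def b_def)
  have reindex: "X $$ (p, c) = (\<Sum>b<k. Z $$ (p, \<sigma> b) * E' $$ (\<sigma> b, c))" if "p < k" "c < t + k" for p c
    unfolding X_entry[OF that] by (rule sum.reindex_bij_betw[OF \<sigma>, symmetric])
  have "P = F * G"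
  proof (rule eq_matI)
    fix p c assume "p < dim_row (F * G)" "c < dim_col (F * G)"
    then have pc: "p < k" "c < k" using carr by auto
    show "P $$ (p, c) = (F * G) $$ (p, c)"
      unfolding mat_mult_entry[OF carr(1,2) pc] using reindex[of p "t + c"] pc by (simp add: X_def F_def G_def)
  qed (use P carr in auto)
  moreover have "Vm = F * H"
  proof (rule eq_matI)
    fix p c assume "p < dim_row (F * H)" "c < dim_col (F * H)"
    then have pc: "p < k" "c < t" using carr by auto
    show "Vm $$ (p, c) = (F * H) $$ (p, c)"
      unfolding mat_mult_entry[OF carr(1,3) pc] using reindex[of p c] pc by (simp add: X_def F_def H_def)
  qed (use Vm carr in auto)
  moreover have "F = Vm * a + P * b"
  proof (rule eq_matI)
    fix p c assume "p < dim_row (Vm * a + P * b)" "c < dim_col (Vm * a + P * b)"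
    then have pc: "p < k" "c < k" using carr P by auto
    have "F $$ (p, c) = (\<Sum>i<t+k. X $$ (p, i) * E $$ (i, \<sigma> c))"
      using pc \<sigma>lt by (simp add: F_def Z_def mat_mult_entry[OF X E(1)] del: index_mult_mat)
    also have "\<dots> = (\<Sum>i<t. Vm $$ (p, i) * a $$ (i, c)) + (\<Sum>i<k. P $$ (p, i) * b $$ (i, c))"
      unfolding X_sum[OF pc(1)] using pc by (simp add: a_def b_def)
    also have "\<dots> = (Vm * a + P * b) $$ (p, c)"
      using pc carr P Vm by (simp add: mat_mult_entry[OF Vm carr(4) pc] mat_mult_entry[OF P carr(5) pc] del: index_mult_mat(1))
    finally show "F $$ (p, c) = (Vm * a + P * b) $$ (p, c)" .
  qed (use P Vm carr in auto)
  ultimately show ?thesis using that carr by blast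
qed

section \<open>Atoms and invariant subspaces of states\<close>

context nc_system begin

context
  fixes P :: "'d nc_poly mat"
  assumes P: "P \<in> carrier_mat k k" and atom: "nc_atom k P"
    and pc: "\<And>i l u. i < k \<Longrightarrow> l < k \<Longrightarrow> pc i l u = wcoeff (P $$ (i, l)) u"
    and pinv': "\<And>i m. i < k \<Longrightarrow> m < k \<Longrightarrow> (\<Sum>l<k. pinv i l * pc l m []) = (if i = m then 1 else 0)"
begin

definition poly_state :: "(nat \<Rightarrow> 'd nc_poly) \<Rightarrow> nat \<times> 'd list \<Rightarrow> complex" where
  "poly_state q = (\<lambda>(i, u). if i < k then wcoeff (q i) u else 0)"

definition column_poly :: "(nat \<times> 'd list \<Rightarrow> complex) \<Rightarrow> nat \<Rightarrow> 'd nc_poly" where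
  "column_poly c i = (\<Sum>u\<in>words D. Poly_Mapping.single (Word u) (c (i, u)))"

lemma wcoeff_column_poly: "c \<in> V \<Longrightarrow> wcoeff (column_poly c i) u = c (i, u)"
proof -
  assume c: "c \<in> V"
  have "wcoeff (column_poly c i) u = (\<Sum>w\<in>words D. if w = u then c (i, u) else 0)"
    unfolding column_poly_def wcoeff_sum by (intro sum.cong refl) (auto simp: lookup_single when_def)
  also have "\<dots> = (if u \<in> words D then c (i, u) else 0)" by (simp add: sum.delta[OF finite_words])
  finally show ?thesis using c by (auto simp: V_def B_def)
qed

lemma poly_state_column_poly: "c \<in> V \<Longrightarrow> poly_state (column_poly c) = c"
  by (auto simp: poly_state_def wcoeff_column_poly fun_eq_iff) (auto simp: V_def B_def)

lemma poly_state_cong: "(\<And>i. i < k \<Longrightarrow> q i = q' i) \<Longrightarrow> poly_state q = poly_state q'"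
  by (auto simp: poly_state_def fun_eq_iff)

lemma poly_state_add: "poly_state (\<lambda>i. q i + q' i) = (\<lambda>b. poly_state q b + poly_state q' b)"
  and poly_state_zero: "poly_state (\<lambda>i. 0) = (\<lambda>b. 0)"
  by (auto simp: poly_state_def fun_eq_iff lookup_add)

lemma poly_state_sum: "poly_state (\<lambda>i. \<Sum>l\<in>I. q l i) = (\<lambda>b. \<Sum>l\<in>I. poly_state (q l) b)"
  by (auto simp: poly_state_def fun_eq_iff wcoeff_sum)

definition P_times :: "(nat \<Rightarrow> 'd nc_poly) \<Rightarrow> nat \<Rightarrow> 'd nc_poly" where
  "P_times h x = (\<Sum>i<k. P $$ (x, i) * h i)"

lemma wcoeff_mult_snoc: "wcoeff (p * q) (u @ [j]) = wcoeff (p * right_quotient [j] q) u + wcoeff p (u @ [j]) * wcoeff q []"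
proof -
  have "wcoeff (p * q) (u @ [j]) = (\<Sum>t\<le>length u. wcoeff p (take t (u @ [j])) * wcoeff q (drop t (u @ [j]))) + wcoeff p (u @ [j]) * wcoeff q []"
    by (simp add: wcoeff_mult)
  also have "(\<Sum>t\<le>length u. wcoeff p (take t (u @ [j])) * wcoeff q (drop t (u @ [j]))) = wcoeff (p * right_quotient [j] q) u"
    unfolding wcoeff_mult wcoeff_right_quotient by (intro sum.cong refl) auto
  finally show ?thesis .
qed

lemma Out_P_times: "i < k \<Longrightarrow> Out i (poly_state (P_times h)) = wcoeff (h i) []"
proof -
  assume i: "i < k"
  have "Out i (poly_state (P_times h)) = (\<Sum>l<k. \<Sum>m<k. pinv i l * pc l m [] * wcoeff (h m) [])"
    by (simp add: Out_def poly_state_def P_times_def wcoeff_sum wcoeff_mult_Nil sum_distrib_left mult.assoc pc)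
  also have "\<dots> = (\<Sum>m<k. (\<Sum>l<k. pinv i l * pc l m []) * wcoeff (h m) [])"
    by (subst sum.swap) (simp add: sum_distrib_right)
  also have "\<dots> = (\<Sum>m<k. if i = m then wcoeff (h m) [] else 0)"
    by (intro sum.cong refl) (simp add: pinv' i)
  finally show ?thesis using i by simp
qed

text \<open>
  On a state of the form \<open>P h\<close> the shift acts on the polynomial column \<open>h = P\<^sup>-\<^sup>1 (P h)\<close> itself.
\<close>

lemma A_P_times: "A j (poly_state (P_times h)) = poly_state (P_times (\<lambda>i. right_quotient [j] (h i)))"
proof
  fix b :: "nat \<times> 'd list"
  obtain i u where b: "b = (i, u)" by force
  have "A j (poly_state (P_times h)) (i, u) = wcoeff (P_times (\<lambda>i. right_quotient [j] (h i)) i) u" if i: "i < k"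
  proof -
    have "A j (poly_state (P_times h)) (i, u) = wcoeff (P_times h i) (u @ [j]) - (\<Sum>l<k. wcoeff (P $$ (i, l)) (u @ [j]) * wcoeff (h l) [])"
      using i by (simp add: A_def Out_P_times pc) (simp add: poly_state_def)
    also have "\<dots> = wcoeff (P_times (\<lambda>i. right_quotient [j] (h i)) i) u"
      by (simp add: P_times_def wcoeff_sum wcoeff_mult_snoc sum.distrib)
    finally show ?thesis .
  qed
  then show "A j (poly_state (P_times h)) b = poly_state (P_times (\<lambda>i. right_quotient [j] (h i))) b"
    by (simp add: b poly_state_def) (simp add: A_def)
qed

lemma A_word_P_times: "A_word w (poly_state (P_times h)) = poly_state (P_times (\<lambda>i. right_quotient w (h i)))"
proof (induction w)
  case Nil
  have "right_quotient [] p = p" for p :: "'d nc_poly" by (rule nc_poly_eqI) (simp add: wcoeff_right_quotient)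
  then show ?case by simp
next
  case (Cons j w)
  have "right_quotient [j] (right_quotient w p) = right_quotient (j # w) p" for p :: "'d nc_poly" by (rule nc_poly_eqI) (simp add: wcoeff_right_quotient)
  then show ?case by (simp add: Cons A_P_times)
qed

text \<open>
  The shift is a twisted derivation for multiplication by a polynomial on the right: the last letter comes
  from the factor \<open>p\<close>, or from \<open>v\<close> when \<open>p\<close> contributes its constant term.
\<close>

lemma A_column_poly_mult:
  assumes v: "v \<in> V"
  shows "A j (poly_state (\<lambda>i. column_poly v i * p)) = (\<lambda>b. poly_state (\<lambda>i. column_poly v i * right_quotient [j] p) b + wcoeff p [] * A j v b)"
proof
  fix b :: "nat \<times> 'd list"
  obtain i u where b: "b = (i, u)" by force
  have Out: "Out l (poly_state (\<lambda>i. column_poly v i * p)) = Out l v * wcoeff p []" for l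
    by (simp add: Out_def poly_state_def wcoeff_mult_Nil wcoeff_column_poly[OF v] sum_distrib_right mult.assoc)
  have "A j (poly_state (\<lambda>i. column_poly v i * p)) (i, u) = wcoeff (column_poly v i * right_quotient [j] p) u + wcoeff p [] * A j v (i, u)" if i: "i < k"
  proof -
    have "A j (poly_state (\<lambda>i. column_poly v i * p)) (i, u) = wcoeff (column_poly v i * p) (u @ [j]) - (\<Sum>l<k. pc i l (u @ [j]) * (Out l v * wcoeff p []))"
      using i by (simp add: A_def Out) (simp add: poly_state_def)
    also have "\<dots> = wcoeff (column_poly v i * right_quotient [j] p) u + (v (i, u @ [j]) - (\<Sum>l<k. pc i l (u @ [j]) * Out l v)) * wcoeff p []"
      by (simp add: wcoeff_mult_snoc wcoeff_column_poly[OF v] left_diff_distrib sum_distrib_right mult.assoc)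
    finally show ?thesis using i by (simp add: A_def)
  qed
  then show "A j (poly_state (\<lambda>i. column_poly v i * p)) b = poly_state (\<lambda>i. column_poly v i * right_quotient [j] p) b + wcoeff p [] * A j v b"
    by (simp add: b poly_state_def) (simp add: A_def)
qed

lemma strict_degree_right_quotient: "strict_degree {p} \<le> Suc m \<Longrightarrow> strict_degree {right_quotient [j] p} \<le> m"
  by (rule strict_degree_le) (auto simp: wcoeff_right_quotient intro!: strict_degree_zero[of "{p}" p])

text \<open>
  By induction on the degree of \<open>p\<close>: each shift lowers this degree or moves the state within the
  invariant subspace \<open>W\<close>.
\<close>

lemma A_word_column_poly_mult:
  assumes W: "W \<subseteq> V" "\<And>c c' t. c \<in> W \<Longrightarrow> c' \<in> W \<Longrightarrow> (\<lambda>b. c b + t * c' b) \<in> W" "(\<lambda>b. 0) \<in> W"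
      "\<And>c j. c \<in> W \<Longrightarrow> A j c \<in> W"
    and v: "v \<in> W" and p: "strict_degree {p} \<le> length w"
  shows "A_word w (poly_state (\<lambda>i. column_poly v i * p)) \<in> W"
  using v p
proof (induction w arbitrary: v p rule: rev_induct)
  case Nil
  then have "p = 0" using strict_degree_eq_0[of "{p}"] by simp
  then show ?case using W(3) by (simp add: poly_state_zero)
next
  case (snoc j w)
  have inv: "A_word w c \<in> W" if "c \<in> W" for c using that W(4) by (induction w) auto
  have v: "v \<in> V" using snoc.prems W(1) by blast
  have "A_word (w @ [j]) (poly_state (\<lambda>i. column_poly v i * p)) =
     (\<lambda>b. A_word w (poly_state (\<lambda>i. column_poly v i * right_quotient [j] p)) b + wcoeff p [] * A_word w (A j v) b)"
    by (simp add: A_word_append A_column_poly_mult[OF v] linear_op_add[OF linear_op_A_word] linear_op_mult[OF linear_op_A_word])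
  moreover have "A_word w (poly_state (\<lambda>i. column_poly v i * right_quotient [j] p)) \<in> W"
    by (rule snoc.IH[OF snoc.prems(1)]) (use snoc.prems strict_degree_right_quotient in simp)
  ultimately show ?case using W(2) inv[OF W(4)[OF snoc.prems(1)]] by simp
qed

text \<open>
  Let \<open>Vm\<close> be the matrix whose columns span the invariant subspace. Invariance is the relation
  \<open>Vm = P Co + Vm N\<close> with \<open>N\<close> free of constant terms, so \<open>P = F G\<close>, \<open>Vm = F H\<close> and \<open>F = Vm a + P b\<close>. If
  \<open>G\<close> is invertible, then \<open>P\<^sup>-\<^sup>1 Vm = G\<^sup>-\<^sup>1 H\<close> is a polynomial. If \<open>F\<close> is invertible, then
  \<open>1 = Vm a' + P b'\<close>, and multiplying a state by this identity writes it as a combination of columns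
  of \<open>Vm\<close> and \<open>P\<close> with polynomial coefficients, both of which are eventually shifted into the subspace.
\<close>

theorem invariant_subspace_dichotomy:
  assumes J: "finite J" and eV: "\<And>l. l \<in> J \<Longrightarrow> e l \<in> V"
    and inv: "\<And>l j. l \<in> J \<Longrightarrow> A j (e l) = (\<lambda>b. \<Sum>m\<in>J. A j (e l) m * e m b)"
  shows "(\<exists>N. \<forall>l\<in>J. \<forall>w. N \<le> length w \<longrightarrow> (\<forall>i<k. Out i (A_word w (e l)) = 0)) \<or>
      (\<forall>c\<in>V. \<exists>N. \<forall>w. N \<le> length w \<longrightarrow> (\<exists>t. A_word w c = (\<lambda>b. \<Sum>l\<in>J. t l * e l b)))"
proof -
  obtain \<sigma> where \<sigma>: "bij_betw \<sigma> {..<card J} J"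
    using ex_bij_betw_nat_finite[OF J] by (auto simp: lessThan_atLeast0)
  define t where "t = card J"
  have \<sigma>J: "\<sigma> l \<in> J" if "l < t" for l using \<sigma> that by (auto simp: bij_betw_def t_def)
  define Vm where "Vm = mat k t (\<lambda>(a, l). column_poly (e (\<sigma> l)) a)"
  have Vm: "Vm \<in> carrier_mat k t" by (simp add: Vm_def)
  let ?Z = "\<lambda>j. Poly_Mapping.single (Word [j]) 1 :: 'd nc_poly"
  define N where "N m l = (\<Sum>j\<in>UNIV. const_poly (A j (e (\<sigma> l)) (\<sigma> m)) * ?Z j)" for m l
  define Co :: "nat \<Rightarrow> nat \<Rightarrow> 'd nc_poly" where "Co i l = const_poly (Out i (e (\<sigma> l)))" for i l
  have wcoeff_Z: "wcoeff (p * ?Z j) [] = 0" "wcoeff (p * ?Z j) (u @ [i]) = (if i = j then wcoeff p u else 0)" for p i j and u :: "'d list"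
  proof -
    show "wcoeff (p * ?Z j) [] = 0" by (simp add: wcoeff_mult_Nil lookup_single when_def)
    have "wcoeff (p * ?Z j) (u @ [i]) = (\<Sum>s\<le>length u. wcoeff p (take s (u @ [i])) * (if s = length u \<and> i = j then 1 else 0))"
      by (simp add: wcoeff_mult lookup_single when_def)
         (intro sum.cong refl, auto simp: append_eq_Cons_conv)
    also have "\<dots> = (\<Sum>s\<le>length u. if s = length u then (if i = j then wcoeff p u else 0) else 0)"
      by (intro sum.cong refl) auto
    finally show "wcoeff (p * ?Z j) (u @ [i]) = (if i = j then wcoeff p u else 0)" by simp
  qed
  have rel: "Vm $$ (a, l) = (\<Sum>i<k. P $$ (a, i) * Co i l) + (\<Sum>m<t. Vm $$ (a, m) * N m l)" if a: "a < k" and l: "l < t" for a l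
  proof (rule nc_poly_eqI)
    fix w
    have c: "e (\<sigma> l) \<in> V" using eV \<sigma>J[OF l] by blast
    have VN: "wcoeff (\<Sum>m<t. Vm $$ (a, m) * N m l) w = (\<Sum>j\<in>UNIV. \<Sum>m<t. wcoeff (column_poly (e (\<sigma> m)) a * const_poly (A j (e (\<sigma> l)) (\<sigma> m)) * ?Z j) w)"
      unfolding N_def wcoeff_sum sum_distrib_left using a
      by (subst sum.swap) (simp add: Vm_def mult.assoc)
    have PC: "wcoeff (\<Sum>i<k. P $$ (a, i) * Co i l) w = (\<Sum>i<k. pc a i w * Out i (e (\<sigma> l)))"
      unfolding wcoeff_sum Co_def wcoeff_mult_const_poly using a by (simp add: pc)
    have lhs: "wcoeff (Vm $$ (a, l)) w = e (\<sigma> l) (a, w)" using a l by (simp add: Vm_def wcoeff_column_poly[OF c])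
    show "wcoeff (Vm $$ (a, l)) w = wcoeff ((\<Sum>i<k. P $$ (a, i) * Co i l) + (\<Sum>m<t. Vm $$ (a, m) * N m l)) w"
    proof (cases w rule: rev_cases)
      case Nil
      have "(\<Sum>i<k. pc a i [] * Out i (e (\<sigma> l))) = (\<Sum>i<k. \<Sum>m<k. pc a i [] * pinv i m * e (\<sigma> l) (m, []))"
        by (simp add: Out_def sum_distrib_left mult.assoc)
      also have "\<dots> = (\<Sum>m<k. (\<Sum>i<k. pc a i [] * pinv i m) * e (\<sigma> l) (m, []))"
        by (subst sum.swap) (simp add: sum_distrib_right)
      also have "\<dots> = (\<Sum>m<k. if a = m then e (\<sigma> l) (m, []) else 0)"
        by (intro sum.cong refl) (simp add: pinv a)
      finally show ?thesis unfolding lookup_add VN PC lhs using a by (simp add: Nil wcoeff_Z)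
    next
      case (snoc u i)
      have "(\<Sum>j\<in>UNIV. \<Sum>m<t. wcoeff (column_poly (e (\<sigma> m)) a * const_poly (A j (e (\<sigma> l)) (\<sigma> m)) * ?Z j) w) =
        (\<Sum>j\<in>UNIV. if j = i then (\<Sum>m<t. e (\<sigma> m) (a, u) * A j (e (\<sigma> l)) (\<sigma> m)) else 0)"
        unfolding snoc wcoeff_Z using eV[OF \<sigma>J] by (intro sum.cong refl) (auto simp: wcoeff_mult_const_poly wcoeff_column_poly)
      also have "\<dots> = (\<Sum>m<t. A i (e (\<sigma> l)) (\<sigma> m) * e (\<sigma> m) (a, u))" by (simp add: mult.commute)
      also have "\<dots> = (\<Sum>m\<in>J. A i (e (\<sigma> l)) m * e m (a, u))"
        using sum.reindex_bij_betw[OF \<sigma>, of "\<lambda>m. A i (e (\<sigma> l)) m * e m (a, u)"] by (simp add: t_def)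
      also have "\<dots> = A i (e (\<sigma> l)) (a, u)" using inv[OF \<sigma>J[OF l], of i] by (simp add: fun_eq_iff)
      also have "\<dots> = e (\<sigma> l) (a, u @ [i]) - (\<Sum>m<k. pc a m (u @ [i]) * Out m (e (\<sigma> l)))" using a by (simp add: A_def)
      finally show ?thesis by (simp add: lookup_add VN PC lhs) (simp add: snoc)
    qed
  qed
  have N0: "wcoeff (N m l) [] = 0" for m l by (simp add: N_def wcoeff_sum wcoeff_Z)
  have pinvP: "(\<Sum>l<k. wcoeff (P $$ (i, l)) [] * pinv l m) = (if i = m then 1 else 0)" if "i < k" "m < k" for i m
    using pinv[OF that] that by (simp add: pc)
  obtain F G H a b where carr: "F \<in> carrier_mat k k" "G \<in> carrier_mat k k" "H \<in> carrier_mat k t"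
    "a \<in> carrier_mat t k" "b \<in> carrier_mat k k" and PFG: "P = F * G" and VFH: "Vm = F * H" and FVP: "F = Vm * a + P * b"
    using submodule_factorization[OF P Vm rel N0 pinvP] by blast
  have "F \<in> nc_GL k \<or> G \<in> nc_GL k"
    using atom carr PFG unfolding nc_atom_def by blast
  then show ?thesis
  proof
    assume "G \<in> nc_GL k"
    then obtain G' where G': "G' \<in> carrier_mat k k" "G * G' = 1\<^sub>m k" by (auto simp: nc_GL_def)
    have "P * (G' * H) = F * (G * (G' * H))"
      unfolding PFG using carr G' by (intro assoc_mult_mat) auto
    also have "G * (G' * H) = G * G' * H"
      using carr G' by (intro assoc_mult_mat[symmetric]) auto
    finally have "P * (G' * H) = F * (G * G' * H)" .
    then have PG'H: "P * (G' * H) = Vm" using G' carr VFH by simp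
    have G'H: "G' * H \<in> carrier_mat k t" using G' carr by simp
    define h where "h l i = (G' * H) $$ (i, l)" for l i
    have eh: "e (\<sigma> l) = poly_state (P_times (h l))" if l: "l < t" for l
    proof -
      have "e (\<sigma> l) = poly_state (column_poly (e (\<sigma> l)))" using eV[OF \<sigma>J[OF l]] by (simp add: poly_state_column_poly)
      also have "\<dots> = poly_state (P_times (h l))"
      proof (rule poly_state_cong)
        fix i assume i: "i < k"
        have "column_poly (e (\<sigma> l)) i = Vm $$ (i, l)" using i l by (simp add: Vm_def)
        also have "\<dots> = P_times (h l) i"
          unfolding PG'H[symmetric] mat_mult_entry[OF P G'H i l] P_times_def h_def ..
        finally show "column_poly (e (\<sigma> l)) i = P_times (h l) i" .
      qed
      finally show ?thesis .
    qed
    define M where "M = strict_degree ((\<lambda>(l, i). h l i) ` ({..<t} \<times> {..<k}))"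
    have "Out i (A_word w (e l)) = 0" if "l \<in> J" "M \<le> length w" "i < k" for l w i
    proof -
      obtain l' where l': "l' < t" "l = \<sigma> l'" using \<sigma> \<open>l \<in> J\<close> by (auto simp: bij_betw_def t_def)
      have "Out i (A_word w (e l)) = wcoeff (h l' i) w"
        unfolding l'(2) eh[OF l'(1)] A_word_P_times Out_P_times[OF \<open>i < k\<close>] by (simp add: wcoeff_right_quotient)
      also have "\<dots> = 0"
        by (rule strict_degree_zero[of "(\<lambda>(l, i). h l i) ` ({..<t} \<times> {..<k})"])
           (use that l' in \<open>auto simp: M_def intro!: image_eqI[of _ _ "(l', i)"]\<close>)
      finally show ?thesis .
    qed
    then show ?thesis by blast
  next
    assume "F \<in> nc_GL k"
    then obtain F' where F': "F' \<in> carrier_mat k k" "F * F' = 1\<^sub>m k" by (auto simp: nc_GL_def)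
    define a' where "a' = a * F'"
    define b' where "b' = b * F'"
    have carr': "a' \<in> carrier_mat t k" "b' \<in> carrier_mat k k" using carr F' by (auto simp: a'_def b'_def)
    have "1\<^sub>m k = (Vm * a + P * b) * F'" using F' FVP by simp
    also have "\<dots> = Vm * a * F' + P * b * F'" using Vm P carr F' by (intro add_mult_distrib_mat[of _ k k]) auto
    also have "Vm * a * F' = Vm * a'" unfolding a'_def using Vm carr F' by simp
    also have "P * b * F' = P * b'" unfolding b'_def using P carr F' by simp
    finally have one: "1\<^sub>m k = Vm * a' + P * b'" .
    define W where "W = {c. \<exists>s. c = (\<lambda>b. \<Sum>l\<in>J. s l * e l b)}"
    have WI: "(\<lambda>b. \<Sum>l\<in>J. x l * e l b) \<in> W" for x
      unfolding W_def by (intro CollectI exI[of _ x] refl)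
    have W1: "W \<subseteq> V" unfolding W_def by (auto intro!: V_sum V_mult eV)
    have W2: "(\<lambda>b. c b + x * c' b) \<in> W" if cW: "c \<in> W" "c' \<in> W" for c c' x
    proof -
      obtain s s' where "c = (\<lambda>b. \<Sum>l\<in>J. s l * e l b)" "c' = (\<lambda>b. \<Sum>l\<in>J. s' l * e l b)"
        using cW unfolding W_def by blast
      then have eq: "(\<lambda>b. c b + x * c' b) = (\<lambda>b. \<Sum>l\<in>J. (s l + x * s' l) * e l b)"
        by (simp add: distrib_right sum.distrib sum_distrib_left mult.assoc)
      show ?thesis unfolding eq by (rule WI)
    qed
    have W3: "(\<lambda>b. 0) \<in> W" unfolding W_def by (auto intro!: exI[of _ "\<lambda>_. 0"])
    have W4: "A j c \<in> W" if cW: "c \<in> W" for c j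
    proof -
      obtain s where c: "c = (\<lambda>b. \<Sum>l\<in>J. s l * e l b)" using cW by (auto simp: W_def)
      have "A j c = (\<lambda>b. \<Sum>l\<in>J. s l * A j (e l) b)"
        unfolding c linear_op_sum[OF linear_op_A] linear_op_mult[OF linear_op_A] ..
      also have "\<dots> = (\<lambda>b. \<Sum>l\<in>J. \<Sum>m\<in>J. s l * A j (e l) m * e m b)"
      proof (intro ext sum.cong refl)
        fix b l assume "l \<in> J"
        have "A j (e l) b = (\<Sum>m\<in>J. A j (e l) m * e m b)" using fun_cong[OF inv[OF \<open>l \<in> J\<close>, of j], of b] .
        then show "s l * A j (e l) b = (\<Sum>m\<in>J. s l * A j (e l) m * e m b)"
          by (simp add: sum_distrib_left mult.assoc)
      qed
      also have "\<dots> = (\<lambda>b. \<Sum>m\<in>J. (\<Sum>l\<in>J. s l * A j (e l) m) * e m b)"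
        by (rule ext, subst sum.swap) (simp add: sum_distrib_right)
      finally have eq: "A j c = (\<lambda>b. \<Sum>m\<in>J. (\<Sum>l\<in>J. s l * A j (e l) m) * e m b)" .
      show ?thesis unfolding eq by (rule WI)
    qed
    have eW: "e l \<in> W" if "l \<in> J" for l
    proof -
      have "(\<Sum>m\<in>J. (if m = l then 1 else 0) * e m b) = (\<Sum>m\<in>J. if m = l then e l b else 0)" for b
        by (intro sum.cong refl) auto
      then have "(\<lambda>b. \<Sum>m\<in>J. (if m = l then 1 else 0) * e m b) = e l" using that J by simp
      then show ?thesis using WI[of "\<lambda>m. if m = l then 1 else 0"] by simp
    qed
    have Wsum: "(\<lambda>b. \<Sum>l\<in>I. x l b) \<in> W" if "\<And>l. l \<in> I \<Longrightarrow> x l \<in> W" for I :: "nat set" and x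
      using that
    proof (induction I rule: infinite_finite_induct)
      case (insert l I)
      then show ?case using W2[of "x l" "\<lambda>b. \<Sum>l\<in>I. x l b" 1] by simp
    qed (use W3 in auto)
    have "\<exists>M. \<forall>w. M \<le> length w \<longrightarrow> (\<exists>s. A_word w c = (\<lambda>b. \<Sum>l\<in>J. s l * e l b))" if c: "c \<in> V" for c
    proof -
      define g where "g l = (\<Sum>i<k. a' $$ (l, i) * column_poly c i)" for l
      define h where "h l = (\<Sum>i<k. b' $$ (l, i) * column_poly c i)" for l
      define M where "M = strict_degree (g ` {..<t} \<union> h ` {..<k})"
      have split: "column_poly c x = (\<Sum>l<t. column_poly (e (\<sigma> l)) x * g l) + P_times h x" if x: "x < k" for x
      proof -
        have "column_poly c x = (\<Sum>i<k. 1\<^sub>m k $$ (x, i) * column_poly c i)"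
        proof -
          have "(\<Sum>i<k. 1\<^sub>m k $$ (x, i) * column_poly c i) = (\<Sum>i<k. if i = x then column_poly c i else 0)"
            using x by (intro sum.cong refl) auto
          then show ?thesis using x by simp
        qed
        also have "\<dots> = (\<Sum>i<k. (\<Sum>l<t. Vm $$ (x, l) * a' $$ (l, i)) * column_poly c i + (\<Sum>l<k. P $$ (x, l) * b' $$ (l, i)) * column_poly c i)"
        proof (intro sum.cong refl)
          fix i assume "i \<in> {..<k}"
          then have i: "i < k" by simp
          have "1\<^sub>m k $$ (x, i) = (Vm * a') $$ (x, i) + (P * b') $$ (x, i)"
            unfolding one using x i Vm P carr' by simp
          then show "1\<^sub>m k $$ (x, i) * column_poly c i = (\<Sum>l<t. Vm $$ (x, l) * a' $$ (l, i)) * column_poly c i + (\<Sum>l<k. P $$ (x, l) * b' $$ (l, i)) * column_poly c i"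
            unfolding mat_mult_entry[OF Vm carr'(1) x i] mat_mult_entry[OF P carr'(2) x i] by (simp add: distrib_right)
        qed
        also have "\<dots> = (\<Sum>i<k. \<Sum>l<t. Vm $$ (x, l) * (a' $$ (l, i) * column_poly c i)) + (\<Sum>i<k. \<Sum>l<k. P $$ (x, l) * (b' $$ (l, i) * column_poly c i))"
          by (simp add: sum.distrib sum_distrib_right mult.assoc)
        also have "\<dots> = (\<Sum>l<t. Vm $$ (x, l) * g l) + (\<Sum>l<k. P $$ (x, l) * h l)"
          unfolding g_def h_def sum_distrib_left by (intro arg_cong2[of _ _ _ _ "(+)"] sum.swap)
        finally show ?thesis using x by (simp add: P_times_def Vm_def)
      qed
      have "c = poly_state (\<lambda>x. (\<Sum>l<t. column_poly (e (\<sigma> l)) x * g l) + P_times h x)"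
        using poly_state_cong[of "column_poly c", OF split] poly_state_column_poly[OF c] by simp
      then have ceq: "c = (\<lambda>b. (\<Sum>l<t. poly_state (\<lambda>x. column_poly (e (\<sigma> l)) x * g l) b) + poly_state (P_times h) b)"
        by (simp only: poly_state_add poly_state_sum)
      have "A_word w c \<in> W" if w: "M \<le> length w" for w
      proof -
        have "right_quotient w (h i) = 0" if "i < k" for i
        proof (rule nc_poly_eqI)
          fix u
          have "wcoeff (h i) (u @ w) = 0"
            by (rule strict_degree_zero[of "g ` {..<t} \<union> h ` {..<k}"]) (use that w in \<open>auto simp: M_def\<close>)
          then show "wcoeff (right_quotient w (h i)) u = wcoeff 0 u" by (simp add: wcoeff_right_quotient)
        qed
        then have "A_word w (poly_state (P_times h)) = poly_state (\<lambda>i. 0)"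
          unfolding A_word_P_times by (intro poly_state_cong) (simp add: P_times_def)
        then have "A_word w c = (\<lambda>b. \<Sum>l<t. A_word w (poly_state (\<lambda>x. column_poly (e (\<sigma> l)) x * g l)) b)"
          by (subst ceq) (simp add: linear_op_add[OF linear_op_A_word] linear_op_sum[OF linear_op_A_word] poly_state_zero)
        moreover have "A_word w (poly_state (\<lambda>x. column_poly (e (\<sigma> l)) x * g l)) \<in> W" if "l < t" for l
        proof (rule A_word_column_poly_mult[OF W1 W2 W3 W4 eW[OF \<sigma>J[OF that]]])
          show "strict_degree {g l} \<le> length w"
            by (rule strict_degree_le) (use strict_degree_zero[of "g ` {..<t} \<union> h ` {..<k}" "g l"] that w in \<open>auto simp: M_def\<close>)
        qed
        ultimately show ?thesis using Wsum[of "{..<t}"] by simp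
      qed
      then show ?thesis unfolding W_def by blast
    qed
    then show ?thesis by blast
  qed
qed

lemma atom_bounded_growth: "i < k \<Longrightarrow> bounded_growth (Out i)"
  using invariant_subspace_dichotomy by (rule bounded_growth_Out)

end

end

section \<open>Evaluation on the ball and bounded quotients\<close>

lemma sum_blocks: "(\<Sum>p<k * n. f p) = (\<Sum>l<k. \<Sum>b<n. f (l * n + b :: nat))"
proof -
  have "sum f {l * n..<l * n + n} = (\<Sum>b<n. f (l * n + b))" for l
    using sum.shift_bounds_nat_ivl[of f 0 "l * n" n] by (simp add: lessThan_atLeast0 add.commute)
  then show ?thesis by (simp only: sum.nat_group[symmetric])
qed

lemma block_index: "i < k \<Longrightarrow> a < n \<Longrightarrow> i * n + a < k * (n::nat)"
  by (metis add.commute add_mult_distrib2 add_strict_left_mono less_le_trans mult.commute mult_Suc mult_le_mono1 Suc_leI)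

lemma word_eval_carrier:
  assumes "Z \<in> nc_universe" shows "word_eval w Z \<in> carrier_mat (fst Z) (fst Z)"
proof -
  obtain n X where Z: "Z = (n, X)" by force
  have X: "X j \<in> carrier_mat n n" for j using assms by (auto simp: nc_universe_def Z)
  have "foldr (*) (map X u) (1\<^sub>m n) \<in> carrier_mat n n" for u
    by (induction u) (auto intro!: mult_carrier_mat[OF X])
  then show ?thesis by (simp add: word_eval_def mat_list_prod_def Z)
qed

lemma word_eval_plus:
  assumes "Z \<in> nc_universe" shows "word_eval (u + w) Z = word_eval u Z * word_eval w Z"
proof -
  obtain n X where Z: "Z = (n, X)" by force
  have X: "X j \<in> carrier_mat n n" for j using assms by (auto simp: nc_universe_def Z)
  have carr: "foldr (*) (map X u) (1\<^sub>m n) \<in> carrier_mat n n" for u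
    by (induction u) (auto intro!: mult_carrier_mat[OF X])
  have "foldr (*) (map X (u @ w)) (1\<^sub>m n) = foldr (*) (map X u) (1\<^sub>m n) * foldr (*) (map X w) (1\<^sub>m n)" for u w
  proof (induction u)
    case Nil show ?case using carr[of w] by simp
  next
    case (Cons j u)
    then show ?case using assoc_mult_mat[OF X carr carr, of j u w] by simp
  qed
  then show ?thesis by (simp add: word_eval_def mat_list_prod_def Z plus_word_def)
qed

text \<open>
  The entries of the matrix \<open>p(Z)\<close>, as a function of the polynomial \<open>p\<close>.
\<close>

definition poly_entry :: "'d nc_point \<Rightarrow> 'd nc_poly \<Rightarrow> nat \<Rightarrow> nat \<Rightarrow> complex" where
  "poly_entry Z p a b = (\<Sum>w\<in>Poly_Mapping.keys p. Poly_Mapping.lookup p w * word_eval w Z $$ (a, b))"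

lemma poly_entry_superset:
  "finite K \<Longrightarrow> Poly_Mapping.keys p \<subseteq> K \<Longrightarrow> poly_entry Z p a b = (\<Sum>w\<in>K. Poly_Mapping.lookup p w * word_eval w Z $$ (a, b))"
  unfolding poly_entry_def by (rule sum.mono_neutral_left) (auto simp: in_keys_iff)

lemma poly_entry_add: "poly_entry Z (p + q) a b = poly_entry Z p a b + poly_entry Z q a b"
proof -
  let ?K = "Poly_Mapping.keys p \<union> Poly_Mapping.keys q"
  have "poly_entry Z (p + q) a b = (\<Sum>w\<in>?K. Poly_Mapping.lookup (p + q) w * word_eval w Z $$ (a, b))"
    by (rule poly_entry_superset) (auto simp: keys_add)
  also have "\<dots> = (\<Sum>w\<in>?K. Poly_Mapping.lookup p w * word_eval w Z $$ (a, b)) + (\<Sum>w\<in>?K. Poly_Mapping.lookup q w * word_eval w Z $$ (a, b))"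
    by (simp add: lookup_add distrib_right sum.distrib)
  also have "\<dots> = poly_entry Z p a b + poly_entry Z q a b"
    using poly_entry_superset[of ?K p Z a b] poly_entry_superset[of ?K q Z a b] by simp
  finally show ?thesis .
qed

lemma poly_entry_zero [simp]: "poly_entry Z 0 a b = 0" by (simp add: poly_entry_def)

lemma poly_entry_sum: "poly_entry Z (\<Sum>i\<in>I. p i) a b = (\<Sum>i\<in>I. poly_entry Z (p i) a b)"
  by (induction I rule: infinite_finite_induct) (simp_all add: poly_entry_add)

lemma poly_entry_single: "poly_entry Z (Poly_Mapping.single w x) a b = x * word_eval w Z $$ (a, b)"
  using poly_entry_superset[of "{w}" "Poly_Mapping.single w x" Z a b] by simp

lemma poly_expand: "(p :: 'd nc_poly) = (\<Sum>w\<in>Poly_Mapping.keys p. Poly_Mapping.single w (Poly_Mapping.lookup p w))"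
  by (rule poly_mapping_eqI) (simp add: lookup_sum lookup_single when_def in_keys_iff)

text \<open>
  Additivity reduces multiplicativity to monomials, where it is concatenation of words.
\<close>

lemma poly_entry_mult:
  assumes Z: "Z \<in> nc_universe" and ab: "a < fst Z" "b < fst Z"
  shows "poly_entry Z (p * q) a b = (\<Sum>c<fst Z. poly_entry Z p a c * poly_entry Z q c b)"
proof -
  let ?p = "Poly_Mapping.lookup p" and ?q = "Poly_Mapping.lookup q"
  have "p * q = (\<Sum>u\<in>Poly_Mapping.keys p. \<Sum>w\<in>Poly_Mapping.keys q. Poly_Mapping.single (u + w) (?p u * ?q w))"
    by (subst (1) poly_expand[of p], subst (1) poly_expand[of q]) (simp add: sum_product mult_single)
  then have "poly_entry Z (p * q) a b = (\<Sum>u\<in>Poly_Mapping.keys p. \<Sum>w\<in>Poly_Mapping.keys q. ?p u * ?q w * (word_eval u Z * word_eval w Z) $$ (a, b))"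
    by (simp add: poly_entry_sum poly_entry_single word_eval_plus[OF Z])
  also have "\<dots> = (\<Sum>u\<in>Poly_Mapping.keys p. \<Sum>w\<in>Poly_Mapping.keys q. \<Sum>c<fst Z. (?p u * word_eval u Z $$ (a, c)) * (?q w * word_eval w Z $$ (c, b)))"
    by (intro sum.cong refl)
       (use ab in \<open>simp add: mat_mult_entry[OF word_eval_carrier[OF Z] word_eval_carrier[OF Z]] sum_distrib_left mult_ac del: index_mult_mat\<close>)
  also have "\<dots> = (\<Sum>c<fst Z. \<Sum>u\<in>Poly_Mapping.keys p. \<Sum>w\<in>Poly_Mapping.keys q. (?p u * word_eval u Z $$ (a, c)) * (?q w * word_eval w Z $$ (c, b)))"
    by (subst sum.swap[of _ "{..<fst Z}"], intro sum.cong refl sum.swap)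
  finally show ?thesis by (simp add: poly_entry_def sum_product)
qed

lemma nc_eval_entry:
  assumes R: "R \<in> carrier_mat k k" and Z: "Z \<in> nc_universe"
    and i: "i < k" "l < k" and a: "a < fst Z" "b < fst Z"
  shows "nc_eval R Z $$ (i * fst Z + a, l * fst Z + b) = poly_entry Z (R $$ (i, l)) a b"
proof -
  let ?n = "fst Z"
  have fin: "finite (nc_support R)"
  proof (rule finite_subset)
    show "nc_support R \<subseteq> (\<Union>i<k. \<Union>l<k. Poly_Mapping.keys (R $$ (i, l)))"
    proof
      fix w assume "w \<in> nc_support R"
      then have "nc_coeff R w \<noteq> 0\<^sub>m k k" using R by (auto simp: nc_support_def)
      then obtain i l where "i < k" "l < k" "nc_coeff R w $$ (i, l) \<noteq> 0"
        using R by (fastforce simp: nc_coeff_def intro!: eq_matI)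
      then show "w \<in> (\<Union>i<k. \<Union>l<k. Poly_Mapping.keys (R $$ (i, l)))"
        using R by (auto simp: nc_coeff_def in_keys_iff)
    qed
  qed simp
  have sub: "Poly_Mapping.keys (R $$ (i, l)) \<subseteq> nc_support R"
  proof
    fix w assume w: "w \<in> Poly_Mapping.keys (R $$ (i, l))"
    have "nc_coeff R w \<noteq> 0\<^sub>m k k"
    proof
      assume "nc_coeff R w = 0\<^sub>m k k"
      then have "nc_coeff R w $$ (i, l) = 0" using i by simp
      then show False using w i R by (simp add: nc_coeff_def in_keys_iff)
    qed
    then show "w \<in> nc_support R" using R by (auto simp: nc_support_def)
  qed
  have n: "?n > 0" using a by simp
  have idx: "i * ?n + a < k * ?n" "l * ?n + b < k * ?n" using i a by (auto intro: block_index)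
  have "nc_eval R Z $$ (i * ?n + a, l * ?n + b) =
    (\<Sum>w\<in>nc_support R. (nc_coeff R w \<otimes>\<^sub>K word_eval w Z) $$ (i * ?n + a, l * ?n + b))"
    using idx R by (simp add: nc_eval_def)
  also have "\<dots> = (\<Sum>w\<in>nc_support R. Poly_Mapping.lookup (R $$ (i, l)) w * word_eval w Z $$ (a, b))"
  proof (intro sum.cong refl)
    fix w
    have dims: "dim_row (word_eval w Z) = ?n" "dim_col (word_eval w Z) = ?n" using word_eval_carrier[OF Z, of w] by auto
    show "(nc_coeff R w \<otimes>\<^sub>K word_eval w Z) $$ (i * ?n + a, l * ?n + b) = Poly_Mapping.lookup (R $$ (i, l)) w * word_eval w Z $$ (a, b)"
      using idx i a R n by (simp add: kronecker_def dims nc_coeff_def)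
  qed
  also have "\<dots> = poly_entry Z (R $$ (i, l)) a b" by (rule poly_entry_superset[OF fin sub, symmetric])
  finally show ?thesis .
qed

lemma nc_eval_carrier: "R \<in> carrier_mat k k \<Longrightarrow> nc_eval R Z \<in> carrier_mat (k * fst Z) (k * fst Z)"
  by (simp add: nc_eval_def)

lemma block_cases:
  assumes "q < k * n" obtains i a where "i < k" "a < n" "q = i * n + (a::nat)"
proof -
  have "n > 0" using assms by (cases n) auto
  then show ?thesis using that[of "q div n" "q mod n"] assms by (simp add: less_mult_imp_div_less mult.commute)
qed

lemma nc_eval_mult:
  assumes P: "P \<in> carrier_mat k k" and R: "R \<in> carrier_mat k k" and Z: "Z \<in> nc_universe"
  shows "nc_eval (P * R) Z = nc_eval P Z * nc_eval R Z"
proof (rule eq_matI)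
  have PR: "P * R \<in> carrier_mat k k" using P R by simp
  note carr = nc_eval_carrier[OF P, of Z] nc_eval_carrier[OF R, of Z] nc_eval_carrier[OF PR, of Z]
  let ?n = "fst Z"
  fix q p assume "q < dim_row (nc_eval P Z * nc_eval R Z)" "p < dim_col (nc_eval P Z * nc_eval R Z)"
  then have qp: "q < k * ?n" "p < k * ?n" using carr by auto
  obtain i a where ia: "i < k" "a < ?n" "q = i * ?n + a" using qp(1) by (rule block_cases)
  obtain l b where lb: "l < k" "b < ?n" "p = l * ?n + b" using qp(2) by (rule block_cases)
  have "(nc_eval P Z * nc_eval R Z) $$ (q, p) = (\<Sum>m<k. \<Sum>c<?n. poly_entry Z (P $$ (i, m)) a c * poly_entry Z (R $$ (m, l)) c b)"
    unfolding mat_mult_entry[OF carr(1,2) qp] sum_blocks unfolding ia(3) lb(3)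
    by (intro sum.cong refl) (simp add: nc_eval_entry[OF P Z] nc_eval_entry[OF R Z] ia lb)
  also have "\<dots> = poly_entry Z ((P * R) $$ (i, l)) a b"
    unfolding mat_mult_entry[OF P R ia(1) lb(1)] poly_entry_sum
    by (intro sum.cong refl) (simp add: poly_entry_mult[OF Z ia(2) lb(2)])
  also have "\<dots> = nc_eval (P * R) Z $$ (q, p)"
    unfolding ia(3) lb(3) by (rule nc_eval_entry[OF PR Z ia(1) lb(1) ia(2) lb(2), symmetric])
  finally show "nc_eval (P * R) Z $$ (q, p) = (nc_eval P Z * nc_eval R Z) $$ (q, p)" ..
qed (use P R in \<open>auto simp: nc_eval_def\<close>)

text \<open>
  Evaluation is multiplicative, and a nonzero product of determinants has nonzero factors.
\<close>

lemma Q_stable_factors: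
  assumes "\<And>R. R \<in> set Ps \<Longrightarrow> R \<in> carrier_mat k k" "Q_stable Q (mat_list_prod k Ps)"
  shows "\<forall>R\<in>set Ps. Q_stable Q R"
  using assms
proof (induction Ps)
  case (Cons R Ps)
  have "foldr (*) Rs (1\<^sub>m k) \<in> carrier_mat k k" if "\<And>R. R \<in> set Rs \<Longrightarrow> R \<in> carrier_mat k k" for Rs :: "'a nc_poly mat list"
    using that by (induction Rs) (auto intro: mult_carrier_mat[of _ k k _ k])
  then have rest: "mat_list_prod k Ps \<in> carrier_mat k k"
    using Cons.prems(1) by (simp add: mat_list_prod_def)
  have R: "R \<in> carrier_mat k k" using Cons.prems by simp
  have "det (nc_eval R Z) * det (nc_eval (mat_list_prod k Ps) Z) \<noteq> 0" if "Z \<in> nc_ball Q" for Z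
  proof -
    have "Z \<in> nc_universe" using that by (simp add: nc_ball_def)
    then have eq: "nc_eval (mat_list_prod k (R # Ps)) Z = nc_eval R Z * nc_eval (mat_list_prod k Ps) Z"
      using nc_eval_mult[OF R rest] by (simp add: mat_list_prod_def)
    have "det (nc_eval (mat_list_prod k (R # Ps)) Z) \<noteq> 0"
      using Cons.prems(2) that by (simp add: Q_stable_def)
    then show ?thesis
      unfolding eq det_mult[OF nc_eval_carrier[OF R] nc_eval_carrier[OF rest]] .
  qed
  then have "Q_stable Q R" "Q_stable Q (mat_list_prod k Ps)" by (auto simp: Q_stable_def)
  with Cons show ?case by simp
qed simp

definition word_coeffs :: "nat \<Rightarrow> 'd nc_poly mat \<Rightarrow> nat \<Rightarrow> nat \<Rightarrow> 'd list \<Rightarrow> complex" where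
  "word_coeffs k R i l u = (if i < k \<and> l < k then wcoeff (R $$ (i, l)) u else 0)"

lemma word_eval_word_apply:
  assumes Z: "Z \<in> nc_universe" and a: "a < fst Z"
  shows "(\<Sum>b<fst Z. word_eval (Word u) Z $$ (a, b) * x b) = word_apply {..<fst Z} (nc_entries Z) u x a"
  using a
proof (induction u arbitrary: a)
  case Nil
  have "(\<Sum>b<fst Z. word_eval (Word []) Z $$ (a, b) * x b) = (\<Sum>b<fst Z. if b = a then x a else 0)"
    using Nil by (intro sum.cong refl) (auto simp: word_eval_def mat_list_prod_def case_prod_unfold)
  then show ?case using Nil by simp
next
  case (Cons j u)
  have X: "snd Z j \<in> carrier_mat (fst Z) (fst Z)" using Z by (auto simp: nc_universe_def)
  have "word_eval (Word (j # u)) Z = snd Z j * word_eval (Word u) Z"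
    by (simp add: word_eval_def mat_list_prod_def case_prod_unfold)
  then have "(\<Sum>b<fst Z. word_eval (Word (j # u)) Z $$ (a, b) * x b) =
      (\<Sum>b<fst Z. \<Sum>c<fst Z. snd Z j $$ (a, c) * word_eval (Word u) Z $$ (c, b) * x b)"
    using Cons.prems by (simp add: mat_mult_entry[OF X word_eval_carrier[OF Z]] sum_distrib_right del: index_mult_mat)
  also have "\<dots> = (\<Sum>c<fst Z. snd Z j $$ (a, c) * (\<Sum>b<fst Z. word_eval (Word u) Z $$ (c, b) * x b))"
    by (subst sum.swap) (simp add: sum_distrib_left mult.assoc)
  also have "\<dots> = (\<Sum>c<fst Z. nc_entries Z j a c * word_apply {..<fst Z} (nc_entries Z) u x c)"
    using Cons by (intro sum.cong refl) (simp add: nc_entries_def)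
  finally show ?case by (simp add: mat_apply_def)
qed

definition unblock :: "nat \<Rightarrow> nat \<Rightarrow> complex vec \<Rightarrow> nat \<Rightarrow> nat \<Rightarrow> complex" where
  "unblock k n v = (\<lambda>l b. if l < k \<and> b < n then v $ (l * n + b) else 0)"

lemma nc_eval_mult_vec:
  fixes R :: "'d::finite nc_poly mat"
  assumes R: "R \<in> carrier_mat k k" and Z: "Z \<in> nc_universe" and v: "v \<in> carrier_vec (k * fst Z)"
    and D: "\<And>i l u. D \<le> length u \<Longrightarrow> word_coeffs k R i l u = 0"
    and ia: "i < k" "a < fst Z"
  shows "(nc_eval R Z *\<^sub>v v) $ (i * fst Z + a) = poly_apply k D (word_coeffs k R) {..<fst Z} (nc_entries Z) (unblock k (fst Z) v) i a"
proof -
  let ?n = "fst Z"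
  have idx: "i * ?n + a < k * ?n" using ia by (rule block_index)
  have poly_entry: "poly_entry Z (R $$ (i, l)) a b = (\<Sum>u\<in>words D. word_coeffs k R i l u * word_eval (Word u) Z $$ (a, b))" if l: "l < k" for l b
  proof -
    have "Poly_Mapping.keys (R $$ (i, l)) \<subseteq> Word ` words D"
    proof
      fix w assume w: "w \<in> Poly_Mapping.keys (R $$ (i, l))"
      have "letters w \<in> words D"
      proof (rule ccontr)
        assume "letters w \<notin> words D"
        then have "word_coeffs k R i l (letters w) = 0" by (intro D) (simp add: words_def)
        then show False using w ia l by (simp add: word_coeffs_def in_keys_iff)
      qed
      then show "w \<in> Word ` words D" by (metis image_eqI word.collapse)
    qed
    then have "poly_entry Z (R $$ (i, l)) a b = (\<Sum>w\<in>Word ` words D. Poly_Mapping.lookup (R $$ (i, l)) w * word_eval w Z $$ (a, b))"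
      by (intro poly_entry_superset) auto
    also have "\<dots> = (\<Sum>u\<in>words D. word_coeffs k R i l u * word_eval (Word u) Z $$ (a, b))"
      using ia l by (subst sum.reindex) (auto simp: inj_on_def word_coeffs_def)
    finally show ?thesis .
  qed
  have "(nc_eval R Z *\<^sub>v v) $ (i * ?n + a) = (\<Sum>p<k * ?n. nc_eval R Z $$ (i * ?n + a, p) * v $ p)"
    using idx v nc_eval_carrier[OF R, of Z] by (simp add: scalar_prod_def lessThan_atLeast0)
  also have "\<dots> = (\<Sum>l<k. \<Sum>b<?n. poly_entry Z (R $$ (i, l)) a b * unblock k ?n v l b)"
    unfolding sum_blocks by (intro sum.cong refl) (simp add: nc_eval_entry[OF R Z] ia unblock_def)
  also have "\<dots> = (\<Sum>l<k. \<Sum>u\<in>words D. word_coeffs k R i l u * (\<Sum>b<?n. word_eval (Word u) Z $$ (a, b) * unblock k ?n v l b))"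
  proof (intro sum.cong refl)
    fix l assume "l \<in> {..<k}"
    then have "(\<Sum>b<?n. poly_entry Z (R $$ (i, l)) a b * unblock k ?n v l b) =
      (\<Sum>b<?n. \<Sum>u\<in>words D. word_coeffs k R i l u * word_eval (Word u) Z $$ (a, b) * unblock k ?n v l b)"
      by (simp add: poly_entry sum_distrib_right)
    also have "\<dots> = (\<Sum>u\<in>words D. word_coeffs k R i l u * (\<Sum>b<?n. word_eval (Word u) Z $$ (a, b) * unblock k ?n v l b))"
      by (subst sum.swap) (simp add: sum_distrib_left mult.assoc)
    finally show "(\<Sum>b<?n. poly_entry Z (R $$ (i, l)) a b * unblock k ?n v l b) =
      (\<Sum>u\<in>words D. word_coeffs k R i l u * (\<Sum>b<?n. word_eval (Word u) Z $$ (a, b) * unblock k ?n v l b))" .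
  qed
  finally show ?thesis by (simp add: poly_apply_def word_eval_word_apply[OF Z ia(2)])
qed

lemma vec_norm_blocks:
  assumes "v \<in> carrier_vec (k * n)" shows "vec_norm v = block_norm k {..<n} (unblock k n v)"
proof -
  have "(\<Sum>p<k * n. (cmod (v $ p))\<^sup>2) = (\<Sum>l<k. \<Sum>b<n. (cmod (unblock k n v l b))\<^sup>2)"
    unfolding sum_blocks by (intro sum.cong refl) (simp add: unblock_def)
  then show ?thesis using assms by (simp add: vec_norm_def block_norm_def L2_set_def sum_nonneg)
qed

lemma word_apply_cong:
  assumes "\<And>j a b. a \<in> S \<Longrightarrow> b \<in> S \<Longrightarrow> X j a b = Y j a b" "a \<in> S"
  shows "word_apply S X u v a = word_apply S Y u v a"
  using assms(2) by (induction u arbitrary: a) (auto simp: mat_apply_def assms(1))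

lemma poly_apply_cong:
  assumes "\<And>j a b. a \<in> S \<Longrightarrow> b \<in> S \<Longrightarrow> X j a b = Y j a b" "a \<in> S"
  shows "poly_apply k D pc S X \<xi> i a = poly_apply k D pc S Y \<xi> i a"
proof -
  have "word_apply S X u v a = word_apply S Y u v a" for u v by (rule word_apply_cong) (use assms in auto)
  then show ?thesis by (simp add: poly_apply_def)
qed

text \<open>
  A tuple of norm at most \<open>r < 1\<close> is a point of the open ball, where the determinant does
  not vanish.
\<close>

lemma stable_functional:
  fixes R :: "'d::finite nc_poly mat" and X :: "'d \<Rightarrow> nat \<Rightarrow> nat \<Rightarrow> complex"
  assumes R: "R \<in> carrier_mat k k" and st: "Q_stable Q R"
    and D: "\<And>i l u. D \<le> length u \<Longrightarrow> word_coeffs k R i l u = 0"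
    and X: "tuple_norm_le Q r {..<n} X" and r: "r < 1" and zero: "block_norm k {..<n} (poly_apply k D (word_coeffs k R) {..<n} X \<xi>) = 0"
  shows "block_norm k {..<n} \<xi> = 0"
proof (cases "n = 0")
  case True then show ?thesis by (simp add: block_norm_def L2_set_def)
next
  case False
  define Z where "Z = (n, \<lambda>j. mat n n (\<lambda>(a, b). X j a b))"
  have fZ: "fst Z = n" by (simp add: Z_def)
  have U: "Z \<in> nc_universe" using False by (auto simp: nc_universe_def Z_def)
  have eq: "X j a b = nc_entries Z j a b" if "a \<in> {..<n}" "b \<in> {..<n}" for j a b
    using that by (simp add: nc_entries_def Z_def)
  have ball: "Z \<in> nc_ball Q"
    by (rule tuple_norm_le_imp_nc_ball[OF U _ r]) (use tuple_norm_le_cong[OF X eq] fZ in simp)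
  define v where "v = vec (k * n) (\<lambda>q. \<xi> (q div n) (q mod n))"
  have v: "v \<in> carrier_vec (k * n)" by (simp add: v_def)
  have un: "unblock k n v l b = \<xi> l b" if "l < k" "b < n" for l b
    using that block_index[OF that] by (simp add: unblock_def v_def)
  have carr: "nc_eval R Z \<in> carrier_mat (k * n) (k * n)" using nc_eval_carrier[OF R, of Z] fZ by simp
  have "nc_eval R Z *\<^sub>v v = 0\<^sub>v (k * n)"
  proof (rule eq_vecI)
    fix q assume "q < dim_vec (0\<^sub>v (k * n) :: complex vec)"
    then have "q < k * n" by simp
    then obtain i a where ia: "i < k" "a < n" "q = i * n + a" by (rule block_cases)
    have "(nc_eval R Z *\<^sub>v v) $ q = poly_apply k D (word_coeffs k R) {..<n} (nc_entries Z) (unblock k n v) i a"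
      using nc_eval_mult_vec[OF R U, of v D i a] D v ia fZ by simp
    also have "\<dots> = poly_apply k D (word_coeffs k R) {..<n} X (unblock k n v) i a"
      by (rule poly_apply_cong) (use eq ia in auto)
    also have "\<dots> = poly_apply k D (word_coeffs k R) {..<n} X \<xi> i a"
    proof -
      have "word_apply {..<n} X u (unblock k n v l) a = word_apply {..<n} X u (\<xi> l) a" if l: "l < k" for u l
        using ia(2)
      proof (induction u arbitrary: a)
        case (Cons j u) then show ?case by (simp add: mat_apply_def)
      qed (simp add: un l)
      then show ?thesis by (simp add: poly_apply_def)
    qed
    also have "\<dots> = 0" using zero ia by (simp add: block_norm_eq_0_iff)
    finally show "(nc_eval R Z *\<^sub>v v) $ q = 0\<^sub>v (k * n) $ q" using \<open>q < k * n\<close> by simp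
  qed (use carr in simp)
  moreover have "det (nc_eval R Z) \<noteq> 0" using st ball by (simp add: Q_stable_def)
  ultimately have "v = 0\<^sub>v (k * n)" using det_0_iff_vec_prod_zero_field[OF carr] v by blast
  then have "\<xi> l b = 0" if "l < k" "b < n" for l b
    using un[OF that] block_index[OF that] that by (simp add: unblock_def)
  then show ?thesis by (simp add: block_norm_eq_0_iff)
qed

text \<open>
  A bound on all vectors, which bounds \<open>mat_norm\<close> and is evidently submultiplicative.
\<close>

definition norm_bounded :: "nat \<Rightarrow> real \<Rightarrow> complex mat \<Rightarrow> bool" where
  "norm_bounded m K M \<longleftrightarrow> M \<in> carrier_mat m m \<and> (\<forall>v\<in>carrier_vec m. vec_norm (M *\<^sub>v v) \<le> K * vec_norm v)"

lemma mat_norm_le: assumes "norm_bounded m K M" "K \<ge> 0" shows "mat_norm M \<le> K"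
  unfolding mat_norm_def operator_norm_def
proof (rule cSUP_least)
  have "0\<^sub>v (dim_col M) \<in> {v \<in> carrier_vec (dim_col M). vec_norm v \<le> 1}" by (simp add: vec_norm_def)
  then show "{v \<in> carrier_vec (dim_col M). vec_norm v \<le> 1} \<noteq> {}" by blast
next
  fix v assume "v \<in> {v \<in> carrier_vec (dim_col M). vec_norm v \<le> 1}"
  then have "vec_norm (M *\<^sub>v v) \<le> K * vec_norm v" "vec_norm v \<le> 1" using assms(1) by (auto simp: norm_bounded_def)
  moreover have "K * vec_norm v \<le> K * 1" using assms(2) calculation(2) by (intro mult_left_mono) auto
  ultimately show "vec_norm (M *\<^sub>v v) \<le> K" by simp
qed

lemma norm_bounded_prod:
  assumes "\<And>R. R \<in> set Rs \<Longrightarrow> norm_bounded m (K R) (f R)" "\<And>R. R \<in> set Rs \<Longrightarrow> K R \<ge> 0"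
  shows "norm_bounded m (\<Prod>R\<leftarrow>Rs. K R) (mat_list_prod m (map f Rs)) \<and> (\<Prod>R\<leftarrow>Rs. K R) \<ge> 0"
  using assms
proof (induction Rs)
  case Nil show ?case by (simp add: norm_bounded_def mat_list_prod_def)
next
  case (Cons R Rs)
  let ?p = "mat_list_prod m (map f Rs)" and ?K = "\<Prod>R\<leftarrow>Rs. K R"
  have IH: "norm_bounded m ?K ?p" "?K \<ge> 0" using Cons by auto
  have R: "norm_bounded m (K R) (f R)" "K R \<ge> 0" using Cons.prems by auto
  have carr: "f R \<in> carrier_mat m m" "?p \<in> carrier_mat m m" using R IH by (auto simp: norm_bounded_def)
  have "vec_norm (f R * ?p *\<^sub>v v) \<le> K R * ?K * vec_norm v" if v: "v \<in> carrier_vec m" for v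
  proof -
    have pv: "?p *\<^sub>v v \<in> carrier_vec m" using carr v by simp
    have "f R * ?p *\<^sub>v v = f R *\<^sub>v (?p *\<^sub>v v)" using carr v by (rule assoc_mult_mat_vec)
    then have "vec_norm (f R * ?p *\<^sub>v v) \<le> K R * vec_norm (?p *\<^sub>v v)" using R pv by (simp add: norm_bounded_def)
    also have "\<dots> \<le> K R * (?K * vec_norm v)" using IH R v by (intro mult_left_mono) (auto simp: norm_bounded_def)
    finally show ?thesis by (simp add: mult.assoc)
  qed
  then show ?case using carr IH R by (auto simp: norm_bounded_def mat_list_prod_def)
qed

lemma mat_inv_props:
  assumes "M \<in> carrier_mat m m" "det M \<noteq> 0"
  shows "mat_inv M \<in> carrier_mat m m" "M * mat_inv M = 1\<^sub>m m" "mat_inv M * M = 1\<^sub>m m"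
proof -
  have "mat_inverse M \<noteq> None"
    using mat_inverse(1)[OF assms(1), where b = "()"] det_non_zero_imp_unit[OF assms, where b = "()"] by blast
  then obtain N where N: "mat_inverse M = Some N" by auto
  then show "mat_inv M \<in> carrier_mat m m" "M * mat_inv M = 1\<^sub>m m" "mat_inv M * M = 1\<^sub>m m"
    using mat_inverse(2)[OF assms(1) N] by (auto simp: mat_inv_def)
qed

text \<open>
  \<open>R(rZ)\<^sup>-\<^sup>1 R(Z) = 1 + R(rZ)\<^sup>-\<^sup>1 (R(Z) - R(rZ))\<close>, where the first factor of the last term is of order
  \<open>1 / (1 - r)\<close> and the second of order \<open>1 - r\<close>; likewise on the other side.
\<close>

theorem atom_quotients_bounded:
  fixes Q :: "'d::finite \<Rightarrow> 'h::complex_hilbert \<Rightarrow> 'h"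
  assumes basis: "operator_space_basis E Q" and k: "k \<ge> 1" and atom: "nc_atom k R" and st: "Q_stable Q R"
  obtains K where "K \<ge> 0"
    "\<And>r Z. 0 \<le> r \<Longrightarrow> r < 1 \<Longrightarrow> Z \<in> nc_ball Q \<Longrightarrow>
       norm_bounded (k * fst Z) K (mat_inv (nc_dilate r R Z) * nc_eval R Z) \<and>
       norm_bounded (k * fst Z) K (nc_eval R Z * mat_inv (nc_dilate r R Z))"
proof -
  note Q = basis_bounded[OF basis]
  obtain C where C: "coordinate_bound Q C" using basis_coordinates_bounded[OF basis] .
  have R: "R \<in> carrier_mat k k" using atom by (simp add: nc_atom_def)
  define D where "D = Suc (strict_degree ((\<lambda>(i, l). R $$ (i, l)) ` ({..<k} \<times> {..<k})))"
  define pc where "pc = word_coeffs k R"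
  have deg: "pc i l u = 0" if "D \<le> length u" for i l u
  proof (cases "i < k \<and> l < k")
    case True
    have "wcoeff (R $$ (i, l)) u = 0"
      by (rule strict_degree_zero[of "(\<lambda>(i, l). R $$ (i, l)) ` ({..<k} \<times> {..<k})"]) (use that True in \<open>auto simp: D_def\<close>)
    then show ?thesis by (simp add: pc_def word_coeffs_def)
  qed (auto simp: pc_def word_coeffs_def)
  have stable: "block_norm k {..<n} \<xi> = 0" if "r < 1" "tuple_norm_le Q r {..<n::nat} X" "block_norm k {..<n} (poly_apply k D pc {..<n} X \<xi>) = 0" for r n X \<xi>
    by (rule stable_functional[OF R st, of D r n X]) (use deg that in \<open>auto simp: pc_def\<close>)
  define M where "M = mat k k (\<lambda>(i, l). pc i l [])"
  have M: "M \<in> carrier_mat k k" by (simp add: M_def)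
  have "det M \<noteq> 0"
  proof
    assume "det M = 0"
    then obtain v where v: "v \<in> carrier_vec k" "v \<noteq> 0\<^sub>v k" "M *\<^sub>v v = 0\<^sub>v k"
      using det_0_iff_vec_prod_zero_field[OF M] by blast
    let ?X = "\<lambda>(j::'d) (a::nat) (b::nat). 0 :: complex"
    let ?\<xi> = "\<lambda>(l::nat) (a::nat). v $ l"
    have qc: "tuple_norm_le Q 0 {..<1::nat} ?X" by (simp add: tuple_norm_le_def tuple_form_def)
    have ev0: "poly_apply k D pc {..<1} ?X ?\<xi> i a = 0" if i: "i < k" for i and a :: nat
    proof -
      have word_apply: "word_apply {..<1} (?X :: 'd \<Rightarrow> nat \<Rightarrow> nat \<Rightarrow> complex) u w a = (if u = [] then w a else 0)" for u w
        by (cases u) (simp_all add: mat_apply_def)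
      have "poly_apply k D pc {..<1} ?X ?\<xi> i a = (\<Sum>l<k. \<Sum>u\<in>(words D :: 'd list set). if u = [] then pc i l [] * v $ l else 0)"
        unfolding poly_apply_def word_apply by (intro sum.cong refl) simp
      also have "\<dots> = (\<Sum>l<k. pc i l [] * v $ l)"
        by (simp add: sum.delta[OF finite_words]) (simp add: words_def D_def)
      also have "\<dots> = (M *\<^sub>v v) $ i" using i v(1) by (simp add: M_def scalar_prod_def lessThan_atLeast0)
      finally show ?thesis using v i by simp
    qed
    then have nn0: "block_norm k {..<1::nat} (poly_apply k D pc {..<1} ?X ?\<xi>) = 0"
      unfolding block_norm_eq_0_iff[OF finite_lessThan] by blast
    have "block_norm k {..<1::nat} ?\<xi> = 0"
      by (rule stable[where r = 0 and n = 1 and X = ?X and \<xi> = ?\<xi>, OF _ qc nn0]) simp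
    then have "\<forall>l<k. \<forall>a\<in>{..<1::nat}. v $ l = 0"
      unfolding block_norm_eq_0_iff[OF finite_lessThan] .
    then have "v $ l = 0" if "l < k" for l using that by force
    then have "v = 0\<^sub>v k" using v(1) by (intro eq_vecI) auto
    with v(2) show False by contradiction
  qed
  note inv = mat_inv_props[OF M this]
  define pinv where "pinv l m = mat_inv M $$ (l, m)" for l m
  have Me: "M $$ (i, l) = pc i l []" if "i < k" "l < k" for i l using that by (simp add: M_def)
  have pinv1: "(\<Sum>l<k. pc i l [] * pinv l m) = (if i = m then 1 else 0)" if "i < k" "m < k" for i m
  proof -
    have "(\<Sum>l<k. pc i l [] * pinv l m) = (M * mat_inv M) $$ (i, m)"
      unfolding mat_mult_entry[OF M inv(1) that] by (intro sum.cong refl) (simp add: Me pinv_def that)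
    then show ?thesis using that unfolding inv(2) by simp
  qed
  have pinv2: "(\<Sum>l<k. pinv i l * pc l m []) = (if i = m then 1 else 0)" if "i < k" "m < k" for i m
  proof -
    have "(\<Sum>l<k. pinv i l * pc l m []) = (mat_inv M * M) $$ (i, m)"
      unfolding mat_mult_entry[OF inv(1) M that] by (intro sum.cong refl) (simp add: Me pinv_def that)
    then show ?thesis using that unfolding inv(3) by simp
  qed
  interpret nc_system Q C k D pc pinv
  proof (rule nc_system.intro)
    show "k > 0" "D > 0" using k by (simp_all add: D_def)
  qed (fact Q C deg | erule (1) pinv1 | erule (2) stable)+
  have growth: "bounded_growth (Out i)" if "i < k" for i
    by (rule atom_bounded_growth[OF R atom _ pinv2 that]) (auto simp: pc_def word_coeffs_def)
  obtain K1 where K1: "K1 \<ge> 0" "\<And>r n X \<xi>. 0 \<le> r \<Longrightarrow> r < 1 \<Longrightarrow> unit_tuple Q n X \<Longrightarrow> \<forall>l a. n \<le> a \<longrightarrow> \<xi> l a = 0 \<Longrightarrow>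
    (1 - r) * block_norm k {..<n} \<xi> \<le> K1 * block_norm k {..<n} (poly_apply k D pc {..<n} (\<lambda>j a b. complex_of_real r * X j a b) \<xi>)"
    by (rule resolvent_bound[OF growth]) (assumption, rule that)
  obtain K2 where K2: "K2 \<ge> 0" "\<And>r n X \<xi>. 0 \<le> r \<Longrightarrow> r \<le> 1 \<Longrightarrow> unit_tuple Q n X \<Longrightarrow>
    block_norm k {..<n} (\<lambda>i a. poly_apply k D pc {..<n} X \<xi> i a - poly_apply k D pc {..<n} (\<lambda>j a b. complex_of_real r * X j a b) \<xi> i a)
      \<le> K2 * (1 - r) * block_norm k {..<n} \<xi>"
    by (rule dilation_difference) (rule that)
  show ?thesis
  proof (rule that[of "1 + K1 * K2"])
    show "1 + K1 * K2 \<ge> 0" using K1(1) K2(1) by simp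
    fix r :: real and Z :: "'d nc_point" assume r: "0 \<le> r" "r < 1" and Z: "Z \<in> nc_ball Q"
    define n where "n = fst Z"
    let ?N = "k * n"
    have U: "Z \<in> nc_universe" using Z by (simp add: nc_ball_def)
    have rZ: "nc_scale r Z \<in> nc_ball Q" "nc_entries (nc_scale r Z) = (\<lambda>j a b. complex_of_real r * nc_entries Z j a b)"
      "fst (nc_scale r Z) = n"
      using nc_scale_in_ball[OF Q Z r(1) less_imp_le[OF r(2)]] by (auto simp: n_def)
    have Ur: "nc_scale r Z \<in> nc_universe" using rZ(1) by (simp add: nc_ball_def)
    obtain \<rho> where "\<rho> < 1" "tuple_norm_le Q \<rho> {..<fst Z} (nc_entries Z)" using nc_ball_imp_tuple_norm_le[OF Q Z] .
    then have unit: "unit_tuple Q n (nc_entries Z)" by (auto simp: unit_tuple_def n_def nc_entries_def)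
    define A0 where "A0 = nc_eval R Z"
    define A1 where "A1 = nc_dilate r R Z"
    have A0: "A0 \<in> carrier_mat ?N ?N" using nc_eval_carrier[OF R, of Z] by (simp add: A0_def n_def)
    have A1: "A1 \<in> carrier_mat ?N ?N" using nc_eval_carrier[OF R, of "nc_scale r Z"] by (simp add: A1_def nc_dilate_def rZ)
    have "det A1 \<noteq> 0" using st rZ(1) by (simp add: Q_stable_def A1_def nc_dilate_def)
    note inv = mat_inv_props[OF A1 this]
    define L where "L = mat_inv A1"
    have L: "L \<in> carrier_mat ?N ?N" "A1 * L = 1\<^sub>m ?N" "L * A1 = 1\<^sub>m ?N" using inv by (simp_all add: L_def)
    have ev0: "unblock k n (A0 *\<^sub>v v) i a = poly_apply k D pc {..<n} (nc_entries Z) (unblock k n v) i a"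
      if "v \<in> carrier_vec ?N" "i < k" "a < n" for v i a
      using nc_eval_mult_vec[OF R U, of v D i a] deg that by (simp add: unblock_def A0_def n_def pc_def)
    have ev1: "unblock k n (A1 *\<^sub>v v) i a = poly_apply k D pc {..<n} (\<lambda>j a b. complex_of_real r * nc_entries Z j a b) (unblock k n v) i a"
      if "v \<in> carrier_vec ?N" "i < k" "a < n" for v i a
      using nc_eval_mult_vec[OF R Ur, of v D i a] deg that by (simp add: unblock_def A1_def nc_dilate_def rZ pc_def)
    have L_bound: "(1 - r) * vec_norm (L *\<^sub>v v) \<le> K1 * vec_norm v" if v: "v \<in> carrier_vec ?N" for v
    proof -
      have Lv: "L *\<^sub>v v \<in> carrier_vec ?N" using L v by simp
      have "A1 *\<^sub>v (L *\<^sub>v v) = v" using assoc_mult_mat_vec[OF A1 L(1) v] L(2) v by simp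
      then have "unblock k n v i a = poly_apply k D pc {..<n} (\<lambda>j a b. complex_of_real r * nc_entries Z j a b) (unblock k n (L *\<^sub>v v)) i a"
        if "i < k" "a < n" for i a using ev1[OF Lv that] by simp
      then have "block_norm k {..<n} (poly_apply k D pc {..<n} (\<lambda>j a b. complex_of_real r * nc_entries Z j a b) (unblock k n (L *\<^sub>v v))) = block_norm k {..<n} (unblock k n v)"
        by (intro block_norm_cong) auto
      then show ?thesis
        using K1(2)[OF r unit, of "unblock k n (L *\<^sub>v v)"]
        by (simp add: vec_norm_blocks[OF v] vec_norm_blocks[OF Lv]) (simp add: unblock_def)
    qed
    have diff: "vec_norm (A0 *\<^sub>v v - A1 *\<^sub>v v) \<le> K2 * (1 - r) * vec_norm v" if v: "v \<in> carrier_vec ?N" for v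
    proof -
      have c: "A0 *\<^sub>v v \<in> carrier_vec ?N" "A1 *\<^sub>v v \<in> carrier_vec ?N" using A0 A1 v by auto
      then have cd: "A0 *\<^sub>v v - A1 *\<^sub>v v \<in> carrier_vec ?N" by simp
      have "block_norm k {..<n} (unblock k n (A0 *\<^sub>v v - A1 *\<^sub>v v)) =
        block_norm k {..<n} (\<lambda>i a. poly_apply k D pc {..<n} (nc_entries Z) (unblock k n v) i a - poly_apply k D pc {..<n} (\<lambda>j a b. complex_of_real r * nc_entries Z j a b) (unblock k n v) i a)"
      proof (rule block_norm_cong)
        fix i a assume ia: "i < k" "a \<in> {..<n}"
        then have "i * n + a < dim_vec (A1 *\<^sub>v v)" using A1 block_index[of i k a n] by simp
        from index_minus_vec(1)[OF this, of "A0 *\<^sub>v v"] ia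
        have "unblock k n (A0 *\<^sub>v v - A1 *\<^sub>v v) i a = unblock k n (A0 *\<^sub>v v) i a - unblock k n (A1 *\<^sub>v v) i a"
          unfolding unblock_def by simp
        then show "unblock k n (A0 *\<^sub>v v - A1 *\<^sub>v v) i a = poly_apply k D pc {..<n} (nc_entries Z) (unblock k n v) i a - poly_apply k D pc {..<n} (\<lambda>j a b. complex_of_real r * nc_entries Z j a b) (unblock k n v) i a"
          using ev0[OF v ia(1)] ev1[OF v ia(1)] ia(2) by simp
      qed
      then show ?thesis
        using K2(2)[OF r(1) less_imp_le[OF r(2)] unit, of "unblock k n v"]
        by (simp add: vec_norm_blocks[OF cd] vec_norm_blocks[OF v])
    qed
    have tri: "vec_norm (v + w) \<le> vec_norm v + vec_norm w" if "v \<in> carrier_vec ?N" "w \<in> carrier_vec ?N" for v w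
    proof -
      have "vec_norm (v + w) = l2 {..<?N} (\<lambda>i. v $ i + w $ i)"
        using that by (simp add: vec_norm_def L2_set_def)
      also have "\<dots> \<le> l2 {..<?N} (\<lambda>i. v $ i) + l2 {..<?N} (\<lambda>i. w $ i)" by (rule l2_triangle)
      finally show ?thesis using that by (simp add: vec_norm_def L2_set_def)
    qed
    have cancel: "y = v + (y - v)" if "y \<in> carrier_vec ?N" "v \<in> carrier_vec ?N" for y v :: "complex vec"
      using that by (intro eq_vecI) auto
    have combine: "vec_norm y \<le> (1 + K1 * K2) * vec_norm v"
      if "y = v + x" "v \<in> carrier_vec ?N" "x \<in> carrier_vec ?N" "(1 - r) * vec_norm x \<le> (1 - r) * (K1 * K2 * vec_norm v)" for x y v
    proof -
      have "vec_norm x \<le> K1 * K2 * vec_norm v" using that(4) r by simp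
      then show ?thesis using tri[OF that(2,3)] unfolding that(1) by (simp add: distrib_right)
    qed
    have "vec_norm (L * A0 *\<^sub>v v) \<le> (1 + K1 * K2) * vec_norm v" if v: "v \<in> carrier_vec ?N" for v
    proof (rule combine[OF _ v])
      let ?x = "L *\<^sub>v (A0 *\<^sub>v v - A1 *\<^sub>v v)"
      have c: "A0 *\<^sub>v v \<in> carrier_vec ?N" "A1 *\<^sub>v v \<in> carrier_vec ?N" using A0 A1 v by auto
      have "L *\<^sub>v (A1 *\<^sub>v v) = v" using assoc_mult_mat_vec[OF L(1) A1 v] L(3) v by simp
      then have x: "?x = L * A0 *\<^sub>v v - v"
        using mult_minus_distrib_mat_vec[OF L(1) c] assoc_mult_mat_vec[OF L(1) A0 v] by simp
      have "L * A0 *\<^sub>v v \<in> carrier_vec ?N" using L A0 v by simp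
      then show "L * A0 *\<^sub>v v = v + ?x" unfolding x by (rule cancel[OF _ v])
      show "?x \<in> carrier_vec ?N" using L c by simp
      have "(1 - r) * vec_norm ?x \<le> K1 * vec_norm (A0 *\<^sub>v v - A1 *\<^sub>v v)" by (rule L_bound) (use c in simp)
      also have "\<dots> \<le> K1 * (K2 * (1 - r) * vec_norm v)" by (intro mult_left_mono diff v K1)
      finally show "(1 - r) * vec_norm ?x \<le> (1 - r) * (K1 * K2 * vec_norm v)" by (simp add: mult_ac)
    qed
    moreover have "vec_norm (A0 * L *\<^sub>v v) \<le> (1 + K1 * K2) * vec_norm v" if v: "v \<in> carrier_vec ?N" for v
    proof (rule combine[OF _ v])
      let ?w = "L *\<^sub>v v"
      let ?x = "A0 *\<^sub>v ?w - A1 *\<^sub>v ?w"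
      have w: "?w \<in> carrier_vec ?N" using L v by simp
      have c: "A0 *\<^sub>v ?w \<in> carrier_vec ?N" "A1 *\<^sub>v ?w \<in> carrier_vec ?N" using A0 A1 w by auto
      have "A1 *\<^sub>v ?w = v" using assoc_mult_mat_vec[OF A1 L(1) v] L(2) v by simp
      then have x: "?x = A0 * L *\<^sub>v v - v" using assoc_mult_mat_vec[OF A0 L(1) v] by simp
      have "A0 * L *\<^sub>v v \<in> carrier_vec ?N" using L A0 v by simp
      then show "A0 * L *\<^sub>v v = v + ?x" unfolding x by (rule cancel[OF _ v])
      show "?x \<in> carrier_vec ?N" using c by simp
      have "(1 - r) * vec_norm ?x \<le> (1 - r) * (K2 * (1 - r) * vec_norm ?w)"
        using r by (intro mult_left_mono diff w) auto
      also have "\<dots> = (1 - r) * (K2 * ((1 - r) * vec_norm ?w))" by (simp add: mult_ac)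
      also have "\<dots> \<le> (1 - r) * (K2 * (K1 * vec_norm v))"
        using r K2(1) by (intro mult_left_mono L_bound v) auto
      finally show "(1 - r) * vec_norm ?x \<le> (1 - r) * (K1 * K2 * vec_norm v)" by (simp add: mult_ac)
    qed
    ultimately show "norm_bounded (k * fst Z) (1 + K1 * K2) (mat_inv (nc_dilate r R Z) * nc_eval R Z) \<and>
       norm_bounded (k * fst Z) (1 + K1 * K2) (nc_eval R Z * mat_inv (nc_dilate r R Z))"
      using L(1) A0 by (auto simp: norm_bounded_def A0_def[symmetric] A1_def[symmetric] L_def[symmetric] n_def[symmetric])
  qed
qed

theorem corollary3p7:
  fixes E :: "('h::complex_hilbert \<Rightarrow> 'h) set"
    and Q :: "'d::finite \<Rightarrow> 'h \<Rightarrow> 'h"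
    and k :: nat
    and P :: "'d nc_poly mat"
    and Ps :: "'d nc_poly mat list"
  assumes "operator_space_basis E Q"
    and "k \<ge> 1"
    and "P \<in> carrier_mat k k"
    and "Q_stable Q P"
    and "Ps \<noteq> []"
    and "\<forall>R\<in>set Ps. nc_atom k R"
    and "P = mat_list_prod k Ps"
  shows "(SUP r\<in>{0..<1::real}. Q_norm Q (\<lambda>Z. mat_list_prod (k * fst Z)
            (map (\<lambda>R. mat_inv (nc_dilate r R Z) * nc_eval R Z) Ps))) < \<infinity>
       \<and> (SUP r\<in>{0..<1::real}. Q_norm Q (\<lambda>Z. mat_list_prod (k * fst Z)
            (map (\<lambda>R. nc_eval R Z * mat_inv (nc_dilate r R Z)) Ps))) < \<infinity>"
proof -
  have "\<forall>R\<in>set Ps. Q_stable Q R"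
    by (rule Q_stable_factors[of _ k]) (use assms in \<open>auto simp: nc_atom_def\<close>)
  then have "\<forall>R\<in>set Ps. \<exists>K\<ge>0. \<forall>r Z. 0 \<le> r \<longrightarrow> r < 1 \<longrightarrow> Z \<in> nc_ball Q \<longrightarrow>
       norm_bounded (k * fst Z) K (mat_inv (nc_dilate r R Z) * nc_eval R Z) \<and>
       norm_bounded (k * fst Z) K (nc_eval R Z * mat_inv (nc_dilate r R Z))"
    using atom_quotients_bounded[OF assms(1,2)] assms(6) by metis
  then obtain K where K: "\<And>R. R \<in> set Ps \<Longrightarrow> K R \<ge> 0" "\<And>R r Z. R \<in> set Ps \<Longrightarrow> 0 \<le> r \<Longrightarrow> r < 1 \<Longrightarrow> Z \<in> nc_ball Q \<Longrightarrow>
       norm_bounded (k * fst Z) (K R) (mat_inv (nc_dilate r R Z) * nc_eval R Z) \<and>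
       norm_bounded (k * fst Z) (K R) (nc_eval R Z * mat_inv (nc_dilate r R Z))"
    by metis
  have finite: "(SUP r\<in>{0..<1::real}. Q_norm Q (F r)) < \<infinity>"
    if "\<And>r Z. 0 \<le> r \<Longrightarrow> r < 1 \<Longrightarrow> Z \<in> nc_ball Q \<Longrightarrow> mat_norm (F r Z) \<le> (\<Prod>R\<leftarrow>Ps. K R)" for F
  proof -
    have "(SUP r\<in>{0..<1::real}. Q_norm Q (F r)) \<le> ereal (\<Prod>R\<leftarrow>Ps. K R)"
      unfolding Q_norm_def using that by (intro SUP_least) auto
    then show ?thesis using le_less_trans by fastforce
  qed
  have bound: "mat_norm (mat_list_prod (k * fst Z) (map (\<lambda>R. mat_inv (nc_dilate r R Z) * nc_eval R Z) Ps)) \<le> (\<Prod>R\<leftarrow>Ps. K R)"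
    "mat_norm (mat_list_prod (k * fst Z) (map (\<lambda>R. nc_eval R Z * mat_inv (nc_dilate r R Z)) Ps)) \<le> (\<Prod>R\<leftarrow>Ps. K R)"
    if "0 \<le> r" "r < 1" "Z \<in> nc_ball Q" for r Z
    using norm_bounded_prod[of Ps "k * fst Z" K "\<lambda>R. mat_inv (nc_dilate r R Z) * nc_eval R Z"]
      norm_bounded_prod[of Ps "k * fst Z" K "\<lambda>R. nc_eval R Z * mat_inv (nc_dilate r R Z)"] K that
    by (auto intro: mat_norm_le)
  show ?thesis by (intro conjI; rule finite; rule bound)
qed

end
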